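(* Let $\mathbb F_\infty$ be the free group on countably infinitely many generators, and let $E\subseteq\mathbb F_\infty$ be a Leinert set such that $1_E\in MA(\mathbb F_\infty)\setminus M_{cb}A(\mathbb F_\infty)$. Then the ideals $I(\mathbb F_\infty\setminus E)$ and $I(E)$ are complemented in $A(\mathbb F_\infty)$, but not completely complemented in $A(\mathbb F_\infty)$. Furthermore, the annihilators $I(\mathbb F_\infty\setminus E)^\perp$ and $I(E)^\perp$ are complemented in $VN(\mathbb F_\infty)$, but not completely complemented in $VN(\mathbb F_\infty)$. In particular, if $E=\{x_ix_j^{-1}:1\le i\le j<\infty\}$, where $\{x_i\}_{i\in\mathbb N}$ denotes the free generators of $\mathbb F_\infty$, then $I(E)$ is complemented in $A(\mathbb F_\infty)$ but is not completely weakly complemented.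
   Context: For a locally compact group $G$ with left regular representation $\lambda$ on $L^2(G)$, the Fourier algebra is $A(G)=\{x\mapsto \langle\lambda(x)f\,|\,g\rangle : f,g\in L^2(G)\}$, a Banach algebra under pointwise operations; it is the predual of the group von Neumann algebra $VN(G)=\overline{\mathrm{span}\{\lambda(x):x\in G\}}^{WOT}$ via $\langle u,\lambda(x)\rangle=u(x)$, and carries the norm and operator space structure of this predual. For closed $E\subseteq G$, $I(E)=I_G(E)=\{u\in A(G):u|_E=0\}$, with annihilator $I(E)^\perp\subseteq VN(G)$, and $A_G(E)=\{u|_E:u\in A(G)\}\cong A(G)/I_G(E)$ with the quotient norm. For discrete $G$, $E\subseteq G$ is a Leinert set if $A_G(E)\cong\ell^2(E)$ isomorphically as Banach algebras (pointwise multiplication). $MA(G)$ is the algebra of functions $v:G\to\mathbb C$ with $vA(G)\subseteq A(G)$; $M_{cb}A(G)$ is the set of $v\in MA(G)$ for which $u\mapsto vu$ is completely bounded on $A(G)$. $1_E$ is the indicator function of $E$. A closed subspace $Y$ of an operator space $X$ (such as $A(G)$ or $VN(G)$) is complemented (resp. completely complemented) if there is a bounded (resp. completely bounded) linear map $P$ from $X$ onto $Y$ with $P^2=P$. A closed ideal $I$ of $A(G)$ is completely weakly complemented if $I^\perp$ is completely complemented in $VN(G)$. *)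

theory Defs
  imports "HOL-Analysis.Analysis" "HOL-Algebra.Group"
begin

section \<open>Free groups\<close>

text \<open>
  A letter \<open>(i, True)\<close> stands for the generator \<open>x\<^sub>i\<close> and \<open>(i, False)\<close> for its inverse.
\<close>

definition opposite :: "'i \<times> bool \<Rightarrow> 'i \<times> bool \<Rightarrow> bool" where
  "opposite a b \<longleftrightarrow> fst a = fst b \<and> snd a \<noteq> snd b"

definition reduced_word :: "('i \<times> bool) list \<Rightarrow> bool" where
  "reduced_word w \<longleftrightarrow> successively (\<lambda>a b. \<not> opposite a b) w"

fun push :: "'i \<times> bool \<Rightarrow> ('i \<times> bool) list \<Rightarrow> ('i \<times> bool) list" where
  "push a [] = [a]"
| "push a (b # w) = (if opposite a b then w else a # b # w)"

text \<open>
  For reduced words \<open>u\<close> and \<open>v\<close>, \<open>foldr push u v\<close> is the reduced form of the concatenation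
  of \<open>u\<close> and \<open>v\<close>.
\<close>

definition free_group :: "('i \<times> bool) list monoid" where
  "free_group = \<lparr>carrier = {w. reduced_word w}, mult = foldr push, one = []\<rparr>"

definition free_gen :: "'i \<Rightarrow> ('i \<times> bool) list" where
  "free_gen i = [(i, True)]"

abbreviation F_infinity :: "(nat \<times> bool) list monoid" where
  "F_infinity \<equiv> free_group"

lemma reduced_tl: "reduced_word (a # w) \<Longrightarrow> reduced_word w"
  by (cases w) (auto simp: reduced_word_def)

lemma reduced_push: "reduced_word w \<Longrightarrow> reduced_word (push a w)"
  by (cases w) (auto simp: reduced_word_def successively_Cons)

lemma reduced_foldr_push: "reduced_word v \<Longrightarrow> reduced_word (foldr push u v)"
  by (induction u) (auto intro: reduced_push)

lemma push_push_opposite: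
  assumes "reduced_word w" "opposite a b"
  shows "push a (push b w) = w"
proof (cases w)
  case Nil
  then show ?thesis using assms by simp
next
  case (Cons c v)
  show ?thesis
  proof (cases "opposite b c")
    case True
    then have "a = c" using assms(2) by (auto simp: opposite_def prod_eq_iff)
    then show ?thesis using assms(1) Cons True
      by (cases v) (auto simp: reduced_word_def)
  next
    case False
    then show ?thesis using assms(2) Cons by simp
  qed
qed

lemma foldr_push_push:
  assumes "reduced_word w"
  shows "foldr push (push a v) w = push a (foldr push v w)"
proof (cases v)
  case (Cons b v')
  then show ?thesis
    using push_push_opposite[OF reduced_foldr_push[OF assms], of a b v'] by auto
qed simp

lemma foldr_push_assoc:
  "reduced_word w \<Longrightarrow> foldr push (foldr push u v) w = foldr push u (foldr push v w)"
  by (induction u) (auto simp: foldr_push_push)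

lemma foldr_push_Nil: "reduced_word w \<Longrightarrow> foldr push w [] = w"
proof (induction w)
  case (Cons a w)
  then have "foldr push w [] = w" using reduced_tl[OF Cons.prems] by simp
  then show ?case using Cons.prems by (cases w) (auto simp: reduced_word_def)
qed simp

lemma foldr_push_inverse:
  "reduced_word w \<Longrightarrow> foldr push (rev (map (apsnd Not) w)) w = []"
proof (induction w)
  case (Cons a w)
  have "opposite (apsnd Not a) a" by (cases a) (simp add: opposite_def)
  then show ?case using Cons.IH[OF reduced_tl[OF Cons.prems]] by simp
qed simp

lemma reduced_inverse: "reduced_word w \<Longrightarrow> reduced_word (rev (map (apsnd Not) w))"
  unfolding reduced_word_def successively_rev successively_map
  by (erule successively_mono) (auto simp: opposite_def)

lemma group_free_group: "group (free_group :: ('i \<times> bool) list monoid)"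
proof (rule groupI)
  fix x y z :: "('i \<times> bool) list"
  assume x: "x \<in> carrier free_group" and y: "y \<in> carrier free_group"
    and z: "z \<in> carrier free_group"
  show "x \<otimes>\<^bsub>free_group\<^esub> y \<in> carrier free_group"
    using y by (simp add: free_group_def reduced_foldr_push)
  show "x \<otimes>\<^bsub>free_group\<^esub> y \<otimes>\<^bsub>free_group\<^esub> z = x \<otimes>\<^bsub>free_group\<^esub> (y \<otimes>\<^bsub>free_group\<^esub> z)"
    using z by (simp add: free_group_def foldr_push_assoc)
next
  fix x :: "('i \<times> bool) list"
  assume x: "x \<in> carrier free_group"
  show "\<exists>y\<in>carrier free_group. y \<otimes>\<^bsub>free_group\<^esub> x = \<one>\<^bsub>free_group\<^esub>"
    using x reduced_inverse foldr_push_inverse by (fastforce simp: free_group_def)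
qed (simp_all add: free_group_def reduced_word_def)


section \<open>Square-summable functions and bounded operators\<close>

text \<open>
  Functions on a set \<open>S\<close> are represented by functions on the ambient type vanishing
  outside \<open>S\<close>, and operators on \<open>\<ell>\<^sup>2(S)\<close> by maps that send everything outside
  \<open>\<ell>\<^sup>2(S)\<close> to \<open>0\<close>, so that equality is the intended one.
\<close>

definition ell2 :: "'a set \<Rightarrow> ('a \<Rightarrow> complex) set" where
  "ell2 S = {f. (\<forall>x. x \<notin> S \<longrightarrow> f x = 0) \<and> (\<lambda>x. (cmod (f x))\<^sup>2) summable_on S}"

definition ell2_norm :: "'a set \<Rightarrow> ('a \<Rightarrow> complex) \<Rightarrow> real" where
  "ell2_norm S f = sqrt (\<Sum>\<^sub>\<infinity>x\<in>S. (cmod (f x))\<^sup>2)"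

definition ell2_inner :: "'a set \<Rightarrow> ('a \<Rightarrow> complex) \<Rightarrow> ('a \<Rightarrow> complex) \<Rightarrow> complex" where
  "ell2_inner S f g = (\<Sum>\<^sub>\<infinity>x\<in>S. f x * cnj (g x))"

type_synonym 'a operator = "('a \<Rightarrow> complex) \<Rightarrow> ('a \<Rightarrow> complex)"

definition bounded_operators :: "'a set \<Rightarrow> 'a operator set" where
  "bounded_operators S = {T.
     (\<forall>f\<in>ell2 S. T f \<in> ell2 S) \<and> (\<forall>f. f \<notin> ell2 S \<longrightarrow> T f = (\<lambda>_. 0)) \<and>
     (\<forall>f\<in>ell2 S. \<forall>g\<in>ell2 S. T (\<lambda>x. f x + g x) = (\<lambda>x. T f x + T g x)) \<and>
     (\<forall>c. \<forall>f\<in>ell2 S. T (\<lambda>x. c * f x) = (\<lambda>x. c * T f x)) \<and>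
     (\<exists>C. \<forall>f\<in>ell2 S. ell2_norm S (T f) \<le> C * ell2_norm S f)}"

definition operator_norm :: "'a set \<Rightarrow> 'a operator \<Rightarrow> real" where
  "operator_norm S T = Sup {ell2_norm S (T f) | f. f \<in> ell2 S \<and> ell2_norm S f \<le> 1}"

text \<open>
  The norm of the \<open>n \<times> n\<close> operator matrix \<open>T\<close> acting on the direct sum of \<open>n\<close> copies
  of \<open>\<ell>\<^sup>2(S)\<close>. Only the entries \<open>T i j\<close> with \<open>i, j < n\<close> matter; this is the convention for
  matrices throughout.
\<close>

definition operator_matrix_norm :: "'a set \<Rightarrow> nat \<Rightarrow> (nat \<Rightarrow> nat \<Rightarrow> 'a operator) \<Rightarrow> real" where
  "operator_matrix_norm S n T =
     Sup {L2_set (\<lambda>i. ell2_norm S (\<lambda>x. \<Sum>j<n. T i j (\<xi> j) x)) {..<n} | \<xi>.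
       (\<forall>j<n. \<xi> j \<in> ell2 S) \<and> L2_set (\<lambda>j. ell2_norm S (\<xi> j)) {..<n} \<le> 1}"

definition weak_operator_topology :: "'a set \<Rightarrow> 'a operator topology" where
  "weak_operator_topology S = topology_generated_by
     {{T \<in> bounded_operators S. ell2_inner S (T f) g \<in> U} | f g U.
       f \<in> ell2 S \<and> g \<in> ell2 S \<and> open U}"

text \<open>The operator norm of a complex matrix with a finite index set \<open>I\<close>.\<close>

definition scalar_matrix_norm :: "'i set \<Rightarrow> ('i \<Rightarrow> 'i \<Rightarrow> complex) \<Rightarrow> real" where
  "scalar_matrix_norm I M =
     Sup {L2_set (\<lambda>i. cmod (\<Sum>j\<in>I. M i j * \<xi> j)) I | \<xi>. L2_set (\<lambda>j. cmod (\<xi> j)) I \<le> 1}"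


section \<open>Operator spaces and complemented subspaces\<close>

record 'v operator_space =
  points :: "'v set"
  vadd :: "'v \<Rightarrow> 'v \<Rightarrow> 'v"
  vscale :: "complex \<Rightarrow> 'v \<Rightarrow> 'v"
  vnorm :: "'v \<Rightarrow> real"
  matrix_norm :: "nat \<Rightarrow> (nat \<Rightarrow> nat \<Rightarrow> 'v) \<Rightarrow> real"

definition linear_map :: "'v operator_space \<Rightarrow> ('v \<Rightarrow> 'v) \<Rightarrow> bool" where
  "linear_map X P \<longleftrightarrow> P ` points X \<subseteq> points X \<and>
     (\<forall>u\<in>points X. \<forall>v\<in>points X. P (vadd X u v) = vadd X (P u) (P v)) \<and>
     (\<forall>c. \<forall>u\<in>points X. P (vscale X c u) = vscale X c (P u))"

definition bounded_map :: "'v operator_space \<Rightarrow> ('v \<Rightarrow> 'v) \<Rightarrow> bool" where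
  "bounded_map X P \<longleftrightarrow> linear_map X P \<and>
     (\<exists>C. \<forall>u\<in>points X. vnorm X (P u) \<le> C * vnorm X u)"

definition completely_bounded_map :: "'v operator_space \<Rightarrow> ('v \<Rightarrow> 'v) \<Rightarrow> bool" where
  "completely_bounded_map X P \<longleftrightarrow> linear_map X P \<and>
     (\<exists>C. \<forall>n a. (\<forall>i<n. \<forall>j<n. a i j \<in> points X) \<longrightarrow>
        matrix_norm X n (\<lambda>i j. P (a i j)) \<le> C * matrix_norm X n a)"

definition projection_onto :: "'v operator_space \<Rightarrow> 'v set \<Rightarrow> ('v \<Rightarrow> 'v) \<Rightarrow> bool" where
  "projection_onto X Y P \<longleftrightarrow> P ` points X = Y \<and> (\<forall>u\<in>points X. P (P u) = P u)"

definition complemented :: "'v operator_space \<Rightarrow> 'v set \<Rightarrow> bool" where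
  "complemented X Y \<longleftrightarrow> (\<exists>P. bounded_map X P \<and> projection_onto X Y P)"

definition completely_complemented :: "'v operator_space \<Rightarrow> 'v set \<Rightarrow> bool" where
  "completely_complemented X Y \<longleftrightarrow>
     (\<exists>P. completely_bounded_map X P \<and> projection_onto X Y P)"


section \<open>The group von Neumann algebra and the Fourier algebra of a discrete group\<close>

definition left_regular :: "('a, 'm) monoid_scheme \<Rightarrow> 'a \<Rightarrow> 'a operator" where
  "left_regular G x f =
     (\<lambda>y. if f \<in> ell2 (carrier G) \<and> y \<in> carrier G then f (inv\<^bsub>G\<^esub> x \<otimes>\<^bsub>G\<^esub> y) else 0)"

definition left_regular_span :: "('a, 'm) monoid_scheme \<Rightarrow> 'a operator set" where
  "left_regular_span G =
     {\<lambda>f y. \<Sum>x\<in>A. c x * left_regular G x f y | A c. finite A \<and> A \<subseteq> carrier G}"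

definition VN :: "('a, 'm) monoid_scheme \<Rightarrow> 'a operator set" where
  "VN G = weak_operator_topology (carrier G) closure_of left_regular_span G"

definition coefficient ::
  "('a, 'm) monoid_scheme \<Rightarrow> ('a \<Rightarrow> complex) \<Rightarrow> ('a \<Rightarrow> complex) \<Rightarrow> 'a \<Rightarrow> complex" where
  "coefficient G f g =
     (\<lambda>x. if x \<in> carrier G then ell2_inner (carrier G) (left_regular G x f) g else 0)"

definition fourier_algebra :: "('a, 'm) monoid_scheme \<Rightarrow> ('a \<Rightarrow> complex) set" where
  "fourier_algebra G =
     {coefficient G f g | f g. f \<in> ell2 (carrier G) \<and> g \<in> ell2 (carrier G)}"

text \<open>
  The duality between \<open>A(G)\<close> and \<open>VN(G)\<close>: if \<open>u(x) = \<langle>\<lambda>(x)f | g\<rangle>\<close> then \<open>\<langle>u, T\<rangle> = \<langle>Tf | g\<rangle>\<close>.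
  For \<open>T \<in> VN(G)\<close> this does not depend on the choice of \<open>f\<close> and \<open>g\<close>, see \<open>pairing_coefficient\<close>.
\<close>

definition pairing :: "('a, 'm) monoid_scheme \<Rightarrow> ('a \<Rightarrow> complex) \<Rightarrow> 'a operator \<Rightarrow> complex" where
  "pairing G u T = (THE z. \<exists>f\<in>ell2 (carrier G). \<exists>g\<in>ell2 (carrier G).
     u = coefficient G f g \<and> z = ell2_inner (carrier G) (T f) g)"

definition VN_space :: "('a, 'm) monoid_scheme \<Rightarrow> 'a operator operator_space" where
  "VN_space G = \<lparr>
     points = VN G,
     vadd = (\<lambda>S T f x. S f x + T f x),
     vscale = (\<lambda>c T f x. c * T f x),
     vnorm = operator_norm (carrier G),
     matrix_norm = operator_matrix_norm (carrier G)\<rparr>"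

definition fourier_norm :: "('a, 'm) monoid_scheme \<Rightarrow> ('a \<Rightarrow> complex) \<Rightarrow> real" where
  "fourier_norm G u =
     Sup {cmod (pairing G u T) | T. T \<in> VN G \<and> operator_norm (carrier G) T \<le> 1}"

text \<open>
  The predual operator space structure: a matrix \<open>[u\<^sub>i\<^sub>j]\<close> over \<open>A(G)\<close> is normed as the map
  \<open>T \<mapsto> [\<langle>u\<^sub>i\<^sub>j, T\<rangle>]\<close> from \<open>VN(G)\<close> to the \<open>n \<times> n\<close> matrices, with its completely bounded norm.
\<close>

definition fourier_matrix_norm ::
  "('a, 'm) monoid_scheme \<Rightarrow> nat \<Rightarrow> (nat \<Rightarrow> nat \<Rightarrow> 'a \<Rightarrow> complex) \<Rightarrow> real" where
  "fourier_matrix_norm G n u =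
     Sup {scalar_matrix_norm ({..<n} \<times> {..<m}) (\<lambda>(i, k) (j, l). pairing G (u i j) (T k l)) | m T.
       (\<forall>k<m. \<forall>l<m. T k l \<in> VN G) \<and> operator_matrix_norm (carrier G) m T \<le> 1}"

definition fourier_space :: "('a, 'm) monoid_scheme \<Rightarrow> ('a \<Rightarrow> complex) operator_space" where
  "fourier_space G = \<lparr>
     points = fourier_algebra G,
     vadd = (\<lambda>u v x. u x + v x),
     vscale = (\<lambda>c u x. c * u x),
     vnorm = fourier_norm G,
     matrix_norm = fourier_matrix_norm G\<rparr>"


section \<open>Ideals, multipliers and Leinert sets\<close>

definition ideal_of :: "('a, 'm) monoid_scheme \<Rightarrow> 'a set \<Rightarrow> ('a \<Rightarrow> complex) set" where
  "ideal_of G E = {u \<in> fourier_algebra G. \<forall>x\<in>E. u x = 0}"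

definition annihilator :: "('a, 'm) monoid_scheme \<Rightarrow> ('a \<Rightarrow> complex) set \<Rightarrow> 'a operator set" where
  "annihilator G I = {T \<in> VN G. \<forall>u\<in>I. pairing G u T = 0}"

definition completely_weakly_complemented ::
  "('a, 'm) monoid_scheme \<Rightarrow> ('a \<Rightarrow> complex) set \<Rightarrow> bool" where
  "completely_weakly_complemented G I \<longleftrightarrow>
     completely_complemented (VN_space G) (annihilator G I)"

definition MA :: "('a, 'm) monoid_scheme \<Rightarrow> ('a \<Rightarrow> complex) set" where
  "MA G = {v. (\<forall>x. x \<notin> carrier G \<longrightarrow> v x = 0) \<and>
     (\<forall>u\<in>fourier_algebra G. (\<lambda>x. v x * u x) \<in> fourier_algebra G)}"

definition McbA :: "('a, 'm) monoid_scheme \<Rightarrow> ('a \<Rightarrow> complex) set" where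
  "McbA G = {v \<in> MA G. completely_bounded_map (fourier_space G) (\<lambda>u x. v x * u x)}"

definition restrict_to :: "'a set \<Rightarrow> ('a \<Rightarrow> complex) \<Rightarrow> 'a \<Rightarrow> complex" where
  "restrict_to E u = (\<lambda>x. if x \<in> E then u x else 0)"

definition restriction_algebra :: "('a, 'm) monoid_scheme \<Rightarrow> 'a set \<Rightarrow> ('a \<Rightarrow> complex) set" where
  "restriction_algebra G E = restrict_to E ` fourier_algebra G"

definition restriction_norm :: "('a, 'm) monoid_scheme \<Rightarrow> 'a set \<Rightarrow> ('a \<Rightarrow> complex) \<Rightarrow> real" where
  "restriction_norm G E v =
     Inf {fourier_norm G u | u. u \<in> fourier_algebra G \<and> restrict_to E u = v}"

definition Leinert_set :: "('a, 'm) monoid_scheme \<Rightarrow> 'a set \<Rightarrow> bool" where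
  "Leinert_set G E \<longleftrightarrow> E \<subseteq> carrier G \<and>
     (\<exists>\<Phi>. bij_betw \<Phi> (restriction_algebra G E) (ell2 E) \<and>
        (\<forall>u\<in>restriction_algebra G E. \<forall>v\<in>restriction_algebra G E.
           \<Phi> (\<lambda>x. u x + v x) = (\<lambda>x. \<Phi> u x + \<Phi> v x) \<and>
           \<Phi> (\<lambda>x. u x * v x) = (\<lambda>x. \<Phi> u x * \<Phi> v x)) \<and>
        (\<forall>c. \<forall>u\<in>restriction_algebra G E. \<Phi> (\<lambda>x. c * u x) = (\<lambda>x. c * \<Phi> u x)) \<and>
        (\<exists>C. \<forall>u\<in>restriction_algebra G E. ell2_norm E (\<Phi> u) \<le> C * restriction_norm G E u) \<and>
        (\<exists>C. \<forall>u\<in>restriction_algebra G E. restriction_norm G E u \<le> C * ell2_norm E (\<Phi> u)))"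


section \<open>The duality pairing is well defined\<close>

lemma ell2_inner_summable:
  assumes "f \<in> ell2 S" "g \<in> ell2 S"
  shows "(\<lambda>x. f x * cnj (g x)) summable_on S"
proof -
  have "(\<lambda>x. (cmod (f x))\<^sup>2 + (cmod (g x))\<^sup>2) summable_on S"
    using assms by (intro summable_on_add) (auto simp: ell2_def)
  moreover have "cmod (f x * cnj (g x)) \<le> (cmod (f x))\<^sup>2 + (cmod (g x))\<^sup>2" for x
  proof -
    have "2 * cmod (f x) * cmod (g x) \<le> (cmod (f x))\<^sup>2 + (cmod (g x))\<^sup>2"
      by (rule sum_squares_bound)
    moreover have "0 \<le> cmod (f x) * cmod (g x)" by simp
    ultimately have "cmod (f x) * cmod (g x) \<le> (cmod (f x))\<^sup>2 + (cmod (g x))\<^sup>2"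
      by linarith
    then show ?thesis by (simp only: norm_mult complex_mod_cnj)
  qed
  ultimately have "(\<lambda>x. norm (f x * cnj (g x))) summable_on S"
    by (rule summable_on_comparison_test) simp
  then show ?thesis by (rule abs_summable_summable)
qed

lemma has_sum_finite_sum:
  fixes h :: "'i \<Rightarrow> 'a \<Rightarrow> complex"
  assumes "finite A" "\<And>x. x \<in> A \<Longrightarrow> h x summable_on S"
  shows "((\<lambda>y. \<Sum>x\<in>A. h x y) has_sum (\<Sum>x\<in>A. infsum (h x) S)) S"
  using assms
proof (induction A rule: finite_induct)
  case (insert z B)
  have "((\<lambda>y. h z y + (\<Sum>x\<in>B. h x y)) has_sum (infsum (h z) S + (\<Sum>x\<in>B. infsum (h x) S))) S"
    by (rule has_sum_add[OF has_sum_infsum[OF insert.prems] insert.IH[OF insert.prems]])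
      simp_all
  then show ?case by (simp only: sum.insert[OF insert.hyps])
qed simp

context group
begin

lemma left_regular_in_ell2:
  assumes x: "x \<in> carrier G" and f: "f \<in> ell2 (carrier G)"
  shows "left_regular G x f \<in> ell2 (carrier G)"
proof -
  have bij: "bij_betw (\<lambda>y. inv x \<otimes> y) (carrier G) (carrier G)"
    using x by (intro bij_betwI[where g = "\<lambda>y. x \<otimes> y"]) (auto simp: m_assoc[symmetric])
  have "(\<lambda>y. (cmod (f (inv x \<otimes> y)))\<^sup>2) summable_on carrier G"
    using f summable_on_reindex_bij_betw[OF bij, of "\<lambda>y. (cmod (f y))\<^sup>2"]
    by (simp add: ell2_def)
  then have "(\<lambda>y. (cmod (left_regular G x f y))\<^sup>2) summable_on carrier G"
    using f by (simp add: left_regular_def cong: summable_on_cong)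
  then show ?thesis by (simp add: ell2_def left_regular_def)
qed

lemma inner_left_regular_span:
  assumes A: "finite A" "A \<subseteq> carrier G" and f: "f \<in> ell2 (carrier G)" and g: "g \<in> ell2 (carrier G)"
  shows "ell2_inner (carrier G) (\<lambda>y. \<Sum>x\<in>A. c x * left_regular G x f y) g =
    (\<Sum>x\<in>A. c x * coefficient G f g x)"
proof -
  have s: "(\<lambda>y. c x * (left_regular G x f y * cnj (g y))) summable_on carrier G" if "x \<in> A" for x
    using that A f g
    by (intro summable_on_cmult_right ell2_inner_summable left_regular_in_ell2) auto
  have "ell2_inner (carrier G) (\<lambda>y. \<Sum>x\<in>A. c x * left_regular G x f y) g =
      (\<Sum>\<^sub>\<infinity>y\<in>carrier G. \<Sum>x\<in>A. c x * (left_regular G x f y * cnj (g y)))"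
    by (simp add: ell2_inner_def sum_distrib_right mult.assoc)
  also have "\<dots> = (\<Sum>x\<in>A. \<Sum>\<^sub>\<infinity>y\<in>carrier G. c x * (left_regular G x f y * cnj (g y)))"
    by (rule infsumI[OF has_sum_finite_sum[OF A(1) s]])
  also have "\<dots> = (\<Sum>x\<in>A. c x * coefficient G f g x)"
    using A by (intro sum.cong) (auto simp: coefficient_def ell2_inner_def infsum_cmult_right')
  finally show ?thesis .
qed

lemma inner_VN_unique:
  assumes T: "T \<in> VN G"
    and f: "f \<in> ell2 (carrier G)" and g: "g \<in> ell2 (carrier G)"
    and f': "f' \<in> ell2 (carrier G)" and g': "g' \<in> ell2 (carrier G)"
    and eq: "coefficient G f g = coefficient G f' g'"
  shows "ell2_inner (carrier G) (T f) g = ell2_inner (carrier G) (T f') g'"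
proof (rule ccontr)
  assume "ell2_inner (carrier G) (T f) g \<noteq> ell2_inner (carrier G) (T f') g'"
  from hausdorff[OF this] obtain U U' where U: "open U" "open U'" "U \<inter> U' = {}"
      "ell2_inner (carrier G) (T f) g \<in> U" "ell2_inner (carrier G) (T f') g' \<in> U'"
    by (elim exE conjE)
  define N where "N h k W = {S \<in> bounded_operators (carrier G). ell2_inner (carrier G) (S h) k \<in> W}"
    for h k and W :: "complex set"
  have N: "openin (weak_operator_topology (carrier G)) (N h k W)"
    if "h \<in> ell2 (carrier G)" "k \<in> ell2 (carrier G)" "open W" for h k W
    unfolding weak_operator_topology_def N_def
    by (rule topology_generated_by_Basis, rule CollectI, intro exI conjI, rule refl)
      (use that in simp_all)
  have T_top: "T \<in> topspace (weak_operator_topology (carrier G))"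
    using T by (auto simp: VN_def in_closure_of)
  then have "T \<in> bounded_operators (carrier G)"
    by (auto simp: weak_operator_topology_def)
  then have "T \<in> N f g U \<inter> N f' g' U'" using U by (simp add: N_def)
  moreover have "openin (weak_operator_topology (carrier G)) (N f g U \<inter> N f' g' U')"
    by (intro openin_Int N f g f' g' U)
  moreover have "\<And>V. T \<in> V \<Longrightarrow> openin (weak_operator_topology (carrier G)) V \<Longrightarrow>
      \<exists>S. S \<in> left_regular_span G \<and> S \<in> V"
    using T by (simp add: VN_def in_closure_of)
  ultimately obtain S where S: "S \<in> left_regular_span G" "S \<in> N f g U \<inter> N f' g' U'"
    by meson
  obtain A c where "finite A" "A \<subseteq> carrier G"
      and S_eq: "S = (\<lambda>f y. \<Sum>x\<in>A. c x * left_regular G x f y)"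
    using S(1) by (auto simp: left_regular_span_def)
  then have "ell2_inner (carrier G) (S f) g = ell2_inner (carrier G) (S f') g'"
    using f g f' g' eq by (simp add: inner_left_regular_span)
  then show False using S(2) U(3) by (auto simp: N_def)
qed

lemma pairing_coefficient:
  assumes "T \<in> VN G" "f \<in> ell2 (carrier G)" "g \<in> ell2 (carrier G)"
  shows "pairing G (coefficient G f g) T = ell2_inner (carrier G) (T f) g"
  unfolding pairing_def
proof (rule the_equality)
  fix z
  assume "\<exists>f'\<in>ell2 (carrier G). \<exists>g'\<in>ell2 (carrier G).
    coefficient G f g = coefficient G f' g' \<and> z = ell2_inner (carrier G) (T f') g'"
  then obtain f' g' where "f' \<in> ell2 (carrier G)" "g' \<in> ell2 (carrier G)"
      "coefficient G f g = coefficient G f' g'" "z = ell2_inner (carrier G) (T f') g'"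
    by (elim bexE conjE)
  then show "z = ell2_inner (carrier G) (T f) g"
    using inner_VN_unique[OF assms] by simp
next
  show "\<exists>f'\<in>ell2 (carrier G). \<exists>g'\<in>ell2 (carrier G).
    coefficient G f g = coefficient G f' g' \<and>
    ell2_inner (carrier G) (T f) g = ell2_inner (carrier G) (T f') g'"
    by (rule bexI[OF _ assms(2)], rule bexI[OF _ assms(3)], intro conjI refl)
qed

end

end

theory Submission
  imports Defs
begin

text \<open>
  If \<open>E\<close> is a Leinert set, then \<open>u \<mapsto> 1\<^sub>E u\<close> maps \<open>A(G)\<close> boundedly into \<open>\<ell>\<^sup>2(E) \<subseteq> A(G)\<close>; this map, its
  adjoint \<open>T \<mapsto> \<Sum>\<^sub>x\<^sub>\<in>\<^sub>E T(x) \<lambda>(x)\<close> on \<open>VN(G)\<close> and their complements are the four bounded projections.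

  Conversely let \<open>P\<close> be a completely bounded map on \<open>VN(G)\<close> and let \<open>v(x)\<close> be the coefficient of
  \<open>P(\<lambda>(x))\<close> at \<open>x\<close>. For a scalar matrix \<open>B\<close> the operator matrix with entries \<open>B\<^sub>k\<^sub>l \<lambda>(s\<^sub>k s\<^sub>l\<^sup>-\<^sup>1)\<close> has the norm of \<open>B\<close>,
  and compressing its image under \<open>P\<close> to the vectors \<open>\<delta>(s\<^sub>k)\<close> gives the matrix \<open>B\<^sub>k\<^sub>l v(s\<^sub>k s\<^sub>l\<^sup>-\<^sup>1)\<close>. Hence \<open>v\<close>
  is a bounded Schur multiplier; a dual argument works for \<open>A(G)\<close>. For a projection onto one of the
  four subspaces \<open>v\<close> is \<open>1\<^sub>E\<close> or \<open>1 - 1\<^sub>E\<close>. Since the entries of \<open>T\<close> in \<open>VN(G)\<close> are \<open>T(s t\<^sup>-\<^sup>1)\<close>, a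
  bounded Schur multiplier \<open>1\<^sub>E\<close> lies in \<open>M\<^sub>c\<^sub>bA(G)\<close>, a contradiction.

  For \<open>E = {x\<^sub>i x\<^sub>j\<^sup>-\<^sup>1 : i \<le> j}\<close> the restriction of coefficient functions to \<open>E\<close> is square-summable by
  Haagerup's argument for words of length two, and the multiplier \<open>1\<^sub>E\<close> with \<open>s\<^sub>k = x\<^sub>k\<close> is triangular
  truncation, which is unbounded.
\<close>


text \<open>The expensive step is that u - 1_E u is again in A(G). Since
  \<open>fourier_algebra\<close> consists of single coefficients, its closure under addition is a
  theorem, which in general rests on every normal functional of VN(G) being a vector functional.
  Here the correction 1_E u is square-summable, hence a coefficient of \<open>delta \<one>\<close>,
  and it suffices to absorb a summand of this kind. The real Hilbert space \<open>l2\<close>, the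
  orthogonal projections and the operator square root serve this purpose.

  In the converse direction P is not averaged over the group. Compression to the vectors
  \<open>delta (s k)\<close> reads only the coefficient of P(\<lambda>(x)) at x, and the range of P
  together with idempotence determines this number for each x separately: either \<lambda>(x) lies
  in the subspace and is fixed by P, or all members of the subspace have coefficient 0 at x. The
  same dichotomy holds in A(G) with \<open>delta x\<close> in place of \<lambda>(x).\<close>

section \<open>Elementary estimates for square-summable functions\<close>

lemma ell2I:
  assumes "\<And>x. x \<notin> S \<Longrightarrow> f x = 0"
    and "\<And>F. finite F \<Longrightarrow> F \<subseteq> S \<Longrightarrow> (\<Sum>x\<in>F. (cmod (f x))\<^sup>2) \<le> B"
  shows "f \<in> ell2 S"
proof -
  have "(\<lambda>x. (cmod (f x))\<^sup>2) summable_on S"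
    by (rule nonneg_bdd_above_summable_on) (use assms(2) in \<open>auto intro!: bdd_aboveI\<close>)
  then show ?thesis using assms(1) by (simp add: ell2_def)
qed

lemma ell2_norm_nonneg [simp]: "0 \<le> ell2_norm S f"
  by (simp add: ell2_norm_def infsum_nonneg)

lemma ell2_norm_power2: "(ell2_norm S f)\<^sup>2 = (\<Sum>\<^sub>\<infinity>x\<in>S. (cmod (f x))\<^sup>2)"
  by (simp add: ell2_norm_def infsum_nonneg)

lemma sum_le_ell2_norm:
  assumes "f \<in> ell2 S" "finite F"
  shows "(\<Sum>x\<in>F. (cmod (f x))\<^sup>2) \<le> (ell2_norm S f)\<^sup>2"
proof -
  have "(\<Sum>x\<in>F. (cmod (f x))\<^sup>2) = (\<Sum>x\<in>F \<inter> S. (cmod (f x))\<^sup>2)"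
    using assms by (intro sum.mono_neutral_right) (auto simp: ell2_def)
  also have "\<dots> \<le> (ell2_norm S f)\<^sup>2"
    unfolding ell2_norm_power2
    by (rule finite_sum_le_infsum) (use assms in \<open>auto simp: ell2_def\<close>)
  finally show ?thesis .
qed

lemma cmod_le_ell2_norm: "f \<in> ell2 S \<Longrightarrow> cmod (f x) \<le> ell2_norm S f"
  using sum_le_ell2_norm[of f S "{x}"] by (simp add: power2_le_iff_abs_le)

lemma ell2_norm_le:
  assumes "0 \<le> c" and "\<And>F. finite F \<Longrightarrow> F \<subseteq> S \<Longrightarrow> (\<Sum>x\<in>F. (cmod (f x))\<^sup>2) \<le> c\<^sup>2"
  shows "ell2_norm S f \<le> c"
proof -
  \<comment> \<open>Without summability the infinite sum is 0 by convention, so that case is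
    trivial.\<close>
  have "(\<Sum>\<^sub>\<infinity>x\<in>S. (cmod (f x))\<^sup>2) \<le> c\<^sup>2"
    using assms(2)
    by (cases "(\<lambda>x. (cmod (f x))\<^sup>2) summable_on S")
      (auto intro: infsum_le_finite_sums simp: infsum_not_exists)
  then show ?thesis using assms(1) by (simp add: ell2_norm_def real_le_lsqrt)
qed

lemma ell2_zero [simp]: "(\<lambda>_. 0) \<in> ell2 S"
  by (simp add: ell2_def)

lemma ell2_norm_zero [simp]: "ell2_norm S (\<lambda>_. 0) = 0"
  by (simp add: ell2_norm_def)

lemma ell2_add [simp]:
  assumes "f \<in> ell2 S" "g \<in> ell2 S"
  shows "(\<lambda>x. f x + g x) \<in> ell2 S"
proof (rule ell2I)
  fix F assume F: "finite F" "F \<subseteq> S"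
  have "(\<Sum>x\<in>F. (cmod (f x + g x))\<^sup>2) \<le> (\<Sum>x\<in>F. 2 * (cmod (f x))\<^sup>2 + 2 * (cmod (g x))\<^sup>2)"
  proof (rule sum_mono)
    fix x
    have "(cmod (f x + g x))\<^sup>2 \<le> (cmod (f x) + cmod (g x))\<^sup>2"
      by (intro power_mono norm_triangle_ineq) simp
    also have "\<dots> \<le> 2 * (cmod (f x))\<^sup>2 + 2 * (cmod (g x))\<^sup>2"
      using sum_squares_bound[of "cmod (f x)" "cmod (g x)"] by (simp add: power2_sum)
    finally show "(cmod (f x + g x))\<^sup>2 \<le> 2 * (cmod (f x))\<^sup>2 + 2 * (cmod (g x))\<^sup>2" .
  qed
  also have "\<dots> \<le> 2 * (ell2_norm S f)\<^sup>2 + 2 * (ell2_norm S g)\<^sup>2"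
    using sum_le_ell2_norm[OF assms(1) F(1)] sum_le_ell2_norm[OF assms(2) F(1)]
    by (simp add: sum.distrib sum_distrib_left[symmetric])
  finally show "(\<Sum>x\<in>F. (cmod (f x + g x))\<^sup>2) \<le> 2 * (ell2_norm S f)\<^sup>2 + 2 * (ell2_norm S g)\<^sup>2" .
qed (use assms in \<open>auto simp: ell2_def\<close>)

lemma ell2_cmult [simp]: "f \<in> ell2 S \<Longrightarrow> (\<lambda>x. c * f x) \<in> ell2 S"
  by (auto simp: ell2_def norm_mult power_mult_distrib intro: summable_on_cmult_right)

lemma ell2_uminus [simp]: "f \<in> ell2 S \<Longrightarrow> (\<lambda>x. - f x) \<in> ell2 S"
  by (simp add: ell2_def)

lemma ell2_diff [simp]: "f \<in> ell2 S \<Longrightarrow> g \<in> ell2 S \<Longrightarrow> (\<lambda>x. f x - g x) \<in> ell2 S"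
  using ell2_add[of f S "\<lambda>x. - g x"] by simp

lemma ell2_cnj [simp]: "(\<lambda>x. cnj (f x)) \<in> ell2 S \<longleftrightarrow> f \<in> ell2 S"
  by (simp add: ell2_def)

lemma ell2_norm_cnj [simp]: "ell2_norm S (\<lambda>x. cnj (f x)) = ell2_norm S f"
  by (simp add: ell2_norm_def)

lemma ell2_sum [simp]: "(\<And>i. i \<in> I \<Longrightarrow> f i \<in> ell2 S) \<Longrightarrow> (\<lambda>x. \<Sum>i\<in>I. f i x) \<in> ell2 S"
  by (induction I rule: infinite_finite_induct) auto

lemma ell2_mono: "f \<in> ell2 S \<Longrightarrow> S \<subseteq> T \<Longrightarrow> f \<in> ell2 T"
  by (rule ell2I[where B = "(ell2_norm S f)\<^sup>2"]) (auto simp: ell2_def sum_le_ell2_norm)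

text \<open>Transfers norms between functions on a group carrier and the type \<open>l2\<close>
  below, which lives on the whole ambient type.\<close>

lemma ell2_norm_UNIV: "f \<in> ell2 S \<Longrightarrow> ell2_norm UNIV f = ell2_norm S f"
  unfolding ell2_norm_def
  by (rule arg_cong[where f = sqrt], rule infsum_cong_neutral) (auto simp: ell2_def)

lemma ell2_inner_UNIV: "f \<in> ell2 S \<or> g \<in> ell2 S \<Longrightarrow> ell2_inner UNIV f g = ell2_inner S f g"
  unfolding ell2_inner_def
  by (rule infsum_cong_neutral) (auto simp: ell2_def)

lemma ell2_restrict:
  assumes "f \<in> ell2 S" "A \<subseteq> S"
  shows "(\<lambda>x. if x \<in> A then f x else 0) \<in> ell2 A"
    and "ell2_norm A (\<lambda>x. if x \<in> A then f x else 0) \<le> ell2_norm S f"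
proof -
  have *: "(\<Sum>x\<in>F. (cmod (if x \<in> A then f x else 0))\<^sup>2) \<le> (ell2_norm S f)\<^sup>2" if "finite F" for F
  proof -
    have "(\<Sum>x\<in>F. (cmod (if x \<in> A then f x else 0))\<^sup>2) \<le> (\<Sum>x\<in>F. (cmod (f x))\<^sup>2)"
      by (intro sum_mono) auto
    then show ?thesis using sum_le_ell2_norm[OF assms(1) that] by linarith
  qed
  show "(\<lambda>x. if x \<in> A then f x else 0) \<in> ell2 A"
    by (rule ell2I[where B = "(ell2_norm S f)\<^sup>2"]) (auto simp: * simp del: sum.delta)
  show "ell2_norm A (\<lambda>x. if x \<in> A then f x else 0) \<le> ell2_norm S f"
    by (rule ell2_norm_le) (auto simp: *)
qed

section \<open>Square-summable functions as a real Hilbert space\<close>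

text \<open>A type, so that the library theory of complete inner product spaces and of bounded
  linear maps applies. The inner product is the real part of the complex one; complex information is
  recovered later by testing with complex multiples of vectors.\<close>

typedef 'a l2 = "ell2 (UNIV :: 'a set)"
  by (rule exI[of _ "\<lambda>_. 0"]) simp

lemma Rep_l2_ell2 [simp]: "Rep_l2 f \<in> ell2 UNIV"
  using Rep_l2 by blast

instantiation l2 :: (type) real_inner
begin

definition "0 = Abs_l2 (\<lambda>_. 0)"
definition "f + g = Abs_l2 (\<lambda>x. Rep_l2 f x + Rep_l2 g x)"
definition "- f = Abs_l2 (\<lambda>x. - Rep_l2 f x)"
definition "f - g = Abs_l2 (\<lambda>x. Rep_l2 f x - Rep_l2 g x)"
definition "r *\<^sub>R f = Abs_l2 (\<lambda>x. complex_of_real r * Rep_l2 f x)"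
definition "inner f g = Re (ell2_inner UNIV (Rep_l2 f) (Rep_l2 g))"
definition "norm f = ell2_norm UNIV (Rep_l2 f)"
definition "dist f g = norm (f - g)" for f g :: "'a l2"
definition "sgn f = inverse (norm f) *\<^sub>R f" for f :: "'a l2"
definition "uniformity = (INF e\<in>{0<..}. principal {(f, g :: 'a l2). dist f g < e})"
definition "open U = (\<forall>f\<in>U. eventually (\<lambda>(f', g). f' = f \<longrightarrow> g \<in> U) uniformity)" for U :: "'a l2 set"

lemma Rep_l2_simps [simp]:
  "Rep_l2 0 = (\<lambda>_. 0)"
  "Rep_l2 (f + g) = (\<lambda>x. Rep_l2 f x + Rep_l2 g x)"
  "Rep_l2 (- f) = (\<lambda>x. - Rep_l2 f x)"
  "Rep_l2 (f - g) = (\<lambda>x. Rep_l2 f x - Rep_l2 g x)"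
  "Rep_l2 (r *\<^sub>R f) = (\<lambda>x. complex_of_real r * Rep_l2 f x)"
  by (simp_all add: zero_l2_def plus_l2_def uminus_l2_def minus_l2_def scaleR_l2_def Abs_l2_inverse)

lemma inner_l2_eq: "inner f g = (\<Sum>\<^sub>\<infinity>x. Re (Rep_l2 f x * cnj (Rep_l2 g x)))"
  unfolding inner_l2_def ell2_inner_def by (rule infsum_Re[symmetric]) (simp add: ell2_inner_summable)

lemma summable_inner_l2: "(\<lambda>x. Re (Rep_l2 f x * cnj (Rep_l2 g x))) summable_on UNIV"
  by (intro summable_on_Re ell2_inner_summable) auto

lemma inner_l2_self: "inner f f = (ell2_norm UNIV (Rep_l2 f))\<^sup>2" for f :: "'a l2"
proof -
  have "Re (z * cnj z) = (cmod z)\<^sup>2" for z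
    by (simp add: cmod_power2 flip: power2_eq_square)
  then show ?thesis unfolding inner_l2_eq ell2_norm_power2 by simp
qed

instance
proof
  fix f g h :: "'a l2" and r s :: real
  show "f + g + h = f + (g + h)" "f + g = g + f" "0 + f = f" "- f + f = 0" "f - g = f + - g"
    "r *\<^sub>R (f + g) = r *\<^sub>R f + r *\<^sub>R g" "(r + s) *\<^sub>R f = r *\<^sub>R f + s *\<^sub>R f"
    "r *\<^sub>R s *\<^sub>R f = (r * s) *\<^sub>R f" "1 *\<^sub>R f = f"
    by (simp_all add: Rep_l2_inject[symmetric] algebra_simps)
  show "dist f g = norm (f - g)" "sgn f = inverse (norm f) *\<^sub>R f"
    by (simp_all add: dist_l2_def sgn_l2_def)
  show "uniformity = (INF e\<in>{0<..}. principal {(f, g :: 'a l2). dist f g < e})"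
    by (rule uniformity_l2_def)
  show "open U = (\<forall>f\<in>U. eventually (\<lambda>(f', g). f' = f \<longrightarrow> g \<in> U) uniformity)" for U :: "'a l2 set"
    by (rule open_l2_def)
  show "inner f g = inner g f"
    unfolding inner_l2_eq by (rule infsum_cong) simp
  show "inner (f + g) h = inner f h + inner g h"
    unfolding inner_l2_eq infsum_add[OF summable_inner_l2 summable_inner_l2, symmetric]
    by (rule infsum_cong) (simp add: algebra_simps)
  show "inner (r *\<^sub>R f) g = r * inner f g"
    unfolding inner_l2_eq infsum_cmult_right'[symmetric]
    by (rule infsum_cong) (simp add: algebra_simps)
  show "0 \<le> inner f f" by (simp add: inner_l2_self)
  show "norm f = sqrt (inner f f)" by (simp add: inner_l2_self norm_l2_def)
  show "inner f f = 0 \<longleftrightarrow> f = 0"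
  proof
    assume "inner f f = 0"
    then have "cmod (Rep_l2 f x) = 0" for x
      using cmod_le_ell2_norm[of "Rep_l2 f" UNIV x] by (simp add: inner_l2_self)
    then show "f = 0" by (simp add: Rep_l2_inject[symmetric] fun_eq_iff)
  qed (simp add: inner_l2_self)
qed

end

lemma Abs_l2_add:
  "f \<in> ell2 UNIV \<Longrightarrow> g \<in> ell2 UNIV \<Longrightarrow> Abs_l2 (\<lambda>x. f x + g x) = Abs_l2 f + Abs_l2 g"
  by (simp add: plus_l2_def Abs_l2_inverse)

lemma norm_Abs_l2: "f \<in> ell2 S \<Longrightarrow> norm (Abs_l2 f) = ell2_norm S f"
  by (simp add: norm_l2_def Abs_l2_inverse[OF ell2_mono] ell2_norm_UNIV)

lemma inner_Abs_l2:
  "f \<in> ell2 S \<Longrightarrow> g \<in> ell2 S \<Longrightarrow> inner (Abs_l2 f) (Abs_l2 g) = Re (ell2_inner S f g)"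
  by (simp add: inner_l2_def Abs_l2_inverse[OF ell2_mono] ell2_inner_UNIV[of f S g])

text \<open>A Cauchy sequence converges in each coordinate. On a finite set of coordinates the norm
  estimate survives the limit, and its bound does not depend on the finite set.\<close>

instance l2 :: (type) complete_space
proof
  fix X :: "nat \<Rightarrow> 'a l2"
  assume X: "Cauchy X"
  have le: "cmod (Rep_l2 f x - Rep_l2 g x) \<le> dist f g" for f g :: "'a l2" and x
    using cmod_le_ell2_norm[of "Rep_l2 (f - g)" UNIV x] by (simp add: dist_norm norm_l2_def)
  have "Cauchy (\<lambda>n. Rep_l2 (X n) x)" for x
  proof (rule metric_CauchyI)
    fix e :: real assume "e > 0"
    then obtain N where "\<And>m n. m \<ge> N \<Longrightarrow> n \<ge> N \<Longrightarrow> dist (X m) (X n) < e"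
      using X by (meson metric_CauchyD)
    then show "\<exists>N. \<forall>m\<ge>N. \<forall>n\<ge>N. dist (Rep_l2 (X m) x) (Rep_l2 (X n) x) < e"
      using le by (metis dist_norm order_le_less_trans)
  qed
  then have "\<exists>l. (\<lambda>n. Rep_l2 (X n) x) \<longlonglongrightarrow> l" for x
    by (simp add: Cauchy_convergent_iff convergent_def)
  then obtain f where f: "\<And>x. (\<lambda>n. Rep_l2 (X n) x) \<longlonglongrightarrow> f x"
    by metis
  \<comment> \<open>Stated with finite sums, because the limit \<open>f\<close> is not yet known to
    be square-summable.\<close>
  have key: "\<exists>N. \<forall>n\<ge>N. \<forall>F. finite F \<longrightarrow> (\<Sum>x\<in>F. (cmod (f x - Rep_l2 (X n) x))\<^sup>2) \<le> e\<^sup>2"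
    if e: "e > 0" for e
  proof -
    obtain N where N: "\<And>m n. m \<ge> N \<Longrightarrow> n \<ge> N \<Longrightarrow> dist (X m) (X n) < e"
      using X e by (meson metric_CauchyD)
    show ?thesis
    proof (intro exI[of _ N] allI impI)
      fix n and F :: "'a set" assume n: "n \<ge> N" and F: "finite F"
      have "(\<lambda>m. \<Sum>x\<in>F. (cmod (Rep_l2 (X m) x - Rep_l2 (X n) x))\<^sup>2)
          \<longlonglongrightarrow> (\<Sum>x\<in>F. (cmod (f x - Rep_l2 (X n) x))\<^sup>2)"
        by (intro tendsto_intros f)
      moreover have "eventually (\<lambda>m. (\<Sum>x\<in>F. (cmod (Rep_l2 (X m) x - Rep_l2 (X n) x))\<^sup>2) \<le> e\<^sup>2) sequentially"
      proof (rule eventually_sequentiallyI)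
        fix m assume "m \<ge> N"
        then have "norm (X m - X n) \<le> e" using N n by (simp add: dist_norm less_imp_le)
        then have "(norm (X m - X n))\<^sup>2 \<le> e\<^sup>2" by (simp add: power_mono)
        then show "(\<Sum>x\<in>F. (cmod (Rep_l2 (X m) x - Rep_l2 (X n) x))\<^sup>2) \<le> e\<^sup>2"
          using sum_le_ell2_norm[OF Rep_l2_ell2 F, of "X m - X n"] by (simp add: norm_l2_def)
      qed
      ultimately show "(\<Sum>x\<in>F. (cmod (f x - Rep_l2 (X n) x))\<^sup>2) \<le> e\<^sup>2"
        by (intro tendsto_upperbound) auto
    qed
  qed
  have diff: "(\<lambda>x. f x - Rep_l2 (X n) x) \<in> ell2 UNIV"
    if "\<forall>F. finite F \<longrightarrow> (\<Sum>x\<in>F. (cmod (f x - Rep_l2 (X n) x))\<^sup>2) \<le> e\<^sup>2" for n e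
    using that by (intro ell2I[where B = "e\<^sup>2"]) auto
  obtain n where "\<forall>F. finite F \<longrightarrow> (\<Sum>x\<in>F. (cmod (f x - Rep_l2 (X n) x))\<^sup>2) \<le> 1\<^sup>2"
    using key[of 1] by auto
  from ell2_add[OF diff[OF this] Rep_l2_ell2]
  have "(\<lambda>x. f x - Rep_l2 (X n) x + Rep_l2 (X n) x) \<in> ell2 UNIV" .
  then have fin: "f \<in> ell2 UNIV" by simp
  have "X \<longlonglongrightarrow> Abs_l2 f"
  proof (rule metric_LIMSEQ_I)
    fix r :: real assume "r > 0"
    then obtain N where N: "\<And>n F. n \<ge> N \<Longrightarrow> finite F \<Longrightarrow>
        (\<Sum>x\<in>F. (cmod (f x - Rep_l2 (X n) x))\<^sup>2) \<le> (r/2)\<^sup>2"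
      using key[of "r/2"] by auto
    have "dist (X n) (Abs_l2 f) < r" if "n \<ge> N" for n
    proof -
      have "norm (Abs_l2 f - X n) \<le> r/2"
        unfolding norm_l2_def
        by (rule ell2_norm_le) (use \<open>r > 0\<close> N[OF that] fin in \<open>auto simp: Abs_l2_inverse\<close>)
      then show ?thesis using \<open>r > 0\<close> by (simp add: dist_norm norm_minus_commute)
    qed
    then show "\<exists>N. \<forall>n\<ge>N. dist (X n) (Abs_l2 f) < r" by blast
  qed
  then show "convergent X" by (auto simp: convergent_def)
qed

instance l2 :: (type) banach ..

section \<open>The complex inner product, point masses and truncation\<close>

lemma ell2_inner_cmult_left: "ell2_inner S (\<lambda>x. c * f x) g = c * ell2_inner S f g"
  by (simp add: ell2_inner_def mult.assoc infsum_cmult_right')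

lemma ell2_inner_cmult_right: "ell2_inner S f (\<lambda>x. c * g x) = cnj c * ell2_inner S f g"
  by (simp add: ell2_inner_def mult.left_commute infsum_cmult_right')

lemma ell2_inner_add_left:
  assumes "f \<in> ell2 S" "f' \<in> ell2 S" "g \<in> ell2 S"
  shows "ell2_inner S (\<lambda>x. f x + f' x) g = ell2_inner S f g + ell2_inner S f' g"
  unfolding ell2_inner_def
  using infsum_add[OF ell2_inner_summable[OF assms(1,3)] ell2_inner_summable[OF assms(2,3)]]
  by (simp add: algebra_simps)

lemma ell2_inner_commute: "ell2_inner S f g = cnj (ell2_inner S g f)"
  by (simp add: ell2_inner_def mult.commute flip: infsum_cnj)

lemma ell2_inner_sum_left:
  assumes "finite I" "\<And>i. i \<in> I \<Longrightarrow> f i \<in> ell2 S" "g \<in> ell2 S"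
  shows "ell2_inner S (\<lambda>x. \<Sum>i\<in>I. f i x) g = (\<Sum>i\<in>I. ell2_inner S (f i) g)"
  using assms
  by (induction I rule: finite_induct) (simp_all add: ell2_inner_add_left, simp add: ell2_inner_def)

text \<open>The inequality for the real inner product bounds only the real part. Multiplying
  \<open>f\<close> by the conjugate of the inner product \<open>z\<close> makes the inner product
  equal to the real number |z|^2.\<close>

lemma ell2_cauchy_schwarz:
  assumes f: "f \<in> ell2 S" and g: "g \<in> ell2 S"
  shows "cmod (ell2_inner S f g) \<le> ell2_norm S f * ell2_norm S g"
proof -
  define z where "z = ell2_inner S f g"
  have "cmod z * cmod z \<le> cmod z * (ell2_norm S f * ell2_norm S g)"
  proof -
    have fz: "(\<lambda>x. cnj z * f x) \<in> ell2 S" using f by simp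
    have "cmod z * cmod z = Re (cnj z * z)"
      by (simp add: cmod_power2 flip: power2_eq_square)
    also have "\<dots> = inner (Abs_l2 (\<lambda>x. cnj z * f x)) (Abs_l2 g)"
      by (subst inner_Abs_l2[OF fz g]) (simp only: ell2_inner_cmult_left z_def)
    also have "\<dots> \<le> norm (Abs_l2 (\<lambda>x. cnj z * f x)) * norm (Abs_l2 g)"
      using Cauchy_Schwarz_ineq2 abs_le_D1 by blast
    also have "norm (Abs_l2 (\<lambda>x. cnj z * f x)) = cmod z * ell2_norm S f"
      by (simp add: norm_Abs_l2[OF fz])
        (simp add: ell2_norm_def norm_mult power_mult_distrib infsum_cmult_right' real_sqrt_mult)
    finally show ?thesis by (simp add: norm_Abs_l2[OF g] mult.assoc)
  qed
  then show ?thesis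
    by (cases "cmod z = 0") (auto simp: z_def[symmetric] mult_le_cancel_left)
qed

lemma ell2_norm_cmult: "ell2_norm S (\<lambda>x. c * f x) = cmod c * ell2_norm S f"
  by (simp add: ell2_norm_def norm_mult power_mult_distrib infsum_cmult_right' real_sqrt_mult)

lemma ell2_norm_triangle:
  assumes "f \<in> ell2 S" "g \<in> ell2 S"
  shows "ell2_norm S (\<lambda>x. f x + g x) \<le> ell2_norm S f + ell2_norm S g"
  using norm_triangle_ineq[of "Abs_l2 f" "Abs_l2 g"] assms
  by (simp add: norm_Abs_l2[of _ S] Abs_l2_add[OF ell2_mono[of _ S] ell2_mono[of _ S], symmetric])

lemma ell2_norm_sum:
  assumes "finite I" "\<And>i. i \<in> I \<Longrightarrow> f i \<in> ell2 S"
  shows "ell2_norm S (\<lambda>x. \<Sum>i\<in>I. f i x) \<le> (\<Sum>i\<in>I. ell2_norm S (f i))"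
  using assms
proof (induction I rule: finite_induct)
  case (insert i I)
  then have "ell2_norm S (\<lambda>x. f i x + (\<Sum>i\<in>I. f i x)) \<le> ell2_norm S (f i) + ell2_norm S (\<lambda>x. \<Sum>i\<in>I. f i x)"
    by (intro ell2_norm_triangle ell2_sum) auto
  with insert show ?case by simp
qed simp

definition delta :: "'a \<Rightarrow> 'a \<Rightarrow> complex" where
  "delta x = (\<lambda>y. if y = x then 1 else 0)"

lemma delta_simps [simp]: "delta x x = 1" "y \<noteq> x \<Longrightarrow> delta x y = 0"
  by (auto simp: delta_def)

lemma finite_support_ell2:
  assumes "finite F" "F \<subseteq> S" "\<And>x. x \<notin> F \<Longrightarrow> f x = 0"
  shows "f \<in> ell2 S" and "(ell2_norm S f)\<^sup>2 = (\<Sum>x\<in>F. (cmod (f x))\<^sup>2)"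
proof -
  have *: "((\<lambda>x. (cmod (f x))\<^sup>2) has_sum (\<Sum>x\<in>F. (cmod (f x))\<^sup>2)) S"
    by (rule has_sum_cong_neutral[where S = F, THEN iffD1, OF _ _ _ has_sum_finite[OF assms(1)]])
      (use assms in auto)
  then show "f \<in> ell2 S" using assms has_sum_imp_summable by (auto simp: ell2_def)
  show "(ell2_norm S f)\<^sup>2 = (\<Sum>x\<in>F. (cmod (f x))\<^sup>2)"
    using * by (simp add: ell2_norm_power2 infsumI)
qed

lemma delta_ell2 [simp]: "x \<in> S \<Longrightarrow> delta x \<in> ell2 S"
  by (rule finite_support_ell2(1)[of "{x}"]) auto

lemma ell2_norm_delta [simp]:
  assumes "x \<in> S"
  shows "ell2_norm S (delta x) = 1"
proof -
  have "(ell2_norm S (delta x))\<^sup>2 = 1"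
    using finite_support_ell2(2)[of "{x}" S "delta x"] assms by simp
  then show ?thesis by (simp add: power2_eq_1_iff) (smt (verit) ell2_norm_nonneg)
qed

lemma ell2_inner_delta_right:
  assumes "x \<in> S"
  shows "ell2_inner S f (delta x) = f x"
proof -
  have "ell2_inner S f (delta x) = (\<Sum>\<^sub>\<infinity>y\<in>{x}. f y * cnj (delta x y))"
    unfolding ell2_inner_def by (rule infsum_cong_neutral) (use assms in auto)
  then show ?thesis by simp
qed

text \<open>The squared norm of the tail is the infinite sum minus the partial sum over
  \<open>F\<close>.\<close>

lemma ell2_truncate_tendsto:
  assumes f: "f \<in> ell2 S"
  shows "((\<lambda>F. ell2_norm S (\<lambda>x. if x \<in> F then 0 else f x)) \<longlongrightarrow> 0) (finite_subsets_at_top S)"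
proof -
  let ?q = "\<lambda>x. (cmod (f x))\<^sup>2"
  have "((\<lambda>F. sum ?q F) \<longlongrightarrow> infsum ?q S) (finite_subsets_at_top S)"
    using f by (intro infsum_tendsto) (simp add: ell2_def)
  then have "((\<lambda>F. sqrt (infsum ?q S - sum ?q F)) \<longlongrightarrow> sqrt (infsum ?q S - infsum ?q S)) (finite_subsets_at_top S)"
    by (intro tendsto_intros)
  moreover have "eventually (\<lambda>F. sqrt (infsum ?q S - sum ?q F) = ell2_norm S (\<lambda>x. if x \<in> F then 0 else f x))
      (finite_subsets_at_top S)"
  proof (rule eventually_finite_subsets_at_top_weakI)
    fix F assume F: "finite F" "F \<subseteq> S"
    have "infsum ?q S = infsum ?q (F \<union> (S - F))" using F by (simp add: Un_absorb1)
    also have "\<dots> = sum ?q F + infsum ?q (S - F)"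
      using f F by (subst infsum_Un_disjoint) (auto simp: ell2_def intro: summable_on_subset_banach)
    also have "infsum ?q (S - F) = (\<Sum>\<^sub>\<infinity>x\<in>S. (cmod (if x \<in> F then 0 else f x))\<^sup>2)"
      by (rule infsum_cong_neutral) auto
    finally show "sqrt (infsum ?q S - sum ?q F) = ell2_norm S (\<lambda>x. if x \<in> F then 0 else f x)"
      by (simp add: ell2_norm_def)
  qed
  ultimately show ?thesis using Lim_transform_eventually by fastforce
qed

section \<open>Coefficient functions in a Hilbert space\<close>

text \<open>Distance minimization: the parallelogram law makes a minimizing sequence Cauchy, and
  minimality of the limit \<open>p\<close> along each line \<open>p + t *\<^sub>R y\<close> in
  \<open>M\<close> gives orthogonality.\<close>

lemma projection_exists:
  fixes M :: "'h::{real_inner,banach} set"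
  assumes M: "closed M" "subspace M"
  shows "\<exists>p\<in>M. \<forall>m\<in>M. inner (x - p) m = 0"
proof -
  define d where "d = Inf ((\<lambda>m. norm (x - m)) ` M)"
  have ne: "(\<lambda>m. norm (x - m)) ` M \<noteq> {}" using M(2) subspace_0 by blast
  have bdd: "bdd_below ((\<lambda>m. norm (x - m)) ` M)" by (rule bdd_belowI[of _ 0]) auto
  have d_le: "d \<le> norm (x - m)" if "m \<in> M" for m
    unfolding d_def by (rule cInf_lower[OF _ bdd]) (use that in auto)
  have d0: "0 \<le> d" unfolding d_def by (rule cInf_greatest[OF ne]) auto
  have "\<exists>m\<in>M. norm (x - m) < d + inverse (Suc n)" for n
  proof -
    have "\<exists>y\<in>(\<lambda>m. norm (x - m)) ` M. y < d + inverse (Suc n)"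
      using cInf_lessD[OF ne, of "d + inverse (Suc n)"] by (auto simp: d_def)
    then show ?thesis by auto
  qed
  then obtain m where mM: "\<And>n. m n \<in> M" and m: "\<And>n. norm (x - m n) < d + inverse (Suc n)"
    by metis
  have lim: "(\<lambda>n. norm (x - m n)) \<longlonglongrightarrow> d"
  proof (rule tendsto_sandwich[of "\<lambda>_. d" _ _ "\<lambda>n. d + inverse (Suc n)"])
    show "(\<lambda>n. d + inverse (Suc n)) \<longlonglongrightarrow> d"
      using tendsto_add[OF tendsto_const LIMSEQ_inverse_real_of_nat, of d] by simp
    show "eventually (\<lambda>n. norm (x - m n) \<le> d + inverse (Suc n)) sequentially"
      using m by (intro always_eventually allI less_imp_le)
  qed (use d_le mM in auto)
  \<comment> \<open>The midpoint of \<open>m i\<close> and \<open>m j\<close> lies in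
    \<open>M\<close>, hence at distance at least \<open>d\<close> from \<open>x\<close>.\<close>
  have par: "(norm (m i - m j))\<^sup>2 \<le> 2 * (norm (x - m i))\<^sup>2 + 2 * (norm (x - m j))\<^sup>2 - 4 * d\<^sup>2" for i j
  proof -
    have "(1/2) *\<^sub>R (m i + m j) \<in> M" using M(2) mM by (simp add: subspace_add subspace_scale)
    then have "d\<^sup>2 \<le> (norm (x - (1/2) *\<^sub>R (m i + m j)))\<^sup>2" using d_le d0 by (simp add: power_mono)
    moreover have "(norm (m i - m j))\<^sup>2 =
        2 * (norm (x - m i))\<^sup>2 + 2 * (norm (x - m j))\<^sup>2 - 4 * (norm (x - (1/2) *\<^sub>R (m i + m j)))\<^sup>2"
      unfolding power2_norm_eq_inner
      by (simp add: inner_diff_left inner_diff_right inner_add_left inner_add_right inner_commute algebra_simps)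
    ultimately show ?thesis by simp
  qed
  have "Cauchy m"
  proof (rule metric_CauchyI)
    fix e :: real assume e: "e > 0"
    have "(\<lambda>n. (norm (x - m n))\<^sup>2) \<longlonglongrightarrow> d\<^sup>2" by (intro tendsto_intros lim)
    then have "\<exists>N. \<forall>n\<ge>N. (norm (x - m n))\<^sup>2 < d\<^sup>2 + e\<^sup>2 / 4"
      using e order_tendstoD(2)[of _ "d\<^sup>2" sequentially "d\<^sup>2 + e\<^sup>2 / 4"]
      by (auto simp: eventually_sequentially)
    then obtain N where N: "\<And>n. n \<ge> N \<Longrightarrow> (norm (x - m n))\<^sup>2 < d\<^sup>2 + e\<^sup>2 / 4" by blast
    have "dist (m i) (m j) < e" if "i \<ge> N" "j \<ge> N" for i j
    proof -
      have "(norm (m i - m j))\<^sup>2 < e\<^sup>2" using par[of i j] N[OF that(1)] N[OF that(2)] by simp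
      then show ?thesis using e by (simp add: dist_norm power_less_imp_less_base)
    qed
    then show "\<exists>N. \<forall>i\<ge>N. \<forall>j\<ge>N. dist (m i) (m j) < e" by blast
  qed
  then obtain p where p: "m \<longlonglongrightarrow> p" by (auto simp: Cauchy_convergent_iff convergent_def)
  have pM: "p \<in> M" using M(1) mM p closed_sequentially by blast
  have "(\<lambda>n. norm (x - m n)) \<longlonglongrightarrow> norm (x - p)" by (intro tendsto_intros p)
  then have np: "norm (x - p) = d" using lim LIMSEQ_unique by blast
  have "inner (x - p) y = 0" if y: "y \<in> M" for y
  proof (cases "y = 0")
    case False
    \<comment> \<open>The minimizer of the quadratic function t \<mapsto> |x - p - t y|^2.\<close>
    define t where "t = inner (x - p) y / inner y y"
    have "p + t *\<^sub>R y \<in> M" using M(2) pM y by (simp add: subspace_add subspace_scale)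
    then have "d\<^sup>2 \<le> (norm (x - (p + t *\<^sub>R y)))\<^sup>2" using d_le d0 by (simp add: power_mono)
    also have "\<dots> = (norm (x - p - t *\<^sub>R y))\<^sup>2" by (simp add: algebra_simps)
    also have "\<dots> = d\<^sup>2 - 2 * t * inner (x - p) y + t\<^sup>2 * inner y y"
      unfolding np[symmetric] power2_norm_eq_inner
      by (simp add: inner_diff_left[of "x - p"] inner_diff_right[of _ "x - p"] inner_commute
          power2_eq_square algebra_simps)
    also have "\<dots> = d\<^sup>2 - (inner (x - p) y)\<^sup>2 / inner y y"
      using False by (simp add: t_def power2_eq_square field_simps)
    finally have "(inner (x - p) y)\<^sup>2 / inner y y \<le> 0" by simp
    moreover have "inner y y > 0" using False by simp
    ultimately show ?thesis by (simp add: divide_le_0_iff)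
  qed simp
  with pM show ?thesis by blast
qed

section \<open>Square roots of operators\<close>

text \<open>
  The iteration \<open>Y \<mapsto> (B + Y\<^sup>2) / 2\<close> converges in norm to \<open>1 - (1 - B)\<^sup>1\<^sup>/\<^sup>2\<close>: its increments are
  dominated by those of the scalar iteration \<open>y \<mapsto> (1 + y\<^sup>2) / 2\<close>.
\<close>

fun sqrt_iter :: "('h::real_normed_vector \<Rightarrow>\<^sub>L 'h) \<Rightarrow> nat \<Rightarrow> ('h \<Rightarrow>\<^sub>L 'h)" where
  "sqrt_iter B 0 = 0"
| "sqrt_iter B (Suc n) = (1/2) *\<^sub>R (B + (sqrt_iter B n o\<^sub>L sqrt_iter B n))"

fun real_sqrt_iter :: "nat \<Rightarrow> real" where
  "real_sqrt_iter 0 = 0"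
| "real_sqrt_iter (Suc n) = (1 + (real_sqrt_iter n)\<^sup>2) / 2"

lemma real_sqrt_iter_bounds: "0 \<le> real_sqrt_iter n \<and> real_sqrt_iter n \<le> 1"
proof (induction n)
  case (Suc n)
  then have "(real_sqrt_iter n)\<^sup>2 \<le> 1\<^sup>2" by (intro power_mono) auto
  then show ?case by simp
qed simp

text \<open>Both iterations have increments of the form (Y (Y - X) + (Y - X) X) / 2, where X and Y
  are consecutive iterates. Hence the norm estimate for one increment passes to the next.\<close>

lemma sqrt_iter_bound:
  assumes "norm B \<le> 1"
  shows "norm (sqrt_iter B n) \<le> real_sqrt_iter n"
    and "norm (sqrt_iter B (Suc n) - sqrt_iter B n) \<le> real_sqrt_iter (Suc n) - real_sqrt_iter n"
proof -
  have le: "norm (sqrt_iter B n) \<le> real_sqrt_iter n" for n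
  proof (induction n)
    case (Suc n)
    have "norm (sqrt_iter B n o\<^sub>L sqrt_iter B n) \<le> norm (sqrt_iter B n) * norm (sqrt_iter B n)"
      by (rule norm_blinfun_compose)
    also have "\<dots> \<le> (real_sqrt_iter n)\<^sup>2"
      unfolding power2_eq_square using Suc real_sqrt_iter_bounds[of n] by (intro mult_mono) auto
    finally have "norm (B + (sqrt_iter B n o\<^sub>L sqrt_iter B n)) \<le> 1 + (real_sqrt_iter n)\<^sup>2"
      using assms norm_triangle_ineq[of B "sqrt_iter B n o\<^sub>L sqrt_iter B n"] by linarith
    then show ?case by simp
  qed simp
  then show "norm (sqrt_iter B n) \<le> real_sqrt_iter n" .
  show "norm (sqrt_iter B (Suc n) - sqrt_iter B n) \<le> real_sqrt_iter (Suc n) - real_sqrt_iter n"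
  proof (induction n)
    case (Suc n)
    define X Y x y where "X = sqrt_iter B n" and "Y = sqrt_iter B (Suc n)"
      and "x = real_sqrt_iter n" and "y = real_sqrt_iter (Suc n)"
    have X: "norm X \<le> x" and Y: "norm Y \<le> y" and D: "norm (Y - X) \<le> y - x"
      using le[of n] le[of "Suc n"] Suc by (simp_all only: X_def Y_def x_def y_def)
    \<comment> \<open>This way of splitting Y^2 - X^2 does not use that X and Y commute.\<close>
    have "sqrt_iter B (Suc (Suc n)) - Y = (1/2) *\<^sub>R ((Y o\<^sub>L (Y - X)) + ((Y - X) o\<^sub>L X))"
    proof -
      have "sqrt_iter B (Suc (Suc n)) = (1/2) *\<^sub>R (B + (Y o\<^sub>L Y))"
        unfolding Y_def by (rule sqrt_iter.simps(2))
      moreover have "Y = (1/2) *\<^sub>R (B + (X o\<^sub>L X))"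
        unfolding X_def Y_def by (rule sqrt_iter.simps(2))
      ultimately have "sqrt_iter B (Suc (Suc n)) - Y = (1/2) *\<^sub>R (B + (Y o\<^sub>L Y)) - (1/2) *\<^sub>R (B + (X o\<^sub>L X))"
        by (rule arg_cong2[where f = minus])
      also have "\<dots> = (1/2) *\<^sub>R ((Y o\<^sub>L (Y - X)) + ((Y - X) o\<^sub>L X))"
        by (intro blinfun_eqI) (simp add: blinfun.bilinear_simps algebra_simps)
      finally show ?thesis .
    qed
    also have "norm \<dots> \<le> (1/2) * (norm (Y o\<^sub>L (Y - X)) + norm ((Y - X) o\<^sub>L X))"
      by (simp add: norm_triangle_ineq)
    also have "\<dots> \<le> (1/2) * (norm Y * norm (Y - X) + norm (Y - X) * norm X)"
      using norm_blinfun_compose[of Y "Y - X"] norm_blinfun_compose[of "Y - X" X] by simp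
    also have "\<dots> \<le> (1/2) * (y * (y - x) + (y - x) * x)"
    proof -
      have "norm Y * norm (Y - X) \<le> y * (y - x)"
        using X Y D norm_ge_zero[of Y] norm_ge_zero[of "Y - X"] by (intro mult_mono) linarith+
      moreover have "norm (Y - X) * norm X \<le> (y - x) * x"
        using X Y D norm_ge_zero[of X] norm_ge_zero[of "Y - X"] by (intro mult_mono) linarith+
      ultimately show ?thesis by simp
    qed
    also have "\<dots> = real_sqrt_iter (Suc (Suc n)) - y"
      by (simp add: x_def y_def power2_eq_square algebra_simps add_divide_distrib diff_divide_distrib)
    finally show ?case by (simp only: Y_def y_def)
  qed (use assms in simp)
qed

text \<open>The limit L of the iteration satisfies 2 L = B + L^2, which says (1 - L)^2 = 1 - B, so S
  = 1 - L. Symmetry, and commutation with any \<open>u\<close> that commutes with B, hold for every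
  iterate and survive the limit.\<close>

lemma sqrt_one_minus:
  fixes B :: "'h::{real_inner,banach} \<Rightarrow>\<^sub>L 'h"
  assumes B: "norm B \<le> 1" and sa: "\<And>x y. inner (B x) y = inner x (B y)"
  obtains S :: "'h \<Rightarrow>\<^sub>L 'h"
  where "\<And>x. S (S x) = x - B x" "\<And>x y. inner (S x) y = inner x (S y)"
    "\<And>u x. bounded_linear u \<Longrightarrow> (\<And>x. u (B x) = B (u x)) \<Longrightarrow> u (S x) = S (u x)"
proof -
  define Y where "Y = sqrt_iter B"
  have dist_le: "norm (Y (n + k) - Y n) \<le> real_sqrt_iter (n + k) - real_sqrt_iter n" for n k
  proof (induction k)
    case (Suc k)
    have "norm (Y (n + Suc k) - Y n) \<le> norm (Y (Suc (n + k)) - Y (n + k)) + norm (Y (n + k) - Y n)"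
      using norm_triangle_ineq[of "Y (Suc (n + k)) - Y (n + k)" "Y (n + k) - Y n"] by simp
    also have "\<dots> \<le> (real_sqrt_iter (Suc (n + k)) - real_sqrt_iter (n + k)) + (real_sqrt_iter (n + k) - real_sqrt_iter n)"
      using sqrt_iter_bound(2)[OF B, of "n + k"] Suc unfolding Y_def by (rule add_mono)
    finally show ?case by simp
  qed simp
  \<comment> \<open>The scalar increments are nonnegative because they dominate norms.\<close>
  have "incseq real_sqrt_iter"
  proof (rule incseq_SucI)
    show "real_sqrt_iter n \<le> real_sqrt_iter (Suc n)" for n
      using sqrt_iter_bound(2)[OF B, of n] norm_ge_zero[of "sqrt_iter B (Suc n) - sqrt_iter B n"] by linarith
  qed
  then have "convergent real_sqrt_iter"
    using real_sqrt_iter_bounds by (intro Bseq_mono_convergent BseqI'[of _ 1]) (auto simp: incseq_def)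
  then have C: "Cauchy real_sqrt_iter" by (rule convergent_Cauchy)
  have "Cauchy Y"
  proof (rule metric_CauchyI)
    fix e :: real assume "e > 0"
    then obtain N where N: "\<And>m n. m \<ge> N \<Longrightarrow> n \<ge> N \<Longrightarrow> dist (real_sqrt_iter m) (real_sqrt_iter n) < e"
      using C by (meson metric_CauchyD)
    have *: "dist (Y m) (Y n) < e" if "n \<ge> N" "n \<le> m" for m n
    proof -
      have "dist (Y m) (Y n) \<le> real_sqrt_iter m - real_sqrt_iter n"
        using dist_le[of n "m - n"] that by (simp add: dist_norm)
      also have "\<dots> < e" using N[of m n] that by (simp add: dist_real_def)
      finally show ?thesis .
    qed
    have "dist (Y m) (Y n) < e" if "m \<ge> N" "n \<ge> N" for m n
      using *[of m n] *[of n m] that by (cases "n \<le> m") (simp_all add: dist_commute)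
    then show "\<exists>N. \<forall>m\<ge>N. \<forall>n\<ge>N. dist (Y m) (Y n) < e" by blast
  qed
  then obtain L where L: "Y \<longlonglongrightarrow> L" by (auto simp: Cauchy_convergent_iff convergent_def)
  have app: "(\<lambda>n. Y n x) \<longlonglongrightarrow> L x" for x
    by (intro tendsto_intros L)
  have fix_eq: "L x = (1/2) *\<^sub>R (B x + L (L x))" for x
  proof -
    have "(\<lambda>n. Y (Suc n) x) \<longlonglongrightarrow> L x" using app LIMSEQ_Suc by blast
    moreover have "(\<lambda>n. Y (Suc n) x) \<longlonglongrightarrow> (1/2) *\<^sub>R (B x + L (L x))"
      unfolding Y_def sqrt_iter.simps
      by (simp add: blinfun.bilinear_simps flip: Y_def) (intro tendsto_intros L)
    ultimately show ?thesis using LIMSEQ_unique by blast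
  qed
  have sq: "(id_blinfun - L) ((id_blinfun - L) x) = x - B x" for x
  proof -
    have "2 *\<^sub>R L x = 2 *\<^sub>R (1/2) *\<^sub>R (B x + L (L x))" by (rule arg_cong[OF fix_eq])
    then have "L (L x) = L x + L x - B x" by (simp add: scaleR_2)
    then show ?thesis by (simp add: blinfun.bilinear_simps)
  qed
  have "inner (Y n x) y = inner x (Y n y)" for n x y
    by (induction n arbitrary: x y) (simp_all add: Y_def blinfun.bilinear_simps sa inner_add_left inner_add_right)
  moreover have "(\<lambda>n. inner (Y n x) y) \<longlonglongrightarrow> inner (L x) y" "(\<lambda>n. inner x (Y n y)) \<longlonglongrightarrow> inner x (L y)" for x y
    by (intro tendsto_intros L)+
  ultimately have "inner (L x) y = inner x (L y)" for x y
    using LIMSEQ_unique by fastforce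
  moreover have "u (L x) = L (u x)" if u: "bounded_linear u" and uB: "\<And>x. u (B x) = B (u x)" for u x
  proof -
    interpret u: bounded_linear u by (rule u)
    have Yu: "u (Y n x) = Y n (u x)" for n x
      by (induction n arbitrary: x) (simp_all add: Y_def blinfun.bilinear_simps u.zero u.scaleR u.add uB)
    have "(\<lambda>n. u (Y n x)) \<longlonglongrightarrow> u (L x)" by (intro u.tendsto app)
    moreover have "(\<lambda>n. u (Y n x)) \<longlonglongrightarrow> L (u x)" unfolding Yu by (rule app)
    ultimately show ?thesis using LIMSEQ_unique by blast
  qed
  ultimately show thesis
    by (intro that[of "id_blinfun - L"] sq)
      (simp_all add: blinfun.bilinear_simps inner_diff_left inner_diff_right linear_diff bounded_linear.linear)
qed

section \<open>The sum of two coefficients as a single coefficient\<close>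

lemma subspace_closure:
  fixes S :: "'a::real_normed_vector set"
  assumes "subspace S"
  shows "subspace (closure S)"
proof (rule subspaceI)
  show "0 \<in> closure S" using subspace_0[OF assms] closure_subset by blast
  fix x y assume "x \<in> closure S" "y \<in> closure S"
  then obtain a b where ab: "\<And>n. a n \<in> S" "a \<longlonglongrightarrow> x" "\<And>n. b n \<in> S" "b \<longlonglongrightarrow> y"
    by (metis closure_sequential)
  have "(\<lambda>n. a n + b n) \<longlonglongrightarrow> x + y" using ab by (intro tendsto_intros)
  moreover have "a n + b n \<in> S" for n using ab assms by (simp add: subspace_add)
  ultimately show "x + y \<in> closure S" unfolding closure_sequential by (intro exI[of _ "\<lambda>n. a n + b n"]) simp
  fix c :: real
  have "(\<lambda>n. c *\<^sub>R a n) \<longlonglongrightarrow> c *\<^sub>R x" using ab by (intro tendsto_intros)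
  moreover have "c *\<^sub>R a n \<in> S" for n using ab assms by (simp add: subspace_scale)
  ultimately show "c *\<^sub>R x \<in> closure S" unfolding closure_sequential by (intro exI[of _ "\<lambda>n. c *\<^sub>R a n"]) simp
qed

text \<open>
  Let \<open>M\<close> be the cyclic subspace of \<open>H \<oplus> H\<close> generated by \<open>(f, d)\<close>; it is the graph of an operator
  (from the second coordinate to the first) by the last assumption. The polar decomposition of the
  second coordinate projection \<open>M \<rightarrow> H\<close> embeds \<open>M\<close> isometrically and equivariantly into \<open>H\<close>, and
  \<open>f'\<close>, \<open>g'\<close> are the images of \<open>(f, d)\<close> and of the projection of \<open>(g, k)\<close> to \<open>M\<close>.
\<close>

lemma sum_of_coefficients:
  fixes f d g k :: "'h::{real_inner,banach}" and U :: "('h \<Rightarrow> 'h) set"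
  defines "M \<equiv> closure (span ((\<lambda>u. (u f, u d)) ` U))"
  assumes lin: "\<And>u. u \<in> U \<Longrightarrow> bounded_linear u"
    and adj: "\<And>u. u \<in> U \<Longrightarrow> \<exists>v\<in>U. \<forall>a b. inner (u a) b = inner a (v b)"
    and comp: "\<And>u v. u \<in> U \<Longrightarrow> v \<in> U \<Longrightarrow> u \<circ> v \<in> U"
    and fd: "(f, d) \<in> M"
    and graph: "\<And>m. (m, 0) \<in> M \<Longrightarrow> m = 0"
  obtains f' g' where "\<And>u. u \<in> U \<Longrightarrow> inner (u f') g' = inner (u f) g + inner (u d) k"
proof -
  have M: "closed M" "subspace M"
    by (simp_all add: M_def subspace_closure)
  have inv: "(u a, u b) \<in> M" if u: "u \<in> U" and ab: "(a, b) \<in> M" for u a b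
  proof -
    define h where "h = (\<lambda>x. (u (fst x), u (snd x)))"
    have h: "bounded_linear h"
      unfolding h_def
      by (intro bounded_linear_Pair bounded_linear_compose[OF lin[OF u]] bounded_linear_fst bounded_linear_snd)
    define X where "X = (\<lambda>u. (u f, u d)) ` U"
    have "h (v f, v d) \<in> X" if "v \<in> U" for v
      using comp[OF u that] by (auto simp: h_def X_def intro: image_eqI[where x = "u \<circ> v"])
    then have "h ` X \<subseteq> X" by (auto simp: X_def)
    then have "h ` span X \<subseteq> span X"
      by (simp add: linear_span_image[OF bounded_linear.linear[OF h], symmetric] span_mono)
    then have "h ` closure (span X) \<subseteq> closure (span X)"
      using closure_bounded_linear_image_subset[OF h, of "span X"] closure_mono by blast
    then have "h (a, b) \<in> closure (span X)" using ab by (auto simp: M_def X_def)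
    then show ?thesis by (simp add: h_def M_def X_def)
  qed
  obtain P where PM: "\<And>x. P x \<in> M" and P: "\<And>x m. m \<in> M \<Longrightarrow> inner (x - P x) m = 0"
    using projection_exists[OF M] by metis
  \<comment> \<open>Linearity and equivariance of the projection follow by checking a candidate
    against this characterization.\<close>
  have P_unique: "P x = p" if "p \<in> M" "\<And>m. m \<in> M \<Longrightarrow> inner (x - p) m = 0" for x p
  proof -
    have "P x - p \<in> M" using M(2) PM that(1) by (simp add: subspace_diff)
    then have "inner (x - p) (P x - p) - inner (x - P x) (P x - p) = 0" using P that(2) by simp
    then have "inner (P x - p) (P x - p) = 0" by (simp add: inner_diff_left)
    then show ?thesis by simp
  qed
  have P_add: "P (x + y) = P x + P y" for x y
  proof (rule P_unique)
    show "inner (x + y - (P x + P y)) m = 0" if "m \<in> M" for m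
      using P[OF that, of x] P[OF that, of y] by (simp add: inner_diff_left inner_add_left)
  qed (simp add: M(2) PM subspace_add)
  have P_scale: "P (c *\<^sub>R x) = c *\<^sub>R P x" for c x
  proof (rule P_unique)
    show "inner (c *\<^sub>R x - c *\<^sub>R P x) m = 0" if "m \<in> M" for m
      using P[OF that, of x] by (simp add: scaleR_diff_right[symmetric])
  qed (simp add: M(2) PM subspace_scale)
  have P_inner: "inner (P x) m = inner x m" if "m \<in> M" for x m
    using P[OF that, of x] by (simp add: inner_diff_left)
  have P_norm: "norm (x - P x) \<le> norm x" for x
  proof -
    have "norm (x - P x) * norm (x - P x) = inner (x - P x) x"
      using P[OF PM, of x x] by (simp add: inner_diff_right power2_norm_eq_inner flip: power2_eq_square)
    also have "\<dots> \<le> norm (x - P x) * norm x" using Cauchy_Schwarz_ineq2 abs_le_D1 by blast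
    finally show ?thesis by (cases "x = P x") (simp_all add: mult_le_cancel_left)
  qed
  \<comment> \<open>\<open>V\<close> is the adjoint of the second coordinate projection
    \<open>M\<close> \<rightarrow> H, see \<open>V_inner\<close>. Thus \<open>snd \<circ> V\<close>
    is the product of that projection with its adjoint, \<open>S\<close> below is a square root of
    it, and V h \<mapsto> S h is the isometry of the polar decomposition.\<close>
  define V where "V h = P (0, h)" for h
  have VM: "V h \<in> M" for h by (simp add: V_def PM)
  have V_add: "V (x + y) = V x + V y" for x y
    using P_add[of "(0, x)" "(0, y)"] by (simp add: V_def)
  have V_scale: "V (c *\<^sub>R x) = c *\<^sub>R V x" for c x
    using P_scale[of c "(0, x)"] by (simp add: V_def)
  have V: "linear V" by (rule linearI) (simp_all add: V_add V_scale)
  interpret V: linear V by (rule V)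
  have V_inner: "inner (V h) m = inner h (snd m)" if "m \<in> M" for h m
    using P_inner[OF that, of "(0, h)"] by (simp add: V_def inner_prod_def)
  have V_equivariant: "V (u h) = (u (fst (V h)), u (snd (V h)))" if u: "u \<in> U" for u h
    unfolding V_def
  proof (rule P_unique)
    \<comment> \<open>Orthogonality to \<open>M\<close> is inherited by applying \<open>u\<close>,
      since the adjoint \<open>v\<close> of \<open>u\<close> also maps \<open>M\<close> into
      itself.\<close>
    obtain v where v: "v \<in> U" "\<And>a b. inner (u a) b = inner a (v b)" using adj[OF u] by blast
    interpret u: bounded_linear u by (rule lin[OF u])
    show "(u (fst (P (0, h))), u (snd (P (0, h)))) \<in> M" using inv[OF u] PM by simp
    fix m assume m: "m \<in> M"
    have "inner ((0, u h) - (u (fst (P (0, h))), u (snd (P (0, h))))) m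
        = inner ((0, h) - P (0, h)) (v (fst m), v (snd m))"
      by (cases "P (0, h)") (simp add: inner_prod_def inner_diff_left v(2) flip: u.diff)
    also have "\<dots> = 0" using inv[OF v(1), of "fst m" "snd m"] m by (intro P) simp
    finally show "inner ((0, u h) - (u (fst (P (0, h))), u (snd (P (0, h))))) m = 0" .
  qed
  \<comment> \<open>\<open>B h\<close> is the second coordinate of the part of (0, h) orthogonal to
    \<open>M\<close>, whence norm at most one.\<close>
  define B where "B = Blinfun (\<lambda>h. h - snd (V h))"
  have B_le: "norm (h - snd (V h)) \<le> norm h" for h
  proof -
    have "norm (h - snd (V h)) = norm (snd ((0, h) - V h))" by simp
    also have "\<dots> \<le> norm ((0, h) - V h)" by (metis norm_snd_le prod.collapse)
    also have "\<dots> \<le> norm h" using P_norm[of "(0, h)"] by (simp add: V_def norm_Pair)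
    finally show ?thesis .
  qed
  have "bounded_linear (\<lambda>h. h - snd (V h))"
    by (rule bounded_linear_intro[where K = 1]) (use B_le in \<open>auto simp: V.add V.scale algebra_simps\<close>)
  then have B: "B h = h - snd (V h)" for h
    by (simp add: B_def bounded_linear_Blinfun_apply)
  have "norm B \<le> 1" by (rule norm_blinfun_bound) (simp_all add: B B_le)
  moreover have "inner (B x) y = inner x (B y)" for x y
    using V_inner[OF VM, of x y] V_inner[OF VM, of y x]
    by (simp add: B inner_diff_left inner_diff_right inner_commute)
  ultimately obtain S :: "'h \<Rightarrow>\<^sub>L 'h" where S_sq: "\<And>x. S (S x) = x - B x"
      and S_sym: "\<And>x y. inner (S x) y = inner x (S y)"
      and S_comm: "\<And>u x. bounded_linear u \<Longrightarrow> (\<And>x. u (B x) = B (u x)) \<Longrightarrow> u (S x) = S (u x)"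
    using sqrt_one_minus by metis
  have S_inner: "inner (S h) (S l) = inner (V h) (V l)" for h l
    by (simp add: S_sym S_sq B V_inner[OF VM])
  have S_norm: "norm (S h) = norm (V h)" for h
    using S_inner[of h h] by (simp add: norm_eq_sqrt_inner)
  have S_u: "u (S h) = S (u h)" if u: "u \<in> U" for u h
  proof (rule S_comm[OF lin[OF u]])
    show "u (B x) = B (u x)" for x
      by (simp add: B V_equivariant[OF u] linear_diff[OF bounded_linear.linear[OF lin[OF u]]])
  qed
  \<comment> \<open>A vector of \<open>M\<close> orthogonal to the range of \<open>V\<close> has
    second coordinate 0, and such a vector is 0 by \<open>graph\<close>.\<close>
  have dense: "m \<in> closure (range V)" if m: "m \<in> M" for m
  proof -
    define N where "N = closure (range V)"
    have N: "closed N" "subspace N"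
      unfolding N_def by (intro closed_closure subspace_closure linear_subspace_image[OF V] subspace_UNIV)+
    have NM: "N \<subseteq> M" unfolding N_def by (rule closure_minimal) (use VM M in auto)
    obtain q where q: "q \<in> N" "\<And>y. y \<in> N \<Longrightarrow> inner (m - q) y = 0"
      using projection_exists[OF N] by metis
    have mq: "m - q \<in> M" using m q NM M(2) by (auto simp: subspace_diff)
    have "V h \<in> N" for h using closure_subset[of "range V"] by (auto simp: N_def)
    then have "inner h (snd (m - q)) = 0" for h
      using V_inner[OF mq, of h] q(2) by (simp add: inner_commute)
    then have "snd (m - q) = 0" using inner_eq_zero_iff by blast
    then have "(fst (m - q), 0) \<in> M" using mq by (metis prod.collapse)
    then have "fst (m - q) = 0" by (rule graph)
    with \<open>snd (m - q) = 0\<close> have "m = q" by (simp add: prod_eq_iff)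
    then show ?thesis using q by (simp add: N_def)
  qed
  \<comment> \<open>Extends V h \<mapsto> S h to all of \<open>M\<close> along sequences: the two
    sides have equal norms, so one sequence is Cauchy when the other is.\<close>
  have lift: "\<exists>h x. (\<lambda>n. V (h n)) \<longlonglongrightarrow> m \<and> (\<lambda>n. S (h n)) \<longlonglongrightarrow> x" if m: "m \<in> M" for m
  proof -
    obtain w where "\<And>n. w n \<in> range V" and wm: "w \<longlonglongrightarrow> m"
      using dense[OF m] unfolding closure_sequential by blast
    then have "\<exists>h. w n = V h" for n by blast
    then obtain h where h: "\<And>n. w n = V (h n)" by metis
    then have Vh: "(\<lambda>n. V (h n)) \<longlonglongrightarrow> m" using wm by (simp flip: h)
    have "dist (S (h i)) (S (h j)) = dist (V (h i)) (V (h j))" for i j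
      using S_norm[of "h i - h j"] by (simp add: dist_norm blinfun.diff_right V.diff)
    moreover have "Cauchy (\<lambda>n. V (h n))" using Vh by (rule LIMSEQ_imp_Cauchy)
    ultimately have "Cauchy (\<lambda>n. S (h n))" by (simp add: Cauchy_def)
    then show ?thesis using Vh by (auto simp: Cauchy_convergent_iff convergent_def)
  qed
  obtain h f' where h: "(\<lambda>n. V (h n)) \<longlonglongrightarrow> (f, d)" "(\<lambda>n. S (h n)) \<longlonglongrightarrow> f'" using lift[OF fd] by blast
  obtain l g' where l: "(\<lambda>n. V (l n)) \<longlonglongrightarrow> P (g, k)" "(\<lambda>n. S (l n)) \<longlonglongrightarrow> g'" using lift[OF PM] by blast
  have "inner (u f') g' = inner (u f) g + inner (u d) k" if u: "u \<in> U" for u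
  proof -
    interpret u: bounded_linear u by (rule lin[OF u])
    have "(\<lambda>n. inner (u (S (h n))) (S (l n))) \<longlonglongrightarrow> inner (u f') g'"
      by (intro tendsto_intros u.tendsto h l)
    moreover have "inner (u (S (h n))) (S (l n)) = inner (u (fst (V (h n))), u (snd (V (h n)))) (V (l n))" for n
      by (simp add: S_u[OF u] S_inner V_equivariant[OF u])
    moreover have "(\<lambda>n. inner (u (fst (V (h n))), u (snd (V (h n)))) (V (l n)))
        \<longlonglongrightarrow> inner (u (fst (f, d)), u (snd (f, d))) (P (g, k))"
      by (intro tendsto_intros u.tendsto h l)
    ultimately have "inner (u f') g' = inner (u f, u d) (P (g, k))"
      using LIMSEQ_unique by fastforce
    \<comment> \<open>The pair (u f, u d) lies in \<open>M\<close>, so projecting (g, k) to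
      \<open>M\<close> has not changed the inner product.\<close>
    also have "\<dots> = inner (u f) g + inner (u d) k"
      using P_inner[OF inv[OF u fd], of "(g, k)"] by (simp add: inner_commute)
    finally show ?thesis .
  qed
  then show thesis by (rule that)
qed

section \<open>Bounded operators on square-summable functions\<close>

context
  fixes S :: "'a set" and T :: "'a operator"
  assumes T: "T \<in> bounded_operators S"
begin

lemma bounded_operator_ell2: "f \<in> ell2 S \<Longrightarrow> T f \<in> ell2 S"
  using T by (simp add: bounded_operators_def)

lemma bounded_operator_outside: "f \<notin> ell2 S \<Longrightarrow> T f = (\<lambda>_. 0)"
  using T by (simp add: bounded_operators_def)

lemma bounded_operator_add:
  "f \<in> ell2 S \<Longrightarrow> g \<in> ell2 S \<Longrightarrow> T (\<lambda>x. f x + g x) = (\<lambda>x. T f x + T g x)"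
  using T by (simp add: bounded_operators_def)

lemma bounded_operator_cmult: "f \<in> ell2 S \<Longrightarrow> T (\<lambda>x. c * f x) = (\<lambda>x. c * T f x)"
  using T by (simp add: bounded_operators_def)

lemma bounded_operator_zero: "T (\<lambda>_. 0) = (\<lambda>_. 0)"
  using bounded_operator_cmult[of "\<lambda>_. 0" 0] by simp

lemma bounded_operator_sum:
  assumes "finite I" "\<And>i. i \<in> I \<Longrightarrow> f i \<in> ell2 S"
  shows "T (\<lambda>x. \<Sum>i\<in>I. f i x) = (\<lambda>x. \<Sum>i\<in>I. T (f i) x)"
  using assms
proof (induction I rule: finite_induct)
  case (insert i I)
  then have "T (\<lambda>x. f i x + (\<Sum>i\<in>I. f i x)) = (\<lambda>x. T (f i) x + T (\<lambda>x. \<Sum>i\<in>I. f i x) x)"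
    by (intro bounded_operator_add) auto
  with insert show ?case by simp
qed (simp add: bounded_operator_zero)

lemma bounded_operator_bound:
  obtains C where "C \<ge> 0" "\<And>f. f \<in> ell2 S \<Longrightarrow> ell2_norm S (T f) \<le> C * ell2_norm S f"
proof -
  obtain C where C: "\<And>f. f \<in> ell2 S \<Longrightarrow> ell2_norm S (T f) \<le> C * ell2_norm S f"
    using T unfolding bounded_operators_def by blast
  have "C * ell2_norm S f \<le> max C 0 * ell2_norm S f" for f by (intro mult_right_mono) auto
  then show thesis using C by (intro that[of "max C 0"]) (auto intro: order_trans)
qed

lemma operator_norm_apply:
  assumes f: "f \<in> ell2 S"
  shows "ell2_norm S (T f) \<le> operator_norm S T * ell2_norm S f"
proof -
  obtain C where C: "C \<ge> 0" "\<And>f. f \<in> ell2 S \<Longrightarrow> ell2_norm S (T f) \<le> C * ell2_norm S f"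
    using bounded_operator_bound by blast
  show ?thesis
  proof (cases "ell2_norm S f = 0")
    case True
    then show ?thesis using C(2)[OF f] by simp
  next
    case False
    define N where "N = ell2_norm S f"
    have N: "N > 0" using False by (simp add: N_def less_le)
    let ?h = "\<lambda>x. complex_of_real (1 / N) * f x"
    have "ell2_norm S (T ?h) \<le> operator_norm S T"
      unfolding operator_norm_def
    proof (rule cSup_upper)
      show "ell2_norm S (T ?h) \<in> {ell2_norm S (T f) |f. f \<in> ell2 S \<and> ell2_norm S f \<le> 1}"
      proof (intro CollectI exI[of _ ?h] conjI refl)
        show "?h \<in> ell2 S" using f by (rule ell2_cmult)
        show "ell2_norm S ?h \<le> 1"
          unfolding ell2_norm_cmult using N by (simp add: N_def[symmetric] norm_divide)
      qed
      have "ell2_norm S (T g) \<le> C" if "g \<in> ell2 S" "ell2_norm S g \<le> 1" for g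
        using C(2)[OF that(1)] mult_left_mono[OF that(2) C(1)] by simp
      then show "bdd_above {ell2_norm S (T f) |f. f \<in> ell2 S \<and> ell2_norm S f \<le> 1}"
        by (auto intro: bdd_aboveI[of _ C])
    qed
    moreover have "ell2_norm S (T ?h) = ell2_norm S (T f) / N"
      using N f by (simp only: bounded_operator_cmult ell2_norm_cmult) (simp add: norm_divide)
    ultimately have "ell2_norm S (T f) / N \<le> operator_norm S T" by (simp only:)
    then show ?thesis using N by (simp add: N_def[symmetric] pos_divide_le_eq)
  qed
qed

lemma operator_norm_nonneg: "0 \<le> operator_norm S T"
proof -
  obtain C where C: "C \<ge> 0" "\<And>f. f \<in> ell2 S \<Longrightarrow> ell2_norm S (T f) \<le> C * ell2_norm S f"
    using bounded_operator_bound by blast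
  have "ell2_norm S (T g) \<le> C" if "g \<in> ell2 S" "ell2_norm S g \<le> 1" for g
    using C(2)[OF that(1)] mult_left_mono[OF that(2) C(1)] by simp
  then have "bdd_above {ell2_norm S (T f) |f. f \<in> ell2 S \<and> ell2_norm S f \<le> 1}"
    by (auto intro: bdd_aboveI[of _ C])
  then have "ell2_norm S (T (\<lambda>_. 0)) \<le> operator_norm S T"
    unfolding operator_norm_def
    by (rule cSup_upper[rotated]) (auto intro!: exI[of _ "\<lambda>_. 0"])
  then show ?thesis by (simp add: bounded_operator_zero)
qed

end

lemma operator_norm_le:
  assumes "\<And>f. f \<in> ell2 S \<Longrightarrow> ell2_norm S (T f) \<le> c * ell2_norm S f" "0 \<le> c"
  shows "operator_norm S T \<le> c"
  unfolding operator_norm_def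
proof (rule cSup_least)
  fix z assume "z \<in> {ell2_norm S (T f) |f. f \<in> ell2 S \<and> ell2_norm S f \<le> 1}"
  then obtain f where f: "f \<in> ell2 S" "ell2_norm S f \<le> 1" "z = ell2_norm S (T f)" by blast
  then show "z \<le> c" using assms(1)[OF f(1)] mult_left_mono[OF f(2) assms(2)] by simp
qed (auto intro!: exI[of _ "\<lambda>_. 0"])

section \<open>Norms of operator matrices\<close>

lemma L2_set_cmult: "L2_set (\<lambda>i. c * f i) A = \<bar>c\<bar> * L2_set f A"
  unfolding L2_set_def
  by (simp add: power_mult_distrib real_sqrt_mult flip: sum_distrib_left)

lemma L2_set_eq_0D: "L2_set f A = 0 \<Longrightarrow> finite A \<Longrightarrow> i \<in> A \<Longrightarrow> f i = 0"
  by (simp add: L2_set_eq_0_iff)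

lemma operator_matrix_norm_le:
  assumes "\<And>\<xi>. (\<And>j. j < n \<Longrightarrow> \<xi> j \<in> ell2 S) \<Longrightarrow>
      L2_set (\<lambda>i. ell2_norm S (\<lambda>x. \<Sum>j<n. T i j (\<xi> j) x)) {..<n} \<le> c * L2_set (\<lambda>j. ell2_norm S (\<xi> j)) {..<n}"
    and c: "0 \<le> c"
  shows "operator_matrix_norm S n T \<le> c"
  unfolding operator_matrix_norm_def
proof (rule cSup_least)
  fix z assume "z \<in> {L2_set (\<lambda>i. ell2_norm S (\<lambda>x. \<Sum>j<n. T i j (\<xi> j) x)) {..<n} | \<xi>.
       (\<forall>j<n. \<xi> j \<in> ell2 S) \<and> L2_set (\<lambda>j. ell2_norm S (\<xi> j)) {..<n} \<le> 1}"
  then obtain \<xi> where \<xi>: "\<And>j. j < n \<Longrightarrow> \<xi> j \<in> ell2 S" "L2_set (\<lambda>j. ell2_norm S (\<xi> j)) {..<n} \<le> 1"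
    and z: "z = L2_set (\<lambda>i. ell2_norm S (\<lambda>x. \<Sum>j<n. T i j (\<xi> j) x)) {..<n}" by blast
  have "z \<le> c * L2_set (\<lambda>j. ell2_norm S (\<xi> j)) {..<n}"
    unfolding z using \<xi>(1) by (rule assms(1))
  also have "\<dots> \<le> c" using mult_left_mono[OF \<xi>(2) c] by simp
  finally show "z \<le> c" .
qed (auto intro!: exI[of _ "\<lambda>_ _. 0"] simp: L2_set_def)

text \<open>The supremum defining the norm is meaningful only for a bounded set. The sum of the
  norms of all entries is a crude bound.\<close>

lemma operator_matrix_norm_bdd:
  fixes n :: nat
  assumes T: "\<And>i j. i < n \<Longrightarrow> j < n \<Longrightarrow> T i j \<in> bounded_operators S"
  shows "bdd_above {L2_set (\<lambda>i. ell2_norm S (\<lambda>x. \<Sum>j<n. T i j (\<xi> j) x)) {..<n} | \<xi>.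
       (\<forall>j<n. \<xi> j \<in> ell2 S) \<and> L2_set (\<lambda>j. ell2_norm S (\<xi> j)) {..<n} \<le> 1}"
proof (rule bdd_aboveI)
  fix z assume "z \<in> {L2_set (\<lambda>i. ell2_norm S (\<lambda>x. \<Sum>j<n. T i j (\<xi> j) x)) {..<n} | \<xi>.
       (\<forall>j<n. \<xi> j \<in> ell2 S) \<and> L2_set (\<lambda>j. ell2_norm S (\<xi> j)) {..<n} \<le> 1}"
  then obtain \<xi> where \<xi>: "\<And>j. j < n \<Longrightarrow> \<xi> j \<in> ell2 S" "L2_set (\<lambda>j. ell2_norm S (\<xi> j)) {..<n} \<le> 1"
    and z: "z = L2_set (\<lambda>i. ell2_norm S (\<lambda>x. \<Sum>j<n. T i j (\<xi> j) x)) {..<n}" by blast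
  have "z \<le> (\<Sum>i<n. ell2_norm S (\<lambda>x. \<Sum>j<n. T i j (\<xi> j) x))"
    unfolding z by (rule L2_set_le_sum) simp
  also have "\<dots> \<le> (\<Sum>i<n. \<Sum>j<n. operator_norm S (T i j))"
  proof (rule sum_mono)
    fix i assume i: "i \<in> {..<n}"
    have "ell2_norm S (\<lambda>x. \<Sum>j<n. T i j (\<xi> j) x) \<le> (\<Sum>j<n. ell2_norm S (T i j (\<xi> j)))"
      by (rule ell2_norm_sum) (use i in \<open>simp_all add: bounded_operator_ell2[OF T \<xi>(1)]\<close>)
    also have "\<dots> \<le> (\<Sum>j<n. operator_norm S (T i j))"
    proof (rule sum_mono)
      fix j assume j: "j \<in> {..<n}"
      have "ell2_norm S (\<xi> j) \<le> L2_set (\<lambda>j. ell2_norm S (\<xi> j)) {..<n}"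
        using j member_le_L2_set[of "{..<n}" j "\<lambda>j. ell2_norm S (\<xi> j)"] by simp
      then have "ell2_norm S (\<xi> j) \<le> 1" using \<xi>(2) by simp
      have Tij: "T i j \<in> bounded_operators S" using T i j by simp
      have "ell2_norm S (T i j (\<xi> j)) \<le> operator_norm S (T i j) * ell2_norm S (\<xi> j)"
        using \<xi>(1) j by (intro operator_norm_apply[OF Tij]) simp
      also have "\<dots> \<le> operator_norm S (T i j)"
        using mult_left_mono[OF \<open>ell2_norm S (\<xi> j) \<le> 1\<close> operator_norm_nonneg[OF Tij]] by simp
      finally show "ell2_norm S (T i j (\<xi> j)) \<le> operator_norm S (T i j)" .
    qed
    finally show "ell2_norm S (\<lambda>x. \<Sum>j<n. T i j (\<xi> j) x) \<le> (\<Sum>j<n. operator_norm S (T i j))" .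
  qed
  finally show "z \<le> (\<Sum>i<n. \<Sum>j<n. operator_norm S (T i j))" .
qed

lemma operator_matrix_norm_nonneg:
  assumes T: "\<And>i j. i < n \<Longrightarrow> j < n \<Longrightarrow> T i j \<in> bounded_operators S"
  shows "0 \<le> operator_matrix_norm S n T"
proof -
  have "L2_set (\<lambda>i. ell2_norm S (\<lambda>x. \<Sum>j<n. T i j (\<lambda>_. 0) x)) {..<n} \<le> operator_matrix_norm S n T"
    unfolding operator_matrix_norm_def
  proof (rule cSup_upper[OF _ operator_matrix_norm_bdd[OF T]])
    show "L2_set (\<lambda>i. ell2_norm S (\<lambda>x. \<Sum>j<n. T i j (\<lambda>_. 0) x)) {..<n}
      \<in> {L2_set (\<lambda>i. ell2_norm S (\<lambda>x. \<Sum>j<n. T i j (\<xi> j) x)) {..<n} | \<xi>.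
       (\<forall>j<n. \<xi> j \<in> ell2 S) \<and> L2_set (\<lambda>j. ell2_norm S (\<xi> j)) {..<n} \<le> 1}"
      by (intro CollectI exI[of _ "\<lambda>_ _. 0"] conjI refl) (simp_all add: L2_set_def)
  qed
  then show ?thesis by (rule order_trans[OF L2_set_nonneg])
qed

lemma operator_matrix_norm_apply:
  assumes T: "\<And>i j. i < n \<Longrightarrow> j < n \<Longrightarrow> T i j \<in> bounded_operators S"
    and \<xi>: "\<And>j. j < n \<Longrightarrow> \<xi> j \<in> ell2 S"
  shows "L2_set (\<lambda>i. ell2_norm S (\<lambda>x. \<Sum>j<n. T i j (\<xi> j) x)) {..<n}
    \<le> operator_matrix_norm S n T * L2_set (\<lambda>j. ell2_norm S (\<xi> j)) {..<n}"
proof (cases "L2_set (\<lambda>j. ell2_norm S (\<xi> j)) {..<n} = 0")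
  case True
  have 0: "ell2_norm S (\<xi> j) = 0" if "j < n" for j
    by (rule L2_set_eq_0D[OF True]) (use that in simp_all)
  have "ell2_norm S (\<lambda>x. \<Sum>j<n. T i j (\<xi> j) x) = 0" if i: "i < n" for i
  proof -
    have "ell2_norm S (\<lambda>x. \<Sum>j<n. T i j (\<xi> j) x) \<le> (\<Sum>j<n. ell2_norm S (T i j (\<xi> j)))"
      by (rule ell2_norm_sum) (use i in \<open>simp_all add: bounded_operator_ell2[OF T \<xi>]\<close>)
    also have "\<dots> = 0"
    proof (rule sum.neutral, rule ballI)
      fix j assume "j \<in> {..<n}"
      then have j: "j < n" by simp
      have "ell2_norm S (T i j (\<xi> j)) \<le> operator_norm S (T i j) * ell2_norm S (\<xi> j)"
        by (rule operator_norm_apply[OF T[OF i j] \<xi>[OF j]])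
      then show "ell2_norm S (T i j (\<xi> j)) = 0"
        unfolding 0[OF j] using ell2_norm_nonneg[of S "T i j (\<xi> j)"] by linarith
    qed
    finally show ?thesis using ell2_norm_nonneg[of S "\<lambda>x. \<Sum>j<n. T i j (\<xi> j) x"] by linarith
  qed
  then have "L2_set (\<lambda>i. ell2_norm S (\<lambda>x. \<Sum>j<n. T i j (\<xi> j) x)) {..<n} = 0"
    by (simp add: L2_set_def)
  with True show ?thesis by simp
next
  case False
  define N where "N = L2_set (\<lambda>j. ell2_norm S (\<xi> j)) {..<n}"
  have N: "N > 0" using False L2_set_nonneg[of "\<lambda>j. ell2_norm S (\<xi> j)" "{..<n}"] by (simp add: N_def less_le)
  define c where "c = complex_of_real (1 / N)"
  have c: "cmod c = 1 / N" using N by (simp add: c_def norm_divide)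
  have "L2_set (\<lambda>i. ell2_norm S (\<lambda>x. \<Sum>j<n. T i j (\<lambda>x. c * \<xi> j x) x)) {..<n} \<le> operator_matrix_norm S n T"
    unfolding operator_matrix_norm_def
  proof (rule cSup_upper[OF _ operator_matrix_norm_bdd[OF T]])
    have "L2_set (\<lambda>j. ell2_norm S (\<lambda>x. c * \<xi> j x)) {..<n} = (1 / N) * N"
      unfolding ell2_norm_cmult c L2_set_cmult using N by (simp flip: N_def)
    also have "\<dots> = 1" using N by simp
    finally have "L2_set (\<lambda>j. ell2_norm S (\<lambda>x. c * \<xi> j x)) {..<n} = 1" .
    then show "L2_set (\<lambda>i. ell2_norm S (\<lambda>x. \<Sum>j<n. T i j (\<lambda>x. c * \<xi> j x) x)) {..<n}
      \<in> {L2_set (\<lambda>i. ell2_norm S (\<lambda>x. \<Sum>j<n. T i j (\<xi> j) x)) {..<n} | \<xi>.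
       (\<forall>j<n. \<xi> j \<in> ell2 S) \<and> L2_set (\<lambda>j. ell2_norm S (\<xi> j)) {..<n} \<le> 1}"
      using \<xi> by (intro CollectI exI[of _ "\<lambda>j x. c * \<xi> j x"]) simp
  qed
  moreover have "L2_set (\<lambda>i. ell2_norm S (\<lambda>x. \<Sum>j<n. T i j (\<lambda>x. c * \<xi> j x) x)) {..<n}
      = L2_set (\<lambda>i. (1 / N) * ell2_norm S (\<lambda>x. \<Sum>j<n. T i j (\<xi> j) x)) {..<n}"
  proof (rule L2_set_cong[OF refl])
    fix i assume i: "i \<in> {..<n}"
    have "T i j (\<lambda>x. c * \<xi> j x) = (\<lambda>x. c * T i j (\<xi> j) x)" if "j < n" for j
      by (rule bounded_operator_cmult[OF T \<xi>]) (use i that in simp_all)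
    then have "(\<lambda>x. \<Sum>j<n. T i j (\<lambda>x. c * \<xi> j x) x) = (\<lambda>x. c * (\<Sum>j<n. T i j (\<xi> j) x))"
      by (simp add: sum_distrib_left)
    then show "ell2_norm S (\<lambda>x. \<Sum>j<n. T i j (\<lambda>x. c * \<xi> j x) x) = (1 / N) * ell2_norm S (\<lambda>x. \<Sum>j<n. T i j (\<xi> j) x)"
      by (simp add: ell2_norm_cmult c)
  qed
  ultimately have "(1 / N) * L2_set (\<lambda>i. ell2_norm S (\<lambda>x. \<Sum>j<n. T i j (\<xi> j) x)) {..<n} \<le> operator_matrix_norm S n T"
    using N by (simp only: L2_set_cmult abs_of_nonneg zero_le_divide_1_iff less_imp_le)
  then show ?thesis using N by (simp add: field_simps flip: N_def)
qed

lemma bounded_operatorsI: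
  assumes "\<And>f. f \<in> ell2 S \<Longrightarrow> T f \<in> ell2 S" "\<And>f. f \<notin> ell2 S \<Longrightarrow> T f = (\<lambda>_. 0)"
    and "\<And>f g x. f \<in> ell2 S \<Longrightarrow> g \<in> ell2 S \<Longrightarrow> T (\<lambda>x. f x + g x) x = T f x + T g x"
    and "\<And>c f x. f \<in> ell2 S \<Longrightarrow> T (\<lambda>x. c * f x) x = c * T f x"
    and "\<And>f. f \<in> ell2 S \<Longrightarrow> ell2_norm S (T f) \<le> C * ell2_norm S f"
  shows "T \<in> bounded_operators S"
  unfolding bounded_operators_def using assms by (auto simp: fun_eq_iff intro!: exI[of _ C])

lemma bounded_operators_add:
  assumes A: "A \<in> bounded_operators S" and B: "B \<in> bounded_operators S"
  shows "(\<lambda>f x. A f x + B f x) \<in> bounded_operators S"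
proof -
  obtain C where C: "C \<ge> 0" "\<And>f. f \<in> ell2 S \<Longrightarrow> ell2_norm S (A f) \<le> C * ell2_norm S f"
    using bounded_operator_bound[OF A] by blast
  obtain D where D: "D \<ge> 0" "\<And>f. f \<in> ell2 S \<Longrightarrow> ell2_norm S (B f) \<le> D * ell2_norm S f"
    using bounded_operator_bound[OF B] by blast
  have "ell2_norm S (\<lambda>x. A f x + B f x) \<le> (C + D) * ell2_norm S f" if f: "f \<in> ell2 S" for f
    using ell2_norm_triangle[OF bounded_operator_ell2[OF A f] bounded_operator_ell2[OF B f]]
      C(2)[OF f] D(2)[OF f] by (simp add: distrib_right)
  then show ?thesis
    by (intro bounded_operatorsI[where C = "C + D"])
      (simp_all add: bounded_operator_ell2[OF A] bounded_operator_ell2[OF B]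
        bounded_operator_outside[OF A] bounded_operator_outside[OF B] bounded_operator_add[OF A]
        bounded_operator_add[OF B] bounded_operator_cmult[OF A] bounded_operator_cmult[OF B] distrib_left)
qed

lemma bounded_operators_scale:
  assumes A: "A \<in> bounded_operators S"
  shows "(\<lambda>f x. c * A f x) \<in> bounded_operators S"
proof -
  obtain C where C: "C \<ge> 0" "\<And>f. f \<in> ell2 S \<Longrightarrow> ell2_norm S (A f) \<le> C * ell2_norm S f"
    using bounded_operator_bound[OF A] by blast
  have "ell2_norm S (\<lambda>x. c * A f x) \<le> (cmod c * C) * ell2_norm S f" if f: "f \<in> ell2 S" for f
    using mult_left_mono[OF C(2)[OF f], of "cmod c"] by (simp add: ell2_norm_cmult mult.assoc)
  then show ?thesis
    by (intro bounded_operatorsI[where C = "cmod c * C"])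
      (simp_all add: bounded_operator_ell2[OF A] bounded_operator_outside[OF A] bounded_operator_add[OF A]
        bounded_operator_cmult[OF A] distrib_left)
qed

lemma bounded_operators_zero: "(\<lambda>f x. 0) \<in> bounded_operators S"
  unfolding bounded_operators_def by (auto intro: exI[of _ 0])

lemma bounded_operators_sum:
  "finite I \<Longrightarrow> (\<And>i. i \<in> I \<Longrightarrow> A i \<in> bounded_operators S) \<Longrightarrow> (\<lambda>f x. \<Sum>i\<in>I. A i f x) \<in> bounded_operators S"
proof (induction I rule: finite_induct)
  case empty
  show ?case by (simp add: bounded_operators_zero)
next
  case (insert i I)
  then have "(\<lambda>f x. A i f x + (\<Sum>i\<in>I. A i f x)) \<in> bounded_operators S"
    by (intro bounded_operators_add) auto
  with insert show ?case by simp
qed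

section \<open>The weak operator topology\<close>

lemma weak_operator_topology_basis:
  assumes "h \<in> ell2 S" "k \<in> ell2 S" "open W"
  shows "openin (weak_operator_topology S) {T \<in> bounded_operators S. ell2_inner S (T h) k \<in> W}"
  unfolding weak_operator_topology_def
  by (rule topology_generated_by_Basis, rule CollectI, intro exI conjI, rule refl)
    (use assms in simp_all)

lemma topspace_weak_operator_topology [simp]: "topspace (weak_operator_topology S) = bounded_operators S"
proof
  show "topspace (weak_operator_topology S) \<subseteq> bounded_operators S"
    by (auto simp: weak_operator_topology_def)
  show "bounded_operators S \<subseteq> topspace (weak_operator_topology S)"
    using openin_subset[OF weak_operator_topology_basis[of "\<lambda>_. 0" S "\<lambda>_. 0" UNIV]] by simp
qed

text \<open>Turns the closure in a generated topology into approximation at finitely many pairs of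
  vectors, the only form in which the topology is used below.\<close>

lemma weak_operator_closure_iff:
  assumes A: "A \<subseteq> bounded_operators S"
  shows "T \<in> weak_operator_topology S closure_of A \<longleftrightarrow> T \<in> bounded_operators S \<and>
    (\<forall>K e. finite K \<and> K \<subseteq> ell2 S \<times> ell2 S \<and> e > 0 \<longrightarrow>
      (\<exists>R\<in>A. \<forall>(f, g)\<in>K. cmod (ell2_inner S (R f) g - ell2_inner S (T f) g) < e))"
    (is "_ \<longleftrightarrow> _ \<and> ?approx")
proof
  assume T: "T \<in> weak_operator_topology S closure_of A"
  then have TB: "T \<in> bounded_operators S" by (auto simp: in_closure_of)
  have ?approx
  proof (intro allI impI)
    fix K and e :: real assume K: "finite K \<and> K \<subseteq> ell2 S \<times> ell2 S \<and> e > 0"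
    define N where "N = (\<lambda>(f, g). {R \<in> bounded_operators S. ell2_inner S (R f) g \<in> ball (ell2_inner S (T f) g) e})"
    \<comment> \<open>For empty \<open>K\<close> the intersection over \<open>K\<close> is
      everything, which is not an open set of this topology; hence the explicit intersection with
      the whole space.\<close>
    have "openin (weak_operator_topology S) (bounded_operators S \<inter> (\<Inter>p\<in>K. N p))"
    proof (cases "K = {}")
      case True
      then show ?thesis using openin_topspace[of "weak_operator_topology S"] by simp
    next
      case False
      have "openin (weak_operator_topology S) (N p)" if "p \<in> K" for p
      proof (cases p)
        case (Pair f g)
        then have "f \<in> ell2 S" "g \<in> ell2 S" using K that by auto
        then show ?thesis unfolding Pair N_def prod.case
          by (intro weak_operator_topology_basis open_ball)
      qed
      then have "openin (weak_operator_topology S) (\<Inter>p\<in>K. N p)"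
        using K False by (intro openin_Inter) auto
      moreover have "(\<Inter>p\<in>K. N p) \<subseteq> bounded_operators S" using False by (auto simp: N_def)
      ultimately show ?thesis by (simp add: Int_absorb1)
    qed
    moreover have "T \<in> bounded_operators S \<inter> (\<Inter>p\<in>K. N p)" using K TB by (auto simp: N_def)
    ultimately obtain R where R: "R \<in> A" "R \<in> (\<Inter>p\<in>K. N p)"
      using T unfolding in_closure_of by blast
    have "cmod (ell2_inner S (R f) g - ell2_inner S (T f) g) < e" if "(f, g) \<in> K" for f g
      using R(2) that by (auto simp: N_def dist_norm norm_minus_commute)
    then show "\<exists>R\<in>A. \<forall>(f, g)\<in>K. cmod (ell2_inner S (R f) g - ell2_inner S (T f) g) < e"
      using R(1) by auto
  qed
  with TB show "T \<in> bounded_operators S \<and> ?approx" ..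
next
  assume T: "T \<in> bounded_operators S \<and> ?approx"
  let ?near = "\<lambda>K e R. \<forall>(f, g)\<in>K. cmod (ell2_inner S (R f) g - ell2_inner S (T f) g) < e"
  \<comment> \<open>Every open set around \<open>T\<close> contains a basic neighbourhood. The
    induction follows the generation of the topology; an intersection is handled by the union of the
    finite sets and the smaller radius.\<close>
  let ?ok = "\<lambda>V. T \<in> V \<longrightarrow> (\<exists>K e. finite K \<and> K \<subseteq> ell2 S \<times> ell2 S \<and> e > 0 \<and>
      (\<forall>R\<in>bounded_operators S. ?near K e R \<longrightarrow> R \<in> V))"
  have "?ok V" if "openin (weak_operator_topology S) V" for V
    using that unfolding weak_operator_topology_def openin_topology_generated_by_iff
  proof (induction rule: generate_topology_on.induct)
    case (Int U V)
    show ?case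
    proof
      assume "T \<in> U \<inter> V"
      then obtain K e L d where "finite K" "K \<subseteq> ell2 S \<times> ell2 S" "e > 0"
          "\<forall>R\<in>bounded_operators S. ?near K e R \<longrightarrow> R \<in> U" "finite L" "L \<subseteq> ell2 S \<times> ell2 S" "d > 0"
          "\<forall>R\<in>bounded_operators S. ?near L d R \<longrightarrow> R \<in> V"
        using Int.IH by (elim IntE impE exE conjE) blast
      then show "\<exists>K e. finite K \<and> K \<subseteq> ell2 S \<times> ell2 S \<and> e > 0 \<and>
          (\<forall>R\<in>bounded_operators S. ?near K e R \<longrightarrow> R \<in> U \<inter> V)"
        by (intro exI[of _ "K \<union> L"] exI[of _ "min d e"])
          (simp add: ball_Un case_prod_beta)
    qed
  next
    case (UN \<U>)
    show ?case
    proof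
      assume "T \<in> \<Union>\<U>"
      then obtain V where V: "V \<in> \<U>" "T \<in> V" by blast
      then obtain K e where K: "finite K" "K \<subseteq> ell2 S \<times> ell2 S" "e > 0"
        and near: "\<forall>R\<in>bounded_operators S. ?near K e R \<longrightarrow> R \<in> V"
        using UN.IH[OF V(1)] by (elim impE exE conjE)
      show "\<exists>K e. finite K \<and> K \<subseteq> ell2 S \<times> ell2 S \<and> e > 0 \<and>
          (\<forall>R\<in>bounded_operators S. ?near K e R \<longrightarrow> R \<in> \<Union>\<U>)"
        using K near by (intro exI[of _ K] exI[of _ e] conjI ballI impI UnionI[OF V(1)]) simp_all
    qed
  next
    case (Basis V)
    then obtain f g W where V: "V = {R \<in> bounded_operators S. ell2_inner S (R f) g \<in> W}"
      and fg: "f \<in> ell2 S" "g \<in> ell2 S" "open W" by blast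
    show ?case
    proof
      assume "T \<in> V"
      then obtain e where e: "e > 0" "ball (ell2_inner S (T f) g) e \<subseteq> W"
        using fg(3) V by (auto simp: open_contains_ball)
      have "R \<in> V" if "R \<in> bounded_operators S" "cmod (ell2_inner S (R f) g - ell2_inner S (T f) g) < e" for R
        using that e(2) by (auto simp: V dist_norm norm_minus_commute)
      with fg e(1) show "\<exists>K e. finite K \<and> K \<subseteq> ell2 S \<times> ell2 S \<and> e > 0 \<and>
          (\<forall>R\<in>bounded_operators S. ?near K e R \<longrightarrow> R \<in> V)"
        by (intro exI[of _ "{(f, g)}"] exI[of _ e]) auto
    qed
  qed simp
  then have "\<exists>R. R \<in> A \<and> R \<in> V" if V: "openin (weak_operator_topology S) V" "T \<in> V" for V
  proof -
    obtain K e where K: "finite K" "K \<subseteq> ell2 S \<times> ell2 S" "e > 0"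
        and near: "\<forall>R\<in>bounded_operators S. ?near K e R \<longrightarrow> R \<in> V"
      using \<open>\<And>V. openin (weak_operator_topology S) V \<Longrightarrow> ?ok V\<close>[OF V(1)] V(2) by (elim impE exE conjE)
    obtain R where "R \<in> A" "?near K e R" using T K by (elim conjE allE[of _ K] allE[of _ e]) blast
    then show ?thesis using near A by blast
  qed
  then show "T \<in> weak_operator_topology S closure_of A" using T by (simp add: in_closure_of)
qed

section \<open>Convolution operators and the Fourier norm\<close>

context group
begin

section \<open>VN(G) as a linear space\<close>

lemma mult_inv_cancel [simp]:
  "x \<in> carrier G \<Longrightarrow> y \<in> carrier G \<Longrightarrow> x \<otimes> (inv x \<otimes> y) = y"
  "x \<in> carrier G \<Longrightarrow> y \<in> carrier G \<Longrightarrow> inv x \<otimes> (x \<otimes> y) = y"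
  by (simp_all add: m_assoc[symmetric])

lemma bij_left_translation:
  "x \<in> carrier G \<Longrightarrow> bij_betw (\<lambda>y. inv x \<otimes> y) (carrier G) (carrier G)"
  by (intro bij_betwI[where g = "\<lambda>y. x \<otimes> y"]) (auto simp: m_assoc[symmetric])

lemma bij_inverse_translation:
  "s \<in> carrier G \<Longrightarrow> bij_betw (\<lambda>y. s \<otimes> inv y) (carrier G) (carrier G)"
  by (intro bij_betwI[where g = "\<lambda>y. inv y \<otimes> s"]) (auto simp: m_assoc inv_mult_group)

lemma bij_inverse_translation':
  "s \<in> carrier G \<Longrightarrow> bij_betw (\<lambda>y. inv y \<otimes> s) (carrier G) (carrier G)"
  by (intro bij_betwI[where g = "\<lambda>y. s \<otimes> inv y"]) (auto simp: m_assoc inv_mult_group)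

lemma ell2_norm_left_regular:
  assumes "x \<in> carrier G" "f \<in> ell2 (carrier G)"
  shows "ell2_norm (carrier G) (left_regular G x f) = ell2_norm (carrier G) f"
  unfolding ell2_norm_def using assms
    infsum_reindex_bij_betw[OF bij_left_translation[OF assms(1)], of "\<lambda>y. (cmod (f y))\<^sup>2"]
  by (simp add: left_regular_def cong: infsum_cong)

lemma left_regular_bounded:
  assumes x: "x \<in> carrier G"
  shows "left_regular G x \<in> bounded_operators (carrier G)"
  unfolding bounded_operators_def
proof (intro CollectI conjI ballI allI impI)
  show "\<exists>C. \<forall>f\<in>ell2 (carrier G). ell2_norm (carrier G) (left_regular G x f) \<le> C * ell2_norm (carrier G) f"
    by (intro exI[of _ 1]) (simp add: ell2_norm_left_regular[OF x])
qed (auto simp: left_regular_in_ell2[OF x], auto simp: left_regular_def fun_eq_iff)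

lemma left_regular_span_bounded: "left_regular_span G \<subseteq> bounded_operators (carrier G)"
  unfolding left_regular_span_def
  by (auto intro!: bounded_operators_sum bounded_operators_scale left_regular_bounded)

lemmas VN_iff = weak_operator_closure_iff[OF left_regular_span_bounded, folded VN_def]

lemma VN_bounded: "T \<in> VN G \<Longrightarrow> T \<in> bounded_operators (carrier G)"
  using VN_iff by blast

lemma left_regular_span_VN: "R \<in> left_regular_span G \<Longrightarrow> R \<in> VN G"
  using left_regular_span_bounded closure_of_subset[of "left_regular_span G" "weak_operator_topology (carrier G)"]
  by (auto simp: VN_def)

lemma scaled_left_regular_VN:
  assumes "x \<in> carrier G"
  shows "(\<lambda>f y. c * left_regular G x f y) \<in> VN G"
  using assms
  by (intro left_regular_span_VN) (auto simp: left_regular_span_def intro!: exI[of _ "{x}"] exI[of _ "\<lambda>_. c"])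

lemma left_regular_span_add:
  assumes "R \<in> left_regular_span G" "R' \<in> left_regular_span G"
  shows "(\<lambda>f y. R f y + R' f y) \<in> left_regular_span G"
proof -
  obtain A a where A: "finite A" "A \<subseteq> carrier G" and R: "R = (\<lambda>f y. \<Sum>x\<in>A. a x * left_regular G x f y)"
    using assms(1) by (auto simp: left_regular_span_def)
  obtain B b where B: "finite B" "B \<subseteq> carrier G" and R': "R' = (\<lambda>f y. \<Sum>x\<in>B. b x * left_regular G x f y)"
    using assms(2) by (auto simp: left_regular_span_def)
  let ?c = "\<lambda>x. (if x \<in> A then a x else 0) + (if x \<in> B then b x else 0)"
  have "R f y + R' f y = (\<Sum>x\<in>A \<union> B. ?c x * left_regular G x f y)" for f y
  proof -
    have "R f y = (\<Sum>x\<in>A \<union> B. (if x \<in> A then a x else 0) * left_regular G x f y)"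
      unfolding R using A B by (intro sum.mono_neutral_cong_left) auto
    moreover have "R' f y = (\<Sum>x\<in>A \<union> B. (if x \<in> B then b x else 0) * left_regular G x f y)"
      unfolding R' using A B by (intro sum.mono_neutral_cong_left) auto
    ultimately show ?thesis by (simp add: sum.distrib distrib_right)
  qed
  then show ?thesis using A B
    unfolding left_regular_span_def by (intro CollectI exI[of _ "A \<union> B"] exI[of _ ?c]) auto
qed

lemma left_regular_span_scale:
  assumes "R \<in> left_regular_span G"
  shows "(\<lambda>f y. c * R f y) \<in> left_regular_span G"
proof -
  obtain A a where A: "finite A" "A \<subseteq> carrier G" and R: "R = (\<lambda>f y. \<Sum>x\<in>A. a x * left_regular G x f y)"
    using assms by (auto simp: left_regular_span_def)
  then show ?thesis unfolding left_regular_span_def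
    by (intro CollectI exI[of _ A] exI[of _ "\<lambda>x. c * a x"]) (auto simp: sum_distrib_left mult.assoc)
qed

lemma VN_add:
  assumes S: "S \<in> VN G" and T: "T \<in> VN G"
  shows "(\<lambda>f y. S f y + T f y) \<in> VN G"
  unfolding VN_iff
proof (intro conjI allI impI)
  show "(\<lambda>f y. S f y + T f y) \<in> bounded_operators (carrier G)"
    using S T by (intro bounded_operators_add VN_bounded)
  fix K and e :: real
  assume K: "finite K \<and> K \<subseteq> ell2 (carrier G) \<times> ell2 (carrier G) \<and> e > 0"
  then have "finite K \<and> K \<subseteq> ell2 (carrier G) \<times> ell2 (carrier G) \<and> e / 2 > 0" by simp
  then obtain P Q where P: "P \<in> left_regular_span G"
      "\<forall>(f, g)\<in>K. cmod (ell2_inner (carrier G) (P f) g - ell2_inner (carrier G) (S f) g) < e / 2"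
    and Q: "Q \<in> left_regular_span G"
      "\<forall>(f, g)\<in>K. cmod (ell2_inner (carrier G) (Q f) g - ell2_inner (carrier G) (T f) g) < e / 2"
    using S T unfolding VN_iff by meson
  have "cmod (ell2_inner (carrier G) (\<lambda>y. P f y + Q f y) g
      - ell2_inner (carrier G) (\<lambda>y. S f y + T f y) g) < e" if "(f, g) \<in> K" for f g
  proof -
    have fg: "f \<in> ell2 (carrier G)" "g \<in> ell2 (carrier G)" using K that by auto
    note [simp] = fg bounded_operator_ell2[OF VN_bounded[OF S] fg(1)] bounded_operator_ell2[OF VN_bounded[OF T] fg(1)]
      bounded_operator_ell2[OF VN_bounded[OF left_regular_span_VN[OF P(1)]] fg(1)]
      bounded_operator_ell2[OF VN_bounded[OF left_regular_span_VN[OF Q(1)]] fg(1)]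
    have "cmod (ell2_inner (carrier G) (P f) g - ell2_inner (carrier G) (S f) g) < e / 2"
      "cmod (ell2_inner (carrier G) (Q f) g - ell2_inner (carrier G) (T f) g) < e / 2"
      using P(2) Q(2) that by auto
    then show ?thesis
      using norm_triangle_ineq[of "ell2_inner (carrier G) (P f) g - ell2_inner (carrier G) (S f) g"
        "ell2_inner (carrier G) (Q f) g - ell2_inner (carrier G) (T f) g"]
      by (simp add: ell2_inner_add_left algebra_simps)
  qed
  then show "\<exists>R\<in>left_regular_span G. \<forall>(f, g)\<in>K.
      cmod (ell2_inner (carrier G) (R f) g - ell2_inner (carrier G) (\<lambda>y. S f y + T f y) g) < e"
    by (intro bexI[OF _ left_regular_span_add[OF P(1) Q(1)]]) auto
qed

lemma VN_scale:
  assumes T: "T \<in> VN G"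
  shows "(\<lambda>f y. c * T f y) \<in> VN G"
  unfolding VN_iff
proof (intro conjI allI impI)
  show "(\<lambda>f y. c * T f y) \<in> bounded_operators (carrier G)"
    using T by (intro bounded_operators_scale VN_bounded)
  fix K and e :: real
  assume K: "finite K \<and> K \<subseteq> ell2 (carrier G) \<times> ell2 (carrier G) \<and> e > 0"
  \<comment> \<open>The summand 1 covers c = 0.\<close>
  define d where "d = e / (cmod c + 1)"
  have d: "d > 0" "cmod c * d < e"
  proof -
    have "cmod c + 1 > 0" using norm_ge_zero[of c] by linarith
    then show "d > 0" "cmod c * d < e" using K by (auto simp: d_def field_simps)
  qed
  then obtain P where P: "P \<in> left_regular_span G"
      "\<forall>(f, g)\<in>K. cmod (ell2_inner (carrier G) (P f) g - ell2_inner (carrier G) (T f) g) < d"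
    using T K unfolding VN_iff by meson
  have "cmod (ell2_inner (carrier G) (\<lambda>y. c * P f y) g - ell2_inner (carrier G) (\<lambda>y. c * T f y) g) < e"
    if "(f, g) \<in> K" for f g
  proof -
    have "cmod (ell2_inner (carrier G) (P f) g - ell2_inner (carrier G) (T f) g) \<le> d"
      using P(2) that by fastforce
    then have "cmod c * cmod (ell2_inner (carrier G) (P f) g - ell2_inner (carrier G) (T f) g) \<le> cmod c * d"
      by (rule mult_left_mono) simp
    then show ?thesis
      using d(2) by (simp add: ell2_inner_cmult_left flip: norm_mult right_diff_distrib)
  qed
  then show "\<exists>R\<in>left_regular_span G. \<forall>(f, g)\<in>K.
      cmod (ell2_inner (carrier G) (R f) g - ell2_inner (carrier G) (\<lambda>y. c * T f y) g) < e"
    by (intro bexI[OF _ left_regular_span_scale[OF P(1)]]) auto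
qed

lemma VN_diff: "S \<in> VN G \<Longrightarrow> T \<in> VN G \<Longrightarrow> (\<lambda>f y. S f y - T f y) \<in> VN G"
  using VN_add[of S "\<lambda>f y. (-1) * T f y"] VN_scale[of T "-1"] by simp

section \<open>Coefficient functions of operators in VN(G)\<close>

lemma left_regular_delta:
  assumes "x \<in> carrier G" "t \<in> carrier G"
  shows "left_regular G x (delta t) = delta (x \<otimes> t)"
proof
  fix y
  have "inv x \<otimes> y = t \<longleftrightarrow> y = x \<otimes> t" if "y \<in> carrier G"
    using that assms by auto
  moreover have "left_regular G x (delta t) y = (if y \<in> carrier G then delta t (inv x \<otimes> y) else 0)"
    using assms by (simp add: left_regular_def)
  ultimately show "left_regular G x (delta t) y = delta (x \<otimes> t) y"
    using assms by (auto simp: delta_def)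
qed

lemma coefficient_delta_right:
  assumes "f \<in> ell2 (carrier G)" "s \<in> carrier G" "x \<in> carrier G"
  shows "coefficient G f (delta s) x = f (inv x \<otimes> s)"
  using assms by (simp add: coefficient_def ell2_inner_delta_right left_regular_def)

lemma coefficient_delta_ell2:
  assumes f: "f \<in> ell2 (carrier G)" and s: "s \<in> carrier G"
  shows "coefficient G f (delta s) \<in> ell2 (carrier G)"
proof -
  have "(\<lambda>y. (cmod (f (inv y \<otimes> s)))\<^sup>2) summable_on carrier G"
    using f summable_on_reindex_bij_betw[OF bij_inverse_translation'[OF s], of "\<lambda>y. (cmod (f y))\<^sup>2"]
    by (simp add: ell2_def)
  then have "(\<lambda>y. (cmod (coefficient G f (delta s) y))\<^sup>2) summable_on carrier G"
    using f s by (simp add: coefficient_delta_right cong: summable_on_cong)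
  then show ?thesis by (simp add: ell2_def coefficient_def)
qed

text \<open>The source of the inclusion of \<open>ell2 (carrier G)\<close> in A(G) and of the bound
  of the Fourier norm by the \<open>ell2\<close> norm.\<close>

lemma coefficient_delta_one:
  assumes "h \<in> ell2 (carrier G)"
  shows "coefficient G (delta \<one>) (\<lambda>x. cnj (h x)) = h"
proof
  fix x
  show "coefficient G (delta \<one>) (\<lambda>x. cnj (h x)) x = h x"
  proof (cases "x \<in> carrier G")
    case True
    then have "coefficient G (delta \<one>) (\<lambda>x. cnj (h x)) x = ell2_inner (carrier G) (delta x) (\<lambda>x. cnj (h x))"
      by (simp add: coefficient_def left_regular_delta)
    also have "\<dots> = h x"
      using True by (subst ell2_inner_commute) (simp add: ell2_inner_delta_right)
    finally show ?thesis .
  next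
    case False
    then show ?thesis using assms by (simp add: coefficient_def ell2_def)
  qed
qed

lemma coefficient_deltas:
  assumes "s \<in> carrier G" "t \<in> carrier G"
  shows "coefficient G (delta t) (delta s) = delta (s \<otimes> inv t)"
proof
  fix x
  show "coefficient G (delta t) (delta s) x = delta (s \<otimes> inv t) x"
  proof (cases "x \<in> carrier G")
    case True
    have "inv x \<otimes> s = t \<longleftrightarrow> x = s \<otimes> inv t"
      using True assms by (metis inv_closed inv_solve_left inv_solve_right m_closed)
    moreover have "coefficient G (delta t) (delta s) x = delta t (inv x \<otimes> s)"
      using True assms by (simp add: coefficient_delta_right)
    ultimately show ?thesis by (auto simp: delta_def)
  next
    case False
    then show ?thesis using assms by (auto simp: coefficient_def delta_def)
  qed
qed

lemma coefficient_in_fourier [simp]: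
  "f \<in> ell2 (carrier G) \<Longrightarrow> g \<in> ell2 (carrier G) \<Longrightarrow> coefficient G f g \<in> fourier_algebra G"
  by (auto simp: fourier_algebra_def)

lemma ell2_subset_fourier: "h \<in> ell2 (carrier G) \<Longrightarrow> h \<in> fourier_algebra G"
  using coefficient_delta_one[of h] coefficient_in_fourier[of "delta \<one>" "\<lambda>x. cnj (h x)"] by simp

text \<open>Reading \<open>h\<close> as a coefficient of \<open>delta \<one>\<close> shows that the
  pairing sees \<open>T\<close> only through the function \<open>T (delta \<one>)\<close>. Its value
  at x is the coefficient T(x) of \<lambda>(x) in the formal series of \<open>T\<close>.\<close>

lemma pairing_ell2:
  assumes "T \<in> VN G" "h \<in> ell2 (carrier G)"
  shows "((\<lambda>x. T (delta \<one>) x * h x) has_sum pairing G h T) (carrier G)"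
proof -
  have h: "(\<lambda>x. cnj (h x)) \<in> ell2 (carrier G)" using assms by simp
  have "pairing G h T = ell2_inner (carrier G) (T (delta \<one>)) (\<lambda>x. cnj (h x))"
    using pairing_coefficient[OF assms(1) _ h, of "delta \<one>"] coefficient_delta_one[OF assms(2)] by simp
  moreover have "(\<lambda>x. T (delta \<one>) x * cnj (cnj (h x))) summable_on carrier G"
    by (rule ell2_inner_summable[OF bounded_operator_ell2[OF VN_bounded[OF assms(1)]] h]) simp
  ultimately show ?thesis by (simp add: ell2_inner_def)
qed

lemma pairing_delta:
  assumes "T \<in> VN G" "x \<in> carrier G"
  shows "pairing G (delta x) T = T (delta \<one>) x"
proof -
  have "((\<lambda>y. T (delta \<one>) y * delta x y) has_sum T (delta \<one>) x) (carrier G)"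
    using has_sum_cong_neutral[where S = "{x}" and T = "carrier G"
        and f = "\<lambda>y. T (delta \<one>) y * delta x y" and g = "\<lambda>y. T (delta \<one>) y * delta x y" and x = "T (delta \<one>) x"]
      has_sum_finiteI[of "{x}" "T (delta \<one>) x" "\<lambda>y. T (delta \<one>) y * delta x y"] assms(2) by auto
  with pairing_ell2[OF assms(1), of "delta x"] assms(2) show ?thesis
    using has_sum_unique by fastforce
qed

text \<open>The value of \<open>T f\<close> at \<open>s\<close> is the pairing of \<open>T\<close>
  with the coefficient of \<open>f\<close> and \<open>delta s\<close>, which is square-summable. So
  \<open>T\<close> is convolution by \<open>T (delta \<one>)\<close>; weak closure enters only
  through the pairing being well defined.\<close>

lemma VN_apply:
  assumes T: "T \<in> VN G" and f: "f \<in> ell2 (carrier G)" and s: "s \<in> carrier G"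
  shows "((\<lambda>t. T (delta \<one>) (s \<otimes> inv t) * f t) has_sum T f s) (carrier G)"
proof -
  let ?h = "coefficient G f (delta s)"
  have h: "?h \<in> ell2 (carrier G)" by (rule coefficient_delta_ell2[OF f s])
  have "pairing G ?h T = T f s"
    using pairing_coefficient[OF T f, of "delta s"] s by (simp add: ell2_inner_delta_right)
  then have "((\<lambda>x. T (delta \<one>) x * ?h x) has_sum T f s) (carrier G)"
    using pairing_ell2[OF T h] by simp
  then have "((\<lambda>t. T (delta \<one>) (s \<otimes> inv t) * ?h (s \<otimes> inv t)) has_sum T f s) (carrier G)"
    using has_sum_reindex_bij_betw[OF bij_inverse_translation[OF s], of "\<lambda>x. T (delta \<one>) x * ?h x" "T f s"] by simp
  moreover have "?h (s \<otimes> inv t) = f t" if "t \<in> carrier G" for t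
    using that s f by (simp add: coefficient_delta_right inv_mult_group m_assoc)
  ultimately show ?thesis by (simp cong: has_sum_cong)
qed

lemma VN_delta:
  assumes T: "T \<in> VN G" and st: "s \<in> carrier G" "t \<in> carrier G"
  shows "T (delta t) s = T (delta \<one>) (s \<otimes> inv t)"
proof -
  have "pairing G (delta (s \<otimes> inv t)) T = T (delta t) s"
    using pairing_coefficient[OF T, of "delta t" "delta s"] coefficient_deltas[OF st] st
    by (simp add: ell2_inner_delta_right)
  then show ?thesis using pairing_delta[OF T, of "s \<otimes> inv t"] st by simp
qed

text \<open>That is, \<open>delta \<one>\<close> is a separating vector for VN(G). Off
  \<open>ell2\<close> and off the carrier both operators give 0 by convention.\<close>

lemma VN_eqI:
  assumes S: "S \<in> VN G" and T: "T \<in> VN G"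
    and eq: "\<And>x. x \<in> carrier G \<Longrightarrow> S (delta \<one>) x = T (delta \<one>) x"
  shows "S = T"
proof (intro ext)
  fix f s
  show "S f s = T f s"
  proof (cases "f \<in> ell2 (carrier G) \<and> s \<in> carrier G")
    case True
    have "((\<lambda>t. T (delta \<one>) (s \<otimes> inv t) * f t) has_sum S f s) (carrier G)"
      using VN_apply[OF S, of f s] True by (simp add: eq cong: has_sum_cong)
    then show ?thesis using VN_apply[OF T, of f s] True has_sum_unique by blast
  next
    case False
    have 0: "R f s = 0" if "R \<in> VN G" for R
      using False bounded_operator_ell2[OF VN_bounded[OF that], of f]
        bounded_operator_outside[OF VN_bounded[OF that], of f]
      by (cases "f \<in> ell2 (carrier G)") (auto simp: ell2_def)
    show ?thesis by (simp only: 0[OF S] 0[OF T])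
  qed
qed

section \<open>The pairing and the Fourier norm\<close>

lemma pairing_bound:
  assumes "T \<in> VN G" "f \<in> ell2 (carrier G)" "g \<in> ell2 (carrier G)"
  shows "cmod (pairing G (coefficient G f g) T)
    \<le> operator_norm (carrier G) T * (ell2_norm (carrier G) f * ell2_norm (carrier G) g)"
proof -
  have "cmod (ell2_inner (carrier G) (T f) g) \<le> ell2_norm (carrier G) (T f) * ell2_norm (carrier G) g"
    using assms by (intro ell2_cauchy_schwarz bounded_operator_ell2[OF VN_bounded[OF assms(1)]])
  also have "\<dots> \<le> operator_norm (carrier G) T * ell2_norm (carrier G) f * ell2_norm (carrier G) g"
    using assms by (intro mult_right_mono operator_norm_apply[OF VN_bounded[OF assms(1)]]) auto
  finally show ?thesis using assms by (simp add: pairing_coefficient mult.assoc)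
qed

lemma pairing_scale:
  assumes T: "T \<in> VN G" and u: "u \<in> fourier_algebra G"
  shows "pairing G u (\<lambda>f y. c * T f y) = c * pairing G u T"
  using u pairing_coefficient[OF T] pairing_coefficient[OF VN_scale[OF T]]
  by (auto simp: fourier_algebra_def ell2_inner_cmult_left)

lemma pairing_scaled_left_regular:
  assumes u: "u \<in> fourier_algebra G" and x: "x \<in> carrier G"
  shows "pairing G u (\<lambda>f y. c * left_regular G x f y) = c * u x"
  using u x pairing_coefficient[OF scaled_left_regular_VN[OF x]]
  by (auto simp: fourier_algebra_def ell2_inner_cmult_left coefficient_def)

text \<open>The three functions come with unrelated representations as coefficients. On
  \<open>left_regular_span\<close> the pairing is a finite combination of function values and thus
  additive; the general case follows by approximating \<open>T\<close> at the three pairs of vectors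
  at once, each within a third of the defect.\<close>

lemma pairing_add:
  assumes T: "T \<in> VN G" and "u \<in> fourier_algebra G" "v \<in> fourier_algebra G"
    and "(\<lambda>x. u x + v x) \<in> fourier_algebra G"
  shows "pairing G (\<lambda>x. u x + v x) T = pairing G u T + pairing G v T"
proof (rule ccontr)
  let ?I = "ell2_inner (carrier G)"
  obtain f g where fg: "f \<in> ell2 (carrier G)" "g \<in> ell2 (carrier G)" "u = coefficient G f g"
    using assms by (auto simp: fourier_algebra_def)
  obtain h k where hk: "h \<in> ell2 (carrier G)" "k \<in> ell2 (carrier G)" "v = coefficient G h k"
    using assms by (auto simp: fourier_algebra_def)
  obtain p q where pq: "p \<in> ell2 (carrier G)" "q \<in> ell2 (carrier G)" "(\<lambda>x. u x + v x) = coefficient G p q"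
    using assms by (auto simp: fourier_algebra_def)
  define d where "d = ?I (T p) q - (?I (T f) g + ?I (T h) k)"
  assume "pairing G (\<lambda>x. u x + v x) T \<noteq> pairing G u T + pairing G v T"
  then have "d \<noteq> 0"
    using T fg hk pq by (simp add: d_def pairing_coefficient)
  then have "finite {(f, g), (h, k), (p, q)} \<and> {(f, g), (h, k), (p, q)} \<subseteq> ell2 (carrier G) \<times> ell2 (carrier G)
      \<and> cmod d / 3 > 0"
    using fg hk pq by simp
  then obtain R where R: "R \<in> left_regular_span G"
      "\<forall>(f, g)\<in>{(f, g), (h, k), (p, q)}. cmod (?I (R f) g - ?I (T f) g) < cmod d / 3"
    using T unfolding VN_iff by meson
  obtain A a where A: "finite A" "A \<subseteq> carrier G" and R_eq: "R = (\<lambda>f y. \<Sum>x\<in>A. a x * left_regular G x f y)"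
    using R(1) by (auto simp: left_regular_span_def)
  have "?I (R p) q = ?I (R f) g + ?I (R h) k"
    unfolding R_eq inner_left_regular_span[OF A fg(1,2)] inner_left_regular_span[OF A hk(1,2)]
      inner_left_regular_span[OF A pq(1,2)] pq(3)[symmetric] fg(3)[symmetric] hk(3)[symmetric]
    by (simp add: distrib_left sum.distrib)
  then have "d = (?I (R f) g - ?I (T f) g) + (?I (R h) k - ?I (T h) k) - (?I (R p) q - ?I (T p) q)"
    by (simp add: d_def)
  moreover have "cmod (a + b - c) \<le> cmod a + cmod b + cmod c" for a b c
    using norm_triangle_ineq4[of "a + b" c] norm_triangle_ineq[of a b] by linarith
  ultimately have "cmod d \<le> cmod (?I (R f) g - ?I (T f) g) + cmod (?I (R h) k - ?I (T h) k)
      + cmod (?I (R p) q - ?I (T p) q)"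
    by metis
  also have "\<dots> < cmod d" using R(2) by simp
  finally show False by simp
qed

lemma fourier_norm_bdd:
  assumes "u \<in> fourier_algebra G"
  shows "bdd_above {cmod (pairing G u T) | T. T \<in> VN G \<and> operator_norm (carrier G) T \<le> 1}"
proof -
  obtain f g where fg: "f \<in> ell2 (carrier G)" "g \<in> ell2 (carrier G)" "u = coefficient G f g"
    using assms by (auto simp: fourier_algebra_def)
  have bnd: "cmod (pairing G u T) \<le> ell2_norm (carrier G) f * ell2_norm (carrier G) g"
    if "T \<in> VN G" "operator_norm (carrier G) T \<le> 1" for T
    using pairing_bound[OF that(1) fg(1,2)]
      mult_right_mono[OF that(2), of "ell2_norm (carrier G) f * ell2_norm (carrier G) g"]
    by (simp add: fg(3))
  show ?thesis by (rule bdd_aboveI[of _ "ell2_norm (carrier G) f * ell2_norm (carrier G) g"])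
    (elim CollectE exE conjE, simp only: bnd)
qed

lemma zero_VN: "(\<lambda>f y. 0) \<in> VN G"
  using scaled_left_regular_VN[OF one_closed, of 0] by simp

lemma operator_norm_zero: "operator_norm (carrier G) (\<lambda>f y. 0) \<le> 0"
  by (rule operator_norm_le) auto

lemma fourier_norm_le:
  assumes "\<And>T. T \<in> VN G \<Longrightarrow> operator_norm (carrier G) T \<le> 1 \<Longrightarrow> cmod (pairing G u T) \<le> c"
  shows "fourier_norm G u \<le> c"
  unfolding fourier_norm_def
proof (rule cSup_least)
  show "{cmod (pairing G u T) |T. T \<in> VN G \<and> operator_norm (carrier G) T \<le> 1} \<noteq> {}"
    using zero_VN operator_norm_zero by (auto intro!: exI[of _ "\<lambda>f y. 0"] intro: order_trans)
qed (use assms in auto)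

lemma pairing_le_fourier_norm_1:
  assumes "u \<in> fourier_algebra G" "T \<in> VN G" "operator_norm (carrier G) T \<le> 1"
  shows "cmod (pairing G u T) \<le> fourier_norm G u"
  unfolding fourier_norm_def
  by (rule cSup_upper[OF _ fourier_norm_bdd[OF assms(1)]]) (use assms in auto)

lemma fourier_norm_nonneg: "u \<in> fourier_algebra G \<Longrightarrow> 0 \<le> fourier_norm G u"
  using pairing_le_fourier_norm_1[OF _ zero_VN] operator_norm_zero norm_ge_zero order_trans zero_le_one
  by meson

text \<open>A positive upper bound \<open>c\<close> stands in for the operator norm because the
  proof divides by it.\<close>

lemma pairing_le_fourier_norm:
  assumes u: "u \<in> fourier_algebra G" and T: "T \<in> VN G" and c: "operator_norm (carrier G) T \<le> c" "0 < c"
  shows "cmod (pairing G u T) \<le> c * fourier_norm G u"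
proof -
  let ?S = "\<lambda>f y. complex_of_real (1 / c) * T f y"
  have "operator_norm (carrier G) ?S \<le> 1"
  proof (rule operator_norm_le)
    fix f assume f: "f \<in> ell2 (carrier G)"
    have "ell2_norm (carrier G) (T f) \<le> c * ell2_norm (carrier G) f"
      using operator_norm_apply[OF VN_bounded[OF T] f] mult_right_mono[OF c(1), of "ell2_norm (carrier G) f"] by simp
    then show "ell2_norm (carrier G) (?S f) \<le> 1 * ell2_norm (carrier G) f"
      using c(2) by (simp only: ell2_norm_cmult) (simp add: norm_divide field_simps)
  qed simp
  then have "cmod (pairing G u ?S) \<le> fourier_norm G u"
    by (intro pairing_le_fourier_norm_1 u VN_scale T)
  then have "cmod (pairing G u T) / c \<le> fourier_norm G u"
    using c(2) by (simp only: pairing_scale[OF T u]) (simp add: norm_mult norm_divide)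
  then show ?thesis using c(2) by (simp add: field_simps)
qed

lemma fourier_norm_coefficient:
  assumes "f \<in> ell2 (carrier G)" "g \<in> ell2 (carrier G)"
  shows "fourier_norm G (coefficient G f g) \<le> ell2_norm (carrier G) f * ell2_norm (carrier G) g"
proof (rule fourier_norm_le)
  fix T assume T: "T \<in> VN G" "operator_norm (carrier G) T \<le> 1"
  show "cmod (pairing G (coefficient G f g) T) \<le> ell2_norm (carrier G) f * ell2_norm (carrier G) g"
    using pairing_bound[OF T(1) assms]
      mult_right_mono[OF T(2), of "ell2_norm (carrier G) f * ell2_norm (carrier G) g"] by simp
qed

lemma fourier_norm_ell2:
  assumes "h \<in> ell2 (carrier G)"
  shows "fourier_norm G h \<le> ell2_norm (carrier G) h"
  using fourier_norm_coefficient[of "delta \<one>" "\<lambda>x. cnj (h x)"] assms by (simp add: coefficient_delta_one)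

lemma fourier_norm_triangle:
  assumes "u \<in> fourier_algebra G" "v \<in> fourier_algebra G" "(\<lambda>x. u x + v x) \<in> fourier_algebra G"
  shows "fourier_norm G (\<lambda>x. u x + v x) \<le> fourier_norm G u + fourier_norm G v"
proof (rule fourier_norm_le)
  fix T assume T: "T \<in> VN G" "operator_norm (carrier G) T \<le> 1"
  show "cmod (pairing G (\<lambda>x. u x + v x) T) \<le> fourier_norm G u + fourier_norm G v"
    using pairing_le_fourier_norm_1[OF assms(1) T] pairing_le_fourier_norm_1[OF assms(2) T]
      norm_triangle_ineq[of "pairing G u T" "pairing G v T"]
    by (simp add: pairing_add[OF T(1) assms])
qed

end

section \<open>Sets on which coefficient functions are square-summable\<close>

text \<open>The common ground of both halves of the theorem: Leinert sets satisfy it, and so does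
  the explicit set of words of length two. Finite sums make summability part of the
  condition.\<close>

definition restricts_to_ell2 :: "('a, 'm) monoid_scheme \<Rightarrow> 'a set \<Rightarrow> real \<Rightarrow> bool" where
  "restricts_to_ell2 G E C \<longleftrightarrow> E \<subseteq> carrier G \<and> 0 \<le> C \<and>
     (\<forall>f\<in>ell2 (carrier G). \<forall>g\<in>ell2 (carrier G). \<forall>F. finite F \<and> F \<subseteq> E \<longrightarrow>
       (\<Sum>x\<in>F. (cmod (coefficient G f g x))\<^sup>2) \<le> (C * (ell2_norm (carrier G) f * ell2_norm (carrier G) g))\<^sup>2)"

text \<open>The operator \<Sum> a(x) \<lambda>(x) over x in \<open>E\<close>, written pointwise so
  that it makes sense before boundedness is known.\<close>

definition convolution :: "('a, 'm) monoid_scheme \<Rightarrow> 'a set \<Rightarrow> ('a \<Rightarrow> complex) \<Rightarrow> 'a operator" where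
  "convolution G E a f =
     (\<lambda>y. if f \<in> ell2 (carrier G) \<and> y \<in> carrier G then \<Sum>\<^sub>\<infinity>x\<in>E. a x * f (inv\<^bsub>G\<^esub> x \<otimes>\<^bsub>G\<^esub> y) else 0)"

locale ell2_restricted = group G for G (structure) +
  fixes E :: "'a set" and C :: real
  assumes restricts: "restricts_to_ell2 G E C"
begin

lemma E_subset: "E \<subseteq> carrier G" and C_nonneg: "0 \<le> C"
  using restricts by (simp_all add: restricts_to_ell2_def)

lemma E_carrier [simp]: "x \<in> E \<Longrightarrow> x \<in> carrier G"
  using E_subset by blast

section \<open>Convolution operators supported on E\<close>

lemma restriction_ell2:
  assumes "f \<in> ell2 (carrier G)" "g \<in> ell2 (carrier G)"
  shows "restrict_to E (coefficient G f g) \<in> ell2 E"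
    and "ell2_norm E (restrict_to E (coefficient G f g)) \<le> C * (ell2_norm (carrier G) f * ell2_norm (carrier G) g)"
proof -
  let ?c = "C * (ell2_norm (carrier G) f * ell2_norm (carrier G) g)"
  have *: "(\<Sum>x\<in>F. (cmod (restrict_to E (coefficient G f g) x))\<^sup>2) \<le> ?c\<^sup>2" if "finite F" "F \<subseteq> E" for F
  proof -
    have "(\<Sum>x\<in>F. (cmod (restrict_to E (coefficient G f g) x))\<^sup>2) = (\<Sum>x\<in>F. (cmod (coefficient G f g x))\<^sup>2)"
      using that by (intro sum.cong) (auto simp: restrict_to_def)
    then show ?thesis using restricts that assms by (simp add: restricts_to_ell2_def)
  qed
  show "restrict_to E (coefficient G f g) \<in> ell2 E"
    by (rule ell2I[OF _ *]) (simp_all add: restrict_to_def)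
  show "ell2_norm E (restrict_to E (coefficient G f g)) \<le> ?c"
    by (rule ell2_norm_le) (auto simp: * C_nonneg)
qed

lemma ell2_E_carrier: "a \<in> ell2 E \<Longrightarrow> a \<in> ell2 (carrier G)"
  using E_subset by (rule ell2_mono[rotated])

lemma convolution_summable:
  assumes a: "a \<in> ell2 E" and f: "f \<in> ell2 (carrier G)" and y: "y \<in> carrier G"
  shows "(\<lambda>x. a x * f (inv x \<otimes> y)) summable_on E"
proof -
  have "(\<lambda>x. a x * cnj (cnj (coefficient G f (delta y) x))) summable_on carrier G"
    by (intro ell2_inner_summable ell2_E_carrier[OF a] ell2_cnj[THEN iffD2] coefficient_delta_ell2 f y)
  then have "(\<lambda>x. a x * coefficient G f (delta y) x) summable_on E"
    using E_subset by (auto intro: summable_on_subset_banach)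
  then show ?thesis using f y by (simp add: coefficient_delta_right cong: summable_on_cong)
qed

text \<open>Convolution by \<open>a\<close> is dual to restricting coefficients to \<open>E\<close>;
  finite support of \<open>g\<close> justifies exchanging the two sums.\<close>

lemma convolution_finite_inner:
  assumes a: "a \<in> ell2 E" and f: "f \<in> ell2 (carrier G)" and F: "finite F" "F \<subseteq> carrier G"
    and g: "\<And>y. y \<notin> F \<Longrightarrow> g y = 0"
  shows "(\<Sum>y\<in>F. convolution G E a f y * cnj (g y)) =
    ell2_inner E a (\<lambda>x. cnj (restrict_to E (coefficient G f g) x))"
proof -
  have 1: "((\<lambda>x. \<Sum>y\<in>F. a x * f (inv x \<otimes> y) * cnj (g y)) has_sum
      (\<Sum>y\<in>F. \<Sum>\<^sub>\<infinity>x\<in>E. a x * f (inv x \<otimes> y) * cnj (g y))) E"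
    using F by (intro has_sum_finite_sum summable_on_cmult_left convolution_summable a f) auto
  have 2: "(\<Sum>y\<in>F. \<Sum>\<^sub>\<infinity>x\<in>E. a x * f (inv x \<otimes> y) * cnj (g y)) =
      (\<Sum>y\<in>F. convolution G E a f y * cnj (g y))"
    using F f by (intro sum.cong refl) (auto simp: convolution_def infsum_cmult_left')
  have 3: "(\<Sum>y\<in>F. a x * f (inv x \<otimes> y) * cnj (g y)) =
      a x * cnj (cnj (restrict_to E (coefficient G f g) x))" if x: "x \<in> E" for x
  proof -
    have "coefficient G f g x = (\<Sum>\<^sub>\<infinity>y\<in>carrier G. left_regular G x f y * cnj (g y))"
      using x by (simp add: coefficient_def ell2_inner_def)
    also have "\<dots> = (\<Sum>\<^sub>\<infinity>y\<in>F. f (inv x \<otimes> y) * cnj (g y))"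
      by (rule infsum_cong_neutral) (use f F in \<open>auto simp: left_regular_def g\<close>)
    finally show ?thesis using x F by (simp add: restrict_to_def sum_distrib_left mult.assoc)
  qed
  have "((\<lambda>x. a x * cnj (cnj (restrict_to E (coefficient G f g) x))) has_sum
      (\<Sum>y\<in>F. convolution G E a f y * cnj (g y))) E"
    using 1 unfolding 2 by (rule has_sum_cong[THEN iffD1, rotated]) (rule 3)
  then show ?thesis unfolding ell2_inner_def by (rule infsumI[symmetric])
qed

text \<open>Pair the convolution with its own truncation \<open>g\<close> to a finite set. The
  result is the squared norm of \<open>g\<close>, while duality and the hypothesis on
  \<open>E\<close> bound it by a constant times the norm of \<open>g\<close>, which can be
  cancelled.\<close>

lemma convolution_norm:
  assumes a: "a \<in> ell2 E" and f: "f \<in> ell2 (carrier G)"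
  shows "convolution G E a f \<in> ell2 (carrier G)"
    and "ell2_norm (carrier G) (convolution G E a f) \<le> C * ell2_norm E a * ell2_norm (carrier G) f"
proof -
  let ?c = "C * ell2_norm E a * ell2_norm (carrier G) f"
  have c0: "0 \<le> ?c" by (simp add: C_nonneg)
  have bnd: "(\<Sum>y\<in>F. (cmod (convolution G E a f y))\<^sup>2) \<le> ?c\<^sup>2" if F: "finite F" "F \<subseteq> carrier G" for F
  proof -
    define g where "g y = (if y \<in> F then convolution G E a f y else 0)" for y
    have g: "g \<in> ell2 (carrier G)" and "(ell2_norm (carrier G) g)\<^sup>2 = (\<Sum>y\<in>F. (cmod (g y))\<^sup>2)"
      by (rule finite_support_ell2[OF F], simp add: g_def)+
    then have N: "(ell2_norm (carrier G) g)\<^sup>2 = (\<Sum>y\<in>F. (cmod (convolution G E a f y))\<^sup>2)"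
      by (simp add: g_def)
    note res = restriction_ell2[OF f g]
    have "complex_of_real ((ell2_norm (carrier G) g)\<^sup>2) = (\<Sum>y\<in>F. convolution G E a f y * cnj (g y))"
      unfolding N of_real_sum by (intro sum.cong refl) (simp add: g_def complex_norm_square del: of_real_power)
    also have "\<dots> = ell2_inner E a (\<lambda>x. cnj (restrict_to E (coefficient G f g) x))"
      by (rule convolution_finite_inner[OF a f F]) (simp add: g_def)
    finally have "(ell2_norm (carrier G) g)\<^sup>2 = cmod (ell2_inner E a (\<lambda>x. cnj (restrict_to E (coefficient G f g) x)))"
      by (metis abs_of_nonneg norm_of_real zero_le_power2)
    also have "\<dots> \<le> ell2_norm E a * ell2_norm E (restrict_to E (coefficient G f g))"
      using ell2_cauchy_schwarz[OF a, of "\<lambda>x. cnj (restrict_to E (coefficient G f g) x)"] res(1) by simp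
    also have "\<dots> \<le> ell2_norm E a * (C * (ell2_norm (carrier G) f * ell2_norm (carrier G) g))"
      by (intro mult_left_mono res) simp
    finally have "ell2_norm (carrier G) g * ell2_norm (carrier G) g \<le> ?c * ell2_norm (carrier G) g"
      by (simp add: power2_eq_square algebra_simps)
    then have "ell2_norm (carrier G) g \<le> ?c"
      using c0 by (cases "ell2_norm (carrier G) g = 0") (auto simp: mult_le_cancel_right)
    then have "(ell2_norm (carrier G) g)\<^sup>2 \<le> ?c\<^sup>2" by (intro power_mono) simp_all
    then show ?thesis by (simp add: N)
  qed
  show "convolution G E a f \<in> ell2 (carrier G)"
    by (rule ell2I[OF _ bnd]) (auto simp: convolution_def)
  show "ell2_norm (carrier G) (convolution G E a f) \<le> ?c"
    by (rule ell2_norm_le[OF c0 bnd])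
qed

lemma convolution_bounded:
  assumes a: "a \<in> ell2 E"
  shows "convolution G E a \<in> bounded_operators (carrier G)"
proof (rule bounded_operatorsI[where C = "C * ell2_norm E a"])
  fix f g x assume fg: "f \<in> ell2 (carrier G)" "g \<in> ell2 (carrier G)"
  show "convolution G E a (\<lambda>x. f x + g x) x = convolution G E a f x + convolution G E a g x"
    using fg infsum_add[OF convolution_summable[OF a fg(1)] convolution_summable[OF a fg(2)], of x x]
    by (simp add: convolution_def distrib_left)
next
  fix c f x assume f: "f \<in> ell2 (carrier G)"
  show "convolution G E a (\<lambda>x. c * f x) x = c * convolution G E a f x"
    using f by (simp add: convolution_def mult.left_commute infsum_cmult_right')
next
  show "convolution G E a f = (\<lambda>_. 0)" if "f \<notin> ell2 (carrier G)" for f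
    using that by (simp add: convolution_def)
qed (rule convolution_norm[OF a], assumption)+

lemma convolution_cut:
  assumes a: "a \<in> ell2 E" and f: "f \<in> ell2 (carrier G)" and A: "finite A" "A \<subseteq> E"
  shows "convolution G E a f y =
    (\<Sum>x\<in>A. a x * left_regular G x f y) + convolution G E (\<lambda>x. if x \<in> A then 0 else a x) f y"
proof (cases "y \<in> carrier G")
  case True
  note s = convolution_summable[OF a f True]
  have "infsum (\<lambda>x. a x * f (inv x \<otimes> y)) E = infsum (\<lambda>x. a x * f (inv x \<otimes> y)) (A \<union> (E - A))"
    using A by (simp add: Un_absorb1)
  also have "\<dots> = (\<Sum>x\<in>A. a x * f (inv x \<otimes> y)) + infsum (\<lambda>x. a x * f (inv x \<otimes> y)) (E - A)"
    using A s by (subst infsum_Un_disjoint) (auto intro: summable_on_subset_banach)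
  also have "infsum (\<lambda>x. a x * f (inv x \<otimes> y)) (E - A) =
      infsum (\<lambda>x. (if x \<in> A then 0 else a x) * f (inv x \<otimes> y)) E"
    by (rule infsum_cong_neutral) auto
  finally show ?thesis using True f by (simp add: convolution_def left_regular_def)
qed (simp add: convolution_def left_regular_def)

text \<open>The error is convolution by the tail of \<open>a\<close>, whose operator norm is at most
  \<open>C\<close> times the norm of the tail.\<close>

lemma convolution_tendsto:
  assumes a: "a \<in> ell2 E" and f: "f \<in> ell2 (carrier G)" and g: "g \<in> ell2 (carrier G)"
  shows "((\<lambda>A. ell2_inner (carrier G) (\<lambda>y. \<Sum>x\<in>A. a x * left_regular G x f y) g) \<longlongrightarrow>
    ell2_inner (carrier G) (convolution G E a f) g) (finite_subsets_at_top E)"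
proof (rule LIM_zero_cancel, rule Lim_null_comparison)
  let ?a = "\<lambda>A x. if x \<in> A then 0 else a x"
  have "((\<lambda>A. C * ell2_norm E (?a A) * ell2_norm (carrier G) f * ell2_norm (carrier G) g) \<longlongrightarrow>
      C * 0 * ell2_norm (carrier G) f * ell2_norm (carrier G) g) (finite_subsets_at_top E)"
    by (intro tendsto_intros ell2_truncate_tendsto[OF a])
  then show "((\<lambda>A. C * ell2_norm E (?a A) * ell2_norm (carrier G) f * ell2_norm (carrier G) g) \<longlongrightarrow> 0)
      (finite_subsets_at_top E)" by simp
  show "eventually (\<lambda>A. cmod (ell2_inner (carrier G) (\<lambda>y. \<Sum>x\<in>A. a x * left_regular G x f y) g -
      ell2_inner (carrier G) (convolution G E a f) g)
      \<le> C * ell2_norm E (?a A) * ell2_norm (carrier G) f * ell2_norm (carrier G) g) (finite_subsets_at_top E)"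
  proof (rule eventually_finite_subsets_at_top_weakI)
    fix A assume A: "finite A" "A \<subseteq> E"
    have "?a A = (\<lambda>x. if x \<in> E - A then a x else 0)"
      using a by (auto simp: ell2_def)
    then have aA: "?a A \<in> ell2 E"
      using ell2_mono[OF ell2_restrict(1)[OF a, of "E - A"], of E] by simp
    have "ell2_inner (carrier G) (convolution G E a f) g =
        ell2_inner (carrier G) (\<lambda>y. \<Sum>x\<in>A. a x * left_regular G x f y) g + ell2_inner (carrier G) (convolution G E (?a A) f) g"
      unfolding convolution_cut[OF a f A, abs_def]
      using A by (intro ell2_inner_add_left g convolution_norm[OF aA f] ell2_sum ell2_cmult left_regular_in_ell2 f) auto
    then have "cmod (ell2_inner (carrier G) (\<lambda>y. \<Sum>x\<in>A. a x * left_regular G x f y) g -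
        ell2_inner (carrier G) (convolution G E a f) g) = cmod (ell2_inner (carrier G) (convolution G E (?a A) f) g)"
      by (simp add: norm_minus_commute)
    also have "\<dots> \<le> ell2_norm (carrier G) (convolution G E (?a A) f) * ell2_norm (carrier G) g"
      by (intro ell2_cauchy_schwarz convolution_norm[OF aA f] g)
    also have "\<dots> \<le> C * ell2_norm E (?a A) * ell2_norm (carrier G) f * ell2_norm (carrier G) g"
      by (intro mult_right_mono convolution_norm[OF aA f]) simp
    finally show "cmod (ell2_inner (carrier G) (\<lambda>y. \<Sum>x\<in>A. a x * left_regular G x f y) g -
      ell2_inner (carrier G) (convolution G E a f) g)
      \<le> C * ell2_norm E (?a A) * ell2_norm (carrier G) f * ell2_norm (carrier G) g" .
  qed
qed

lemma convolution_VN: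
  assumes a: "a \<in> ell2 E"
  shows "convolution G E a \<in> VN G"
  unfolding VN_iff
proof (intro conjI allI impI)
  let ?I = "ell2_inner (carrier G)"
  let ?L = "\<lambda>A f y. \<Sum>x\<in>A. a x * left_regular G x f y"
  show "convolution G E a \<in> bounded_operators (carrier G)" by (rule convolution_bounded[OF a])
  fix K and e :: real
  assume K: "finite K \<and> K \<subseteq> ell2 (carrier G) \<times> ell2 (carrier G) \<and> e > 0"
  have "eventually (\<lambda>A. \<forall>p\<in>K. dist (?I (?L A (fst p)) (snd p)) (?I (convolution G E a (fst p)) (snd p)) < e)
      (finite_subsets_at_top E)"
  proof (intro eventually_ball_finite ballI)
    fix p assume "p \<in> K"
    then have "fst p \<in> ell2 (carrier G)" "snd p \<in> ell2 (carrier G)" using K by auto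
    then show "eventually (\<lambda>A. dist (?I (?L A (fst p)) (snd p)) (?I (convolution G E a (fst p)) (snd p)) < e)
        (finite_subsets_at_top E)"
      using K by (intro tendstoD convolution_tendsto a) auto
  qed (use K in simp)
  then obtain A where A: "finite A" "A \<subseteq> E"
      and "\<forall>Y. finite Y \<and> A \<subseteq> Y \<and> Y \<subseteq> E \<longrightarrow>
        (\<forall>p\<in>K. dist (?I (?L Y (fst p)) (snd p)) (?I (convolution G E a (fst p)) (snd p)) < e)"
    unfolding eventually_finite_subsets_at_top by (elim exE conjE)
  then have near: "\<forall>p\<in>K. dist (?I (?L A (fst p)) (snd p)) (?I (convolution G E a (fst p)) (snd p)) < e"
    by simp
  show "\<exists>R\<in>left_regular_span G. \<forall>(f, g)\<in>K. cmod (?I (R f) g - ?I (convolution G E a f) g) < e"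
  proof (rule bexI[of _ "?L A"])
    show "\<forall>(f, g)\<in>K. cmod (?I (?L A f) g - ?I (convolution G E a f) g) < e"
      using near by (simp add: dist_norm case_prod_beta)
    show "?L A \<in> left_regular_span G"
      unfolding left_regular_span_def using A E_subset by blast
  qed
qed

lemma pairing_convolution:
  assumes a: "a \<in> ell2 E" and u: "u \<in> fourier_algebra G"
  shows "((\<lambda>x. a x * u x) has_sum pairing G u (convolution G E a)) E"
proof -
  obtain f g where fg: "f \<in> ell2 (carrier G)" "g \<in> ell2 (carrier G)" "u = coefficient G f g"
    using u by (auto simp: fourier_algebra_def)
  have "eventually (\<lambda>A. ell2_inner (carrier G) (\<lambda>y. \<Sum>x\<in>A. a x * left_regular G x f y) g = (\<Sum>x\<in>A. a x * u x))
      (finite_subsets_at_top E)"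
    by (rule eventually_finite_subsets_at_top_weakI)
      (use E_subset fg in \<open>simp add: inner_left_regular_span subset_trans\<close>)
  then show ?thesis
    using convolution_tendsto[OF a fg(1,2)] pairing_coefficient[OF convolution_VN[OF a] fg(1,2)]
    by (simp add: has_sum_def fg(3) Lim_transform_eventually)
qed

lemma convolution_delta_one:
  assumes a: "a \<in> ell2 E" and x: "x \<in> carrier G"
  shows "convolution G E a (delta \<one>) x = a x"
proof -
  have "convolution G E a (delta \<one>) x = pairing G (delta x) (convolution G E a)"
    using pairing_delta[OF convolution_VN[OF a] x] by simp
  also have "((\<lambda>y. a y * delta x y) has_sum pairing G (delta x) (convolution G E a)) E"
    using x by (intro pairing_convolution a ell2_subset_fourier) simp
  then have "pairing G (delta x) (convolution G E a) = (\<Sum>\<^sub>\<infinity>y\<in>E. a y * delta x y)"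
    by (rule infsumI[symmetric])
  also have "\<dots> = (\<Sum>\<^sub>\<infinity>y\<in>{x}. a y * delta x y)"
    using a by (intro infsum_cong_neutral) (auto simp: ell2_def)
  finally show ?thesis by simp
qed

lemma convolution_operator_norm:
  assumes a: "a \<in> ell2 E"
  shows "operator_norm (carrier G) (convolution G E a) \<le> C * ell2_norm E a"
  by (rule operator_norm_le) (use convolution_norm(2)[OF a] C_nonneg in \<open>simp_all add: mult.assoc\<close>)

section \<open>Restriction to E on VN(G) and on A(G)\<close>

text \<open>The adjoint of \<open>u \<mapsto> 1\<^sub>E u\<close>.\<close>

definition VN_restrict :: "'a operator \<Rightarrow> 'a operator" where
  "VN_restrict T = convolution G E (restrict_to E (T (delta \<one>)))"

lemma restrict_VN_ell2:
  assumes "T \<in> VN G"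
  shows "restrict_to E (T (delta \<one>)) \<in> ell2 E"
    and "ell2_norm E (restrict_to E (T (delta \<one>))) \<le> operator_norm (carrier G) T"
proof -
  have T: "T (delta \<one>) \<in> ell2 (carrier G)" by (rule bounded_operator_ell2[OF VN_bounded[OF assms]]) simp
  show "restrict_to E (T (delta \<one>)) \<in> ell2 E"
    unfolding restrict_to_def by (rule ell2_restrict(1)[OF T E_subset])
  have "ell2_norm E (restrict_to E (T (delta \<one>))) \<le> ell2_norm (carrier G) (T (delta \<one>))"
    unfolding restrict_to_def by (rule ell2_restrict(2)[OF T E_subset])
  also have "\<dots> \<le> operator_norm (carrier G) T"
    using operator_norm_apply[OF VN_bounded[OF assms], of "delta \<one>"] by simp
  finally show "ell2_norm E (restrict_to E (T (delta \<one>))) \<le> operator_norm (carrier G) T" .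
qed

lemma VN_restrict_VN: "T \<in> VN G \<Longrightarrow> VN_restrict T \<in> VN G"
  unfolding VN_restrict_def by (intro convolution_VN restrict_VN_ell2)

lemma VN_restrict_delta_one:
  "T \<in> VN G \<Longrightarrow> x \<in> carrier G \<Longrightarrow> VN_restrict T (delta \<one>) x = (if x \<in> E then T (delta \<one>) x else 0)"
  unfolding VN_restrict_def
  by (subst convolution_delta_one[OF restrict_VN_ell2(1)]) (simp_all add: restrict_to_def)

lemma VN_restrict_norm:
  assumes "T \<in> VN G"
  shows "operator_norm (carrier G) (VN_restrict T) \<le> C * operator_norm (carrier G) T"
proof -
  have "operator_norm (carrier G) (VN_restrict T) \<le> C * ell2_norm E (restrict_to E (T (delta \<one>)))"
    unfolding VN_restrict_def by (rule convolution_operator_norm[OF restrict_VN_ell2(1)[OF assms]])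
  also have "\<dots> \<le> C * operator_norm (carrier G) T"
    by (intro mult_left_mono restrict_VN_ell2 assms C_nonneg)
  finally show ?thesis .
qed

text \<open>The hypothesis on \<open>E\<close> bounds the restriction by the vectors of one
  representation, but the Fourier norm is a supremum over VN(G). Testing \<open>u\<close> against
  convolution by the conjugate \<open>a\<close> of its restriction gives N^2 for the pairing, with
  operator norm at most C N.\<close>

lemma restrict_fourier_ell2:
  assumes u: "u \<in> fourier_algebra G"
  shows "restrict_to E u \<in> ell2 E"
    and "ell2_norm E (restrict_to E u) \<le> C * fourier_norm G u"
proof -
  obtain f g where fg: "f \<in> ell2 (carrier G)" "g \<in> ell2 (carrier G)" "u = coefficient G f g"
    using u by (auto simp: fourier_algebra_def)
  show h: "restrict_to E u \<in> ell2 E" unfolding fg(3) by (rule restriction_ell2[OF fg(1,2)])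
  define a where "a = (\<lambda>x. cnj (restrict_to E u x))"
  have a: "a \<in> ell2 E" using h by (simp add: a_def)
  define N where "N = ell2_norm E (restrict_to E u)"
  have N: "ell2_norm E a = N" by (simp add: a_def N_def)
  have "((\<lambda>x. a x * u x) has_sum pairing G u (convolution G E a)) E"
    by (rule pairing_convolution[OF a u])
  moreover have "a x * u x = complex_of_real ((cmod (restrict_to E u x))\<^sup>2)" if "x \<in> E" for x
    using that by (simp add: a_def restrict_to_def complex_norm_square mult.commute del: of_real_power)
  moreover have "((\<lambda>x. complex_of_real ((cmod (restrict_to E u x))\<^sup>2)) has_sum complex_of_real (N\<^sup>2)) E"
    using h unfolding N_def ell2_norm_power2
    by (intro has_sum_of_real has_sum_infsum) (simp add: ell2_def)
  ultimately have "pairing G u (convolution G E a) = complex_of_real (N\<^sup>2)"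
    using has_sum_unique by (smt (verit) has_sum_cong)
  then have N2: "cmod (pairing G u (convolution G E a)) = N\<^sup>2" by (simp add: norm_power N_def)
  show "ell2_norm E (restrict_to E u) \<le> C * fourier_norm G u"
  \<comment> \<open>Dividing by \<open>C * N\<close> needs positivity. If it is 0, the convolution
    has norm 0, so the pairing N^2 vanishes.\<close>
  proof (cases "C * N = 0")
    case True
    have "operator_norm (carrier G) (convolution G E a) \<le> C * N"
      using convolution_operator_norm[OF a] by (simp add: N)
    then have "cmod (pairing G u (convolution G E a)) \<le> 0"
      using True pairing_bound[OF convolution_VN[OF a] fg(1,2)]
        operator_norm_nonneg[OF convolution_bounded[OF a]] by (simp add: fg(3))
    then have "N = 0" using N2 by simp
    then show ?thesis using C_nonneg fourier_norm_nonneg[OF u] by (simp add: N_def)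
  next
    case False
    have "N\<^sup>2 \<le> (C * N) * fourier_norm G u"
      unfolding N2[symmetric]
    proof (rule pairing_le_fourier_norm[OF u convolution_VN[OF a]])
      show "operator_norm (carrier G) (convolution G E a) \<le> C * N"
        using convolution_operator_norm[OF a] by (simp add: N)
      show "0 < C * N" using False C_nonneg by (auto simp: N_def less_le)
    qed
    then have "N * N \<le> (C * fourier_norm G u) * N" by (simp add: power2_eq_square algebra_simps)
    moreover have "N > 0" using False by (auto simp: N_def less_le)
    ultimately show ?thesis unfolding N_def[symmetric] by (simp add: mult_le_cancel_right)
  qed
qed

text \<open>Both sides are the sum of \<open>T (delta \<one>) x * u x\<close> over x in
  \<open>E\<close>.\<close>

lemma pairing_VN_restrict:
  assumes T: "T \<in> VN G" and u: "u \<in> fourier_algebra G"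
  shows "pairing G (restrict_to E u) T = pairing G u (VN_restrict T)"
proof -
  have "pairing G (restrict_to E u) T = (\<Sum>\<^sub>\<infinity>x\<in>carrier G. T (delta \<one>) x * restrict_to E u x)"
    by (rule infsumI[OF pairing_ell2[OF T ell2_E_carrier[OF restrict_fourier_ell2(1)[OF u]]], symmetric])
  also have "\<dots> = (\<Sum>\<^sub>\<infinity>x\<in>E. restrict_to E (T (delta \<one>)) x * u x)"
    by (rule infsum_cong_neutral) (auto simp: restrict_to_def)
  also have "\<dots> = pairing G u (VN_restrict T)"
    unfolding VN_restrict_def by (rule infsumI[OF pairing_convolution[OF restrict_VN_ell2(1)[OF T] u]])
  finally show ?thesis .
qed

end

section \<open>Sums of coefficient functions\<close>

text \<open>A linear relation between the two coordinates passes from generators to the closed span.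
  It is used to show that the closed cyclic subspace is a graph.\<close>

lemma closure_span_functional:
  fixes v w :: "'h::real_inner"
  assumes "\<And>p. p \<in> X \<Longrightarrow> inner (fst p) v = inner (snd p) w" and p: "p \<in> closure (span X)"
  shows "inner (fst p) v = inner (snd p) w"
proof -
  let ?Z = "{p. inner (fst p) v = inner (snd p) w}"
  have "subspace ?Z" by (rule subspaceI) (auto simp: inner_add_left)
  then have "span X \<subseteq> ?Z" using assms(1) by (intro span_minimal) auto
  moreover have "closed ?Z" by (intro closed_Collect_eq continuous_intros)
  ultimately have "closure (span X) \<subseteq> ?Z" by (rule closure_minimal)
  then show ?thesis using p by blast
qed

context group
begin

text \<open>Members of \<open>l2\<close> may be nonzero off the carrier, whereas \<lambda>(x) acts
  on \<open>ell2 (carrier G)\<close>.\<close>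

definition cut :: "'a l2 \<Rightarrow> 'a \<Rightarrow> complex" where
  "cut \<phi> = (\<lambda>y. if y \<in> carrier G then Rep_l2 \<phi> y else 0)"

text \<open>The scalar is part of the operator because the Hilbert space is real: the factors 1 and
  \<i> together recover a complex coefficient from real parts.\<close>

definition l2_left_regular :: "complex \<Rightarrow> 'a \<Rightarrow> 'a l2 \<Rightarrow> 'a l2" where
  "l2_left_regular c x \<phi> = Abs_l2 (\<lambda>y. c * left_regular G x (cut \<phi>) y)"

lemma cut_ell2: "cut \<phi> \<in> ell2 (carrier G)"
  and cut_norm: "ell2_norm (carrier G) (cut \<phi>) \<le> norm \<phi>"
  unfolding cut_def norm_l2_def by (rule ell2_restrict[OF Rep_l2_ell2 subset_UNIV])+

lemma l2_left_regular_ell2: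
  "x \<in> carrier G \<Longrightarrow> (\<lambda>y. c * left_regular G x (cut \<phi>) y) \<in> ell2 (carrier G)"
  by (intro ell2_cmult left_regular_in_ell2 cut_ell2)

lemma Rep_l2_left_regular:
  "x \<in> carrier G \<Longrightarrow> Rep_l2 (l2_left_regular c x \<phi>) = (\<lambda>y. c * left_regular G x (cut \<phi>) y)"
  unfolding l2_left_regular_def
  by (rule Abs_l2_inverse[OF ell2_mono[OF l2_left_regular_ell2 subset_UNIV]])

lemma cut_Abs: "f \<in> ell2 (carrier G) \<Longrightarrow> cut (Abs_l2 f) = f"
  by (auto simp: cut_def Abs_l2_inverse[OF ell2_mono[OF _ subset_UNIV]] ell2_def fun_eq_iff)

lemma cut_left_regular:
  "x \<in> carrier G \<Longrightarrow> cut (l2_left_regular c x \<phi>) = (\<lambda>y. c * left_regular G x (cut \<phi>) y)"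
  unfolding l2_left_regular_def by (rule cut_Abs[OF l2_left_regular_ell2])

lemma inner_l2_left_regular:
  assumes x: "x \<in> carrier G"
  shows "inner (l2_left_regular c x \<phi>) \<psi> = Re (c * coefficient G (cut \<phi>) (cut \<psi>) x)"
proof -
  have "ell2_inner UNIV (\<lambda>y. c * left_regular G x (cut \<phi>) y) (Rep_l2 \<psi>) =
      ell2_inner (carrier G) (\<lambda>y. c * left_regular G x (cut \<phi>) y) (Rep_l2 \<psi>)"
    using l2_left_regular_ell2[OF x] by (intro ell2_inner_UNIV) blast
  also have "\<dots> = ell2_inner (carrier G) (\<lambda>y. c * left_regular G x (cut \<phi>) y) (cut \<psi>)"
    unfolding ell2_inner_def by (intro infsum_cong) (simp add: cut_def)
  also have "\<dots> = c * coefficient G (cut \<phi>) (cut \<psi>) x"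
    using x by (simp add: ell2_inner_cmult_left coefficient_def)
  finally show ?thesis by (simp only: inner_l2_def Rep_l2_left_regular[OF x])
qed

text \<open>The adjoint of \<lambda>(x) is \<lambda>(x^-1); this yields the closure under adjoints
  required by \<open>sum_of_coefficients\<close>.\<close>

lemma coefficient_inv:
  assumes x: "x \<in> carrier G" and f: "f \<in> ell2 (carrier G)" and g: "g \<in> ell2 (carrier G)"
  shows "coefficient G g f (inv x) = cnj (coefficient G f g x)"
proof -
  have "coefficient G g f (inv x) = (\<Sum>\<^sub>\<infinity>y\<in>carrier G. g (x \<otimes> y) * cnj (f y))"
    using x g by (simp add: coefficient_def ell2_inner_def left_regular_def cong: infsum_cong)
  also have "\<dots> = (\<Sum>\<^sub>\<infinity>y\<in>carrier G. g (x \<otimes> (inv x \<otimes> y)) * cnj (f (inv x \<otimes> y)))"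
    using infsum_reindex_bij_betw[OF bij_left_translation[OF x], of "\<lambda>y. g (x \<otimes> y) * cnj (f y)"] by simp
  also have "\<dots> = (\<Sum>\<^sub>\<infinity>y\<in>carrier G. cnj (f (inv x \<otimes> y) * cnj (g y)))"
    using x by (intro infsum_cong) (simp add: mult.commute)
  also have "\<dots> = cnj (coefficient G f g x)"
    using x f by (simp only: infsum_cnj) (simp add: coefficient_def ell2_inner_def left_regular_def cong: infsum_cong)
  finally show ?thesis .
qed

lemma bounded_linear_l2_left_regular:
  assumes x: "x \<in> carrier G"
  shows "bounded_linear (l2_left_regular c x)"
proof (rule bounded_linear_intro[where K = "cmod c"])
  have cut_add: "cut (\<phi> + \<psi>) = (\<lambda>y. cut \<phi> y + cut \<psi> y)" for \<phi> \<psi>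
    by (auto simp: cut_def)
  have cut_scale: "cut (r *\<^sub>R \<phi>) = (\<lambda>y. complex_of_real r * cut \<phi> y)" for r \<phi>
    by (auto simp: cut_def)
  note T = left_regular_bounded[OF x]
  show "l2_left_regular c x (\<phi> + \<psi>) = l2_left_regular c x \<phi> + l2_left_regular c x \<psi>" for \<phi> \<psi>
    by (simp add: Rep_l2_inject[symmetric] Rep_l2_left_regular[OF x] cut_add
        bounded_operator_add[OF T cut_ell2 cut_ell2] distrib_left)
  show "l2_left_regular c x (r *\<^sub>R \<phi>) = r *\<^sub>R l2_left_regular c x \<phi>" for r \<phi>
    by (simp add: Rep_l2_inject[symmetric] Rep_l2_left_regular[OF x] cut_scale
        bounded_operator_cmult[OF T cut_ell2] mult.left_commute)
  show "norm (l2_left_regular c x \<phi>) \<le> norm \<phi> * cmod c" for \<phi>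
    unfolding l2_left_regular_def norm_Abs_l2[OF l2_left_regular_ell2[OF x]]
    using mult_left_mono[OF cut_norm[of \<phi>], of "cmod c"]
    by (simp add: ell2_norm_cmult ell2_norm_left_regular[OF x cut_ell2] mult.commute)
qed

lemma l2_left_regular_compose:
  assumes x: "x \<in> carrier G" and y: "y \<in> carrier G"
  shows "l2_left_regular c x \<circ> l2_left_regular d y = l2_left_regular (c * d) (x \<otimes> y)"
proof
  fix \<phi>
  have "left_regular G x (\<lambda>z. d * left_regular G y (cut \<phi>) z) z = d * left_regular G (x \<otimes> y) (cut \<phi>) z" for z
  proof -
    have "left_regular G x (\<lambda>z. d * left_regular G y (cut \<phi>) z) z = d * left_regular G x (left_regular G y (cut \<phi>)) z"
      by (simp add: bounded_operator_cmult[OF left_regular_bounded[OF x] left_regular_in_ell2[OF y cut_ell2]])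
    also have "left_regular G x (left_regular G y (cut \<phi>)) z = left_regular G (x \<otimes> y) (cut \<phi>) z"
      using x y cut_ell2[of \<phi>] left_regular_in_ell2[OF y cut_ell2[of \<phi>]]
      by (simp add: left_regular_def[of G x] left_regular_def[of G "x \<otimes> y"])
        (simp add: left_regular_def inv_mult_group m_assoc)
    finally show ?thesis .
  qed
  then show "(l2_left_regular c x \<circ> l2_left_regular d y) \<phi> = l2_left_regular (c * d) (x \<otimes> y) \<phi>"
    using x y by (simp add: Rep_l2_inject[symmetric] Rep_l2_left_regular cut_left_regular mult.assoc)
qed

text \<open>A weak form of the fact that \<open>A(G)\<close> is a vector space.\<close>

lemma fourier_add_ell2:
  assumes u: "u \<in> fourier_algebra G" and h: "h \<in> ell2 (carrier G)"
  shows "(\<lambda>x. u x + h x) \<in> fourier_algebra G"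
proof -
  obtain f g where f: "f \<in> ell2 (carrier G)" and g: "g \<in> ell2 (carrier G)" and u_eq: "u = coefficient G f g"
    using u by (auto simp: fourier_algebra_def)
  have d: "delta \<one> \<in> ell2 (carrier G)" by simp
  have k: "(\<lambda>x. cnj (h x)) \<in> ell2 (carrier G)" using h by simp
  define U where "U = {l2_left_regular c x | c x. x \<in> carrier G}"
  define X where "X = (\<lambda>u. (u (Abs_l2 f), u (Abs_l2 (delta \<one>)))) ` U"
  have lin: "bounded_linear r" if "r \<in> U" for r
    using that by (auto simp: U_def bounded_linear_l2_left_regular)
  have adj: "\<exists>s\<in>U. \<forall>\<phi> \<psi>. inner (r \<phi>) \<psi> = inner \<phi> (s \<psi>)" if rU: "r \<in> U" for r
  proof -
    obtain c x where r: "r = l2_left_regular c x" and x: "x \<in> carrier G"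
      using rU by (auto simp: U_def)
    have "inner (r \<phi>) \<psi> = inner \<phi> (l2_left_regular (cnj c) (inv x) \<psi>)" for \<phi> \<psi>
    proof -
      have "inner \<phi> (l2_left_regular (cnj c) (inv x) \<psi>) = Re (cnj c * coefficient G (cut \<psi>) (cut \<phi>) (inv x))"
        using x by (simp only: inner_l2_left_regular inv_closed inner_commute[of \<phi>])
      also have "\<dots> = Re (cnj (c * coefficient G (cut \<phi>) (cut \<psi>) x))"
        using x by (simp only: coefficient_inv cut_ell2 complex_cnj_mult)
      also have "\<dots> = inner (r \<phi>) \<psi>"
        using x by (simp only: r inner_l2_left_regular complex_cnj)
          (simp only: cnj.sel)
      finally show ?thesis by simp
    qed
    moreover have "l2_left_regular (cnj c) (inv x) \<in> U" using x by (auto simp: U_def)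
    ultimately show ?thesis by blast
  qed
  have comp: "r \<circ> s \<in> U" if "r \<in> U" "s \<in> U" for r s
    using that by (auto simp: U_def l2_left_regular_compose) blast
  have one: "l2_left_regular 1 \<one> (Abs_l2 \<phi>) = Abs_l2 \<phi>" if "\<phi> \<in> ell2 (carrier G)" for \<phi>
  proof -
    have "left_regular G \<one> \<phi> y = \<phi> y" for y
      using that by (simp add: left_regular_def ell2_def)
    then show ?thesis using that by (simp add: l2_left_regular_def cut_Abs)
  qed
  have "(Abs_l2 f, Abs_l2 (delta \<one>)) \<in> X"
    unfolding X_def using one[OF f] one[OF d]
    by (intro image_eqI[of _ _ "l2_left_regular 1 \<one>"]) (auto simp: U_def)
  then have fd: "(Abs_l2 f, Abs_l2 (delta \<one>)) \<in> closure (span X)"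
    using span_base closure_subset by blast
  \<comment> \<open>The value of \<lambda>(x) f at y is f(x^-1 y), which is square-summable as a
    function of x. It is therefore the inner product of \<lambda>(x) \<open>delta \<one>\<close> =
    \<open>delta x\<close> with one fixed vector, built as \<open>w\<close> below. So on the closed
    cyclic subspace the second coordinate determines each value of the first.\<close>
  have graph: "m = 0" if m: "(m, 0) \<in> closure (span X)" for m
  proof -
    have "Re (Rep_l2 m y * cnj c) = 0" for c y
    proof -
      define v where "v = (\<lambda>z. c * delta y z)"
      define w where "w = (\<lambda>x. if y \<in> carrier G then c * cnj (coefficient G f (delta y) x) else 0)"
      have v: "v \<in> ell2 UNIV" by (simp add: v_def)
      have w: "w \<in> ell2 (carrier G)"
        unfolding w_def using coefficient_delta_ell2[OF f, of y] by (cases "y \<in> carrier G") simp_all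
      have "inner (fst p) (Abs_l2 v) = inner (snd p) (Abs_l2 w)" if pX: "p \<in> X" for p
      proof -
        obtain b x where x: "x \<in> carrier G"
            and p: "p = (l2_left_regular b x (Abs_l2 f), l2_left_regular b x (Abs_l2 (delta \<one>)))"
          using pX by (auto simp: X_def U_def)
        have "cut (Abs_l2 v) = (if y \<in> carrier G then v else (\<lambda>_. 0))"
          unfolding cut_def Abs_l2_inverse[OF v] by (auto simp: v_def fun_eq_iff delta_def)
        then have "coefficient G f (cut (Abs_l2 v)) x = (if y \<in> carrier G then cnj c * f (inv x \<otimes> y) else 0)"
          using x f by (simp add: coefficient_def v_def ell2_inner_cmult_right ell2_inner_delta_right left_regular_def)
            (simp add: ell2_inner_def)
        moreover have "coefficient G (delta \<one>) w x = (if y \<in> carrier G then cnj c * f (inv x \<otimes> y) else 0)"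
        proof -
          have "coefficient G (delta \<one>) (\<lambda>x. cnj (cnj (w x))) = (\<lambda>x. cnj (w x))"
            by (rule coefficient_delta_one) (simp add: w)
          then show ?thesis using x f by (simp add: w_def coefficient_delta_right)
        qed
        ultimately show ?thesis
          using x f w by (simp add: p inner_l2_left_regular cut_Abs)
      qed
      from closure_span_functional[OF this m] have "inner m (Abs_l2 v) = 0" by simp
      moreover have "inner m (Abs_l2 v) = Re (ell2_inner UNIV (Rep_l2 m) v)"
        by (simp add: inner_l2_def Abs_l2_inverse[OF v])
      ultimately show ?thesis
        by (simp add: v_def ell2_inner_cmult_right ell2_inner_delta_right mult.commute)
    qed
    from this[of _ 1] this[of _ \<i>] have "Rep_l2 m y = 0" for y by (simp add: complex_eq_iff)
    then show ?thesis by (simp add: Rep_l2_inject[symmetric] fun_eq_iff)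
  qed
  obtain f' g' where *: "\<And>r. r \<in> U \<Longrightarrow> inner (r f') g' = inner (r (Abs_l2 f)) (Abs_l2 g)
      + inner (r (Abs_l2 (delta \<one>))) (Abs_l2 (\<lambda>x. cnj (h x)))"
    using sum_of_coefficients[OF lin adj comp fd[unfolded X_def] graph[unfolded X_def]] by metis
  have "coefficient G (cut f') (cut g') x = u x + h x" for x
  proof (cases "x \<in> carrier G")
    case True
    \<comment> \<open>The operators c \<lambda>(x) belong to the family \<open>U\<close> for every
      complex c, so real parts may be compared after multiplication by any c.\<close>
    have "Re (c * coefficient G (cut f') (cut g') x) = Re (c * (u x + h x))" for c
    proof -
      have "l2_left_regular c x \<in> U" using True by (auto simp: U_def)
      from *[OF this] show ?thesis
        using f g d k h True
        by (simp only: inner_l2_left_regular cut_Abs coefficient_delta_one) (simp add: u_eq distrib_left)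
    qed
    from this[of 1] this[of \<i>] show ?thesis by (simp add: complex_eq_iff)
  next
    case False
    then show ?thesis using h by (simp add: u_eq coefficient_def ell2_def)
  qed
  then have "(\<lambda>x. u x + h x) = coefficient G (cut f') (cut g')" by auto
  then show ?thesis using cut_ell2 by simp
qed

end

section \<open>Matrix norms and Schur multipliers\<close>

text \<open>For finite \<open>I\<close> and nonnegative \<open>c\<close> this says that
  \<open>scalar_matrix_norm I M\<close> is at most \<open>c\<close>, without the supremum.\<close>

definition matrix_bound :: "'i set \<Rightarrow> ('i \<Rightarrow> 'i \<Rightarrow> complex) \<Rightarrow> real \<Rightarrow> bool" where
  "matrix_bound I M c \<longleftrightarrow>
     (\<forall>z. L2_set (\<lambda>i. cmod (\<Sum>j\<in>I. M i j * z j)) I \<le> c * L2_set (\<lambda>j. cmod (z j)) I)"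

lemma L2_set_power2: "(L2_set f A)\<^sup>2 = (\<Sum>i\<in>A. (f i)\<^sup>2)"
  by (simp add: L2_set_def sum_nonneg)

lemma L2_set_le_cmultI:
  assumes "(\<Sum>i\<in>A. (f i)\<^sup>2) \<le> c\<^sup>2 * (\<Sum>j\<in>B. (g j)\<^sup>2)" "0 \<le> c"
  shows "L2_set f A \<le> c * L2_set g B"
  by (rule power2_le_imp_le) (use assms in \<open>simp_all add: power_mult_distrib L2_set_power2 L2_set_nonneg\<close>)

lemma L2_set_le_cmultD:
  assumes "L2_set f A \<le> c * L2_set g B"
  shows "(\<Sum>i\<in>A. (f i)\<^sup>2) \<le> c\<^sup>2 * (\<Sum>j\<in>B. (g j)\<^sup>2)"
  using power_mono[OF assms L2_set_nonneg, of 2] by (simp add: power_mult_distrib L2_set_power2)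

lemma L2_set_sum_triangle: "L2_set (\<lambda>i. \<Sum>j\<in>J. f i j) A \<le> (\<Sum>j\<in>J. L2_set (\<lambda>i. f i j) A)"
proof (induction J rule: infinite_finite_induct)
  case (insert j J)
  then show ?case
    using L2_set_triangle_ineq[of "\<lambda>i. f i j" "\<lambda>i. \<Sum>j\<in>J. f i j" A] by simp
qed (simp_all add: L2_set_def)

lemma L2_set_Times: "L2_set (\<lambda>i. L2_set (\<lambda>k. f (i, k)) B) A = L2_set f (A \<times> B)"
  by (simp add: L2_set_def sum_nonneg sum.cartesian_product case_prod_beta)

lemma matrix_bound_mono:
  assumes "matrix_bound I M c" "c \<le> d"
  shows "matrix_bound I M d"
  using assms mult_right_mono[OF assms(2) L2_set_nonneg] unfolding matrix_bound_def
  by (meson order_trans)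

lemma matrix_bound_cong:
  assumes "\<And>i j. i \<in> I \<Longrightarrow> j \<in> I \<Longrightarrow> M i j = N i j"
  shows "matrix_bound I M c \<longleftrightarrow> matrix_bound I N c"
proof -
  have "(\<Sum>j\<in>I. M i j * z j) = (\<Sum>j\<in>I. N i j * z j)" if "i \<in> I" for i z
    using assms that by (intro sum.cong) auto
  then show ?thesis by (simp add: matrix_bound_def cong: L2_set_cong)
qed

lemma matrix_bound_reindex:
  fixes h :: "'j \<Rightarrow> 'i"
  assumes h: "bij_betw h J I" and M: "matrix_bound I M c"
  shows "matrix_bound J (\<lambda>i j. M (h i) (h j)) c"
  unfolding matrix_bound_def
proof
  fix z :: "'j \<Rightarrow> complex"
  define w where "w i = z (inv_into J h i)" for i
  have w: "w (h j) = z j" if "j \<in> J" for j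
    using h that by (simp add: w_def bij_betw_inv_into_left)
  have L2: "L2_set f I = L2_set (\<lambda>j. f (h j)) J" for f
    unfolding L2_set_def using sum.reindex_bij_betw[OF h, of "\<lambda>i. (f i)\<^sup>2"] by simp
  have "L2_set (\<lambda>i. cmod (\<Sum>j\<in>I. M i j * w j)) I \<le> c * L2_set (\<lambda>j. cmod (w j)) I"
    using M by (simp add: matrix_bound_def)
  moreover have "(\<Sum>j\<in>I. M i j * w j) = (\<Sum>j\<in>J. M i (h j) * z j)" for i
    using sum.reindex_bij_betw[OF h, of "\<lambda>j. M i j * w j"] by (simp add: w cong: sum.cong)
  ultimately show "L2_set (\<lambda>i. cmod (\<Sum>j\<in>J. M (h i) (h j) * z j)) J \<le> c * L2_set (\<lambda>j. cmod (z j)) J"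
    by (simp add: L2 w cong: L2_set_cong)
qed

lemma matrix_bound_diff:
  assumes "matrix_bound I M c" "matrix_bound I N d"
  shows "matrix_bound I (\<lambda>i j. M i j - N i j) (c + d)"
  unfolding matrix_bound_def
proof
  fix z :: "'a \<Rightarrow> complex"
  have "L2_set (\<lambda>i. cmod (\<Sum>j\<in>I. (M i j - N i j) * z j)) I
      \<le> L2_set (\<lambda>i. cmod (\<Sum>j\<in>I. M i j * z j) + cmod (\<Sum>j\<in>I. N i j * z j)) I"
    by (intro L2_set_mono) (simp_all add: left_diff_distrib sum_subtractf norm_triangle_ineq4)
  also have "\<dots> \<le> L2_set (\<lambda>i. cmod (\<Sum>j\<in>I. M i j * z j)) I + L2_set (\<lambda>i. cmod (\<Sum>j\<in>I. N i j * z j)) I"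
    by (rule L2_set_triangle_ineq)
  also have "\<dots> \<le> (c + d) * L2_set (\<lambda>j. cmod (z j)) I"
    using assms unfolding matrix_bound_def distrib_right by (intro add_mono) auto
  finally show "L2_set (\<lambda>i. cmod (\<Sum>j\<in>I. (M i j - N i j) * z j)) I \<le> (c + d) * L2_set (\<lambda>j. cmod (z j)) I" .
qed

lemma scalar_matrix_norm_le:
  assumes M: "matrix_bound I M c" and c: "0 \<le> c"
  shows "scalar_matrix_norm I M \<le> c"
  unfolding scalar_matrix_norm_def
proof (rule cSup_least)
  fix r assume "r \<in> {L2_set (\<lambda>i. cmod (\<Sum>j\<in>I. M i j * \<xi> j)) I | \<xi>. L2_set (\<lambda>j. cmod (\<xi> j)) I \<le> 1}"
  then obtain z where z: "L2_set (\<lambda>j. cmod (z j)) I \<le> 1" and r: "r = L2_set (\<lambda>i. cmod (\<Sum>j\<in>I. M i j * z j)) I"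
    by blast
  have "r \<le> c * L2_set (\<lambda>j. cmod (z j)) I" using M by (simp add: r matrix_bound_def)
  also have "\<dots> \<le> c" using mult_left_mono[OF z c] by simp
  finally show "r \<le> c" .
qed (auto intro!: exI[of _ "\<lambda>_. 0"] simp: L2_set_def)

lemma scalar_matrix_norm_bdd:
  assumes I: "finite I"
  shows "bdd_above {L2_set (\<lambda>i. cmod (\<Sum>j\<in>I. M i j * \<xi> j)) I | \<xi>. L2_set (\<lambda>j. cmod (\<xi> j)) I \<le> 1}"
proof (rule bdd_aboveI)
  fix r assume "r \<in> {L2_set (\<lambda>i. cmod (\<Sum>j\<in>I. M i j * \<xi> j)) I | \<xi>. L2_set (\<lambda>j. cmod (\<xi> j)) I \<le> 1}"
  then obtain w where w: "L2_set (\<lambda>j. cmod (w j)) I \<le> 1" and r: "r = L2_set (\<lambda>i. cmod (\<Sum>j\<in>I. M i j * w j)) I"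
    by blast
  have "r \<le> (\<Sum>i\<in>I. cmod (\<Sum>j\<in>I. M i j * w j))" unfolding r by (rule L2_set_le_sum) simp
  also have "\<dots> \<le> (\<Sum>i\<in>I. \<Sum>j\<in>I. cmod (M i j))"
  proof (intro sum_mono order_trans[OF norm_sum])
    fix i j assume "j \<in> I"
    then have "cmod (w j) \<le> 1" using member_le_L2_set[OF I, of j "\<lambda>j. cmod (w j)"] w by simp
    then show "cmod (M i j * w j) \<le> cmod (M i j)"
      using mult_left_mono[of "cmod (w j)" 1 "cmod (M i j)"] by (simp add: norm_mult)
  qed
  finally show "r \<le> (\<Sum>i\<in>I. \<Sum>j\<in>I. cmod (M i j))" .
qed

lemma scalar_matrix_norm_nonneg:
  assumes "finite I"
  shows "0 \<le> scalar_matrix_norm I M"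
  unfolding scalar_matrix_norm_def
  by (rule cSup_upper[OF _ scalar_matrix_norm_bdd[OF assms]]) (auto intro!: exI[of _ "\<lambda>_. 0"] simp: L2_set_def)

lemma matrix_bound_scalar_matrix_norm:
  assumes I: "finite I"
  shows "matrix_bound I M (scalar_matrix_norm I M)"
  unfolding matrix_bound_def
proof
  fix z :: "'a \<Rightarrow> complex"
  let ?L = "\<lambda>z. L2_set (\<lambda>i. cmod (\<Sum>j\<in>I. M i j * z j)) I"
  let ?n = "\<lambda>z. L2_set (\<lambda>j. cmod (z j)) I"
  show "?L z \<le> scalar_matrix_norm I M * ?n z"
  proof (cases "?n z = 0")
    case True
    have "z j = 0" if "j \<in> I" for j using L2_set_eq_0D[OF True I that] by simp
    then have "?L z = 0" by (simp add: L2_set_def)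
    with True show ?thesis by simp
  next
    case False
    then have N: "?n z > 0" using L2_set_nonneg[of "\<lambda>j. cmod (z j)" I] by (simp add: less_le)
    define c where "c = complex_of_real (1 / ?n z)"
    have c: "cmod c = 1 / ?n z" using N by (simp add: c_def norm_divide)
    have "?L (\<lambda>j. c * z j) \<le> scalar_matrix_norm I M"
      unfolding scalar_matrix_norm_def
    proof (rule cSup_upper)
      have "?n (\<lambda>j. c * z j) = (1 / ?n z) * ?n z"
        unfolding norm_mult c L2_set_cmult using N by simp
      then have "?n (\<lambda>j. c * z j) \<le> 1" using N by simp
      then show "?L (\<lambda>j. c * z j) \<in> {?L \<xi> | \<xi>. ?n \<xi> \<le> 1}" by (intro CollectI exI[of _ "\<lambda>j. c * z j"] conjI refl)
    qed (rule scalar_matrix_norm_bdd[OF I])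
    moreover have "?L (\<lambda>j. c * z j) = (1 / ?n z) * ?L z"
    proof -
      have "(\<Sum>j\<in>I. M i j * (c * z j)) = c * (\<Sum>j\<in>I. M i j * z j)" for i
        by (simp add: sum_distrib_left mult.left_commute)
      then have "?L (\<lambda>j. c * z j) = L2_set (\<lambda>i. (1 / ?n z) * cmod (\<Sum>j\<in>I. M i j * z j)) I"
        by (simp only: norm_mult c)
      then show ?thesis using N by (simp only: L2_set_cmult abs_of_nonneg zero_le_divide_1_iff less_imp_le)
    qed
    ultimately have "(1 / ?n z) * ?L z \<le> scalar_matrix_norm I M" by simp
    then show ?thesis using N by (simp add: field_simps)
  qed
qed

text \<open>The operator B \<otimes> 1 has the norm bound of B: the estimate for B holds at each x,
  is summed over finite sets of x, and passes to the limit.\<close>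

lemma ell2_matrix_bound:
  fixes n :: nat
  assumes B: "matrix_bound {..<n} B c" and c: "0 \<le> c" and \<eta>: "\<And>l. l < n \<Longrightarrow> \<eta> l \<in> ell2 S"
  shows "L2_set (\<lambda>k. ell2_norm S (\<lambda>x. \<Sum>l<n. B k l * \<eta> l x)) {..<n} \<le> c * L2_set (\<lambda>l. ell2_norm S (\<eta> l)) {..<n}"
proof (rule L2_set_le_cmultI[OF _ c])
  have lim: "((\<lambda>F. \<Sum>k<n. \<Sum>x\<in>F. (cmod (h k x))\<^sup>2) \<longlongrightarrow> (\<Sum>k<n. (ell2_norm S (h k))\<^sup>2)) (finite_subsets_at_top S)"
    if "\<And>k. k < n \<Longrightarrow> h k \<in> ell2 S" for h
    unfolding ell2_norm_power2
    by (intro tendsto_sum infsum_tendsto) (use that in \<open>simp add: ell2_def\<close>)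
  have lim1: "((\<lambda>F. \<Sum>k<n. \<Sum>x\<in>F. (cmod (\<Sum>l<n. B k l * \<eta> l x))\<^sup>2) \<longlongrightarrow>
      (\<Sum>k<n. (ell2_norm S (\<lambda>x. \<Sum>l<n. B k l * \<eta> l x))\<^sup>2)) (finite_subsets_at_top S)"
    by (rule lim) (intro ell2_sum ell2_cmult \<eta>, simp)
  have lim2: "((\<lambda>F. \<Sum>l<n. \<Sum>x\<in>F. (cmod (\<eta> l x))\<^sup>2) \<longlongrightarrow> (\<Sum>l<n. (ell2_norm S (\<eta> l))\<^sup>2)) (finite_subsets_at_top S)"
    by (rule lim) (rule \<eta>)
  show "(\<Sum>k<n. (ell2_norm S (\<lambda>x. \<Sum>l<n. B k l * \<eta> l x))\<^sup>2) \<le> c\<^sup>2 * (\<Sum>l<n. (ell2_norm S (\<eta> l))\<^sup>2)"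
  proof (rule tendsto_le[OF finite_subsets_at_top_neq_bot tendsto_mult[OF tendsto_const lim2] lim1])
    show "eventually (\<lambda>F. (\<Sum>k<n. \<Sum>x\<in>F. (cmod (\<Sum>l<n. B k l * \<eta> l x))\<^sup>2)
        \<le> c\<^sup>2 * (\<Sum>l<n. \<Sum>x\<in>F. (cmod (\<eta> l x))\<^sup>2)) (finite_subsets_at_top S)"
    proof (rule always_eventually, rule allI)
      fix F
      have "(\<Sum>k<n. \<Sum>x\<in>F. (cmod (\<Sum>l<n. B k l * \<eta> l x))\<^sup>2) = (\<Sum>x\<in>F. \<Sum>k<n. (cmod (\<Sum>l<n. B k l * \<eta> l x))\<^sup>2)"
        by (rule sum.swap)
      also have "\<dots> \<le> (\<Sum>x\<in>F. c\<^sup>2 * (\<Sum>l<n. (cmod (\<eta> l x))\<^sup>2))"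
        by (intro sum_mono L2_set_le_cmultD) (rule B[unfolded matrix_bound_def, rule_format])
      also have "\<dots> = c\<^sup>2 * (\<Sum>l<n. \<Sum>x\<in>F. (cmod (\<eta> l x))\<^sup>2)"
        unfolding sum_distrib_left[symmetric] by (subst sum.swap) simp
      finally show "(\<Sum>k<n. \<Sum>x\<in>F. (cmod (\<Sum>l<n. B k l * \<eta> l x))\<^sup>2)
        \<le> c\<^sup>2 * (\<Sum>l<n. \<Sum>x\<in>F. (cmod (\<eta> l x))\<^sup>2)" .
    qed
  qed
qed

text \<open>The functions with such a \<open>K\<close> are the Herz-Schur multipliers. Repetitions
  in the family \<open>s\<close> are allowed; this is how matrices over VN(G) are covered, whose
  index (k, x) carries the group element x.\<close>

definition schur_bound :: "('a, 'm) monoid_scheme \<Rightarrow> ('a \<Rightarrow> complex) \<Rightarrow> real \<Rightarrow> bool" where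
  "schur_bound G v K \<longleftrightarrow> 0 \<le> K \<and>
     (\<forall>(n::nat) s B c. (\<forall>k<n. s k \<in> carrier G) \<longrightarrow> 0 < c \<longrightarrow> matrix_bound {..<n} B c \<longrightarrow>
        matrix_bound {..<n} (\<lambda>k l. B k l * v (s k \<otimes>\<^bsub>G\<^esub> inv\<^bsub>G\<^esub> (s l))) (K * c))"

context group
begin

lemma schur_boundI:
  assumes "0 \<le> K" and "\<And>(n::nat) s B c. (\<And>k. k < n \<Longrightarrow> s k \<in> carrier G) \<Longrightarrow> 0 < c \<Longrightarrow> matrix_bound {..<n} B c \<Longrightarrow>
    matrix_bound {..<n} (\<lambda>k l. B k l * v (s k \<otimes> inv (s l))) (K * c)"
  shows "schur_bound G v K"
  using assms by (simp add: schur_bound_def)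

lemma schur_bound_finite:
  assumes v: "schur_bound G v K" and I: "finite I" and s: "\<And>i. i \<in> I \<Longrightarrow> s i \<in> carrier G"
    and c: "0 < c" and B: "matrix_bound I B c"
  shows "matrix_bound I (\<lambda>i j. B i j * v (s i \<otimes> inv (s j))) (K * c)"
proof -
  obtain h where "bij_betw h {0..<card I} I" using ex_bij_betw_nat_finite[OF I] by blast
  then have h: "bij_betw h {..<card I} I" by (simp add: lessThan_atLeast0)
  have "\<And>k. k < card I \<Longrightarrow> s (h k) \<in> carrier G" using h s by (auto dest: bij_betwE)
  then have "matrix_bound {..<card I} (\<lambda>k l. B (h k) (h l) * v (s (h k) \<otimes> inv (s (h l)))) (K * c)"
    using v[unfolded schur_bound_def, THEN conjunct2, rule_format, of "card I" "\<lambda>k. s (h k)" c "\<lambda>k l. B (h k) (h l)"]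
      c matrix_bound_reindex[OF h B] by simp
  from matrix_bound_reindex[OF bij_betw_inv_into[OF h] this] show ?thesis
    by (rule matrix_bound_cong[THEN iffD1, rotated]) (simp add: bij_betw_inv_into_right[OF h])
qed

lemma schur_bound_cong:
  assumes "\<And>x. x \<in> carrier G \<Longrightarrow> v x = w x" and v: "schur_bound G v K"
  shows "schur_bound G w K"
proof (rule schur_boundI)
  show "0 \<le> K" using v by (simp add: schur_bound_def)
  fix n :: nat and s B c
  assume s: "\<And>k. k < n \<Longrightarrow> s k \<in> carrier G" and c: "0 < c" and B: "matrix_bound {..<n} B c"
  have "matrix_bound {..<n} (\<lambda>k l. B k l * v (s k \<otimes> inv (s l))) (K * c)"
    by (rule schur_bound_finite[OF v _ _ c B]) (use s in auto)
  then show "matrix_bound {..<n} (\<lambda>k l. B k l * w (s k \<otimes> inv (s l))) (K * c)"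
    by (rule matrix_bound_cong[THEN iffD1, rotated]) (use s assms(1) in simp)
qed

text \<open>Schur multiplication by the constant 1 is the identity, which accounts for the summand
  1. This reduces projections with multiplier 1 - 1_E to those with multiplier 1_E.\<close>

lemma schur_bound_complement:
  assumes v: "schur_bound G v K"
  shows "schur_bound G (\<lambda>x. 1 - v x) (1 + K)"
proof (rule schur_boundI)
  show "0 \<le> 1 + K" using v by (simp add: schur_bound_def)
  fix n :: nat and s B c
  assume s: "\<And>k. k < n \<Longrightarrow> s k \<in> carrier G" and c: "0 < c" and B: "matrix_bound {..<n} B c"
  have "matrix_bound {..<n} (\<lambda>k l. B k l * v (s k \<otimes> inv (s l))) (K * c)"
    by (rule schur_bound_finite[OF v _ _ c B]) (use s in auto)
  from matrix_bound_diff[OF B this]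
  show "matrix_bound {..<n} (\<lambda>k l. B k l * (1 - v (s k \<otimes> inv (s l)))) ((1 + K) * c)"
    by (simp add: algebra_simps)
qed

text \<open>The operator matrix is \<open>D (B \<otimes> 1) D\<^sup>*\<close> with the diagonal unitary \<open>D = diag (\<lambda>(s\<^sub>k))\<close>.\<close>

lemma translated_matrix_norm:
  fixes n :: nat
  assumes s: "\<And>k. k < n \<Longrightarrow> s k \<in> carrier G" and c: "0 \<le> c" and B: "matrix_bound {..<n} B c"
  shows "operator_matrix_norm (carrier G) n (\<lambda>k l f y. B k l * left_regular G (s k \<otimes> inv (s l)) f y) \<le> c"
proof (rule operator_matrix_norm_le[OF _ c])
  fix \<xi> :: "nat \<Rightarrow> 'a \<Rightarrow> complex" assume \<xi>: "\<And>j. j < n \<Longrightarrow> \<xi> j \<in> ell2 (carrier G)"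
  define \<eta> where "\<eta> l = left_regular G (inv (s l)) (\<xi> l)" for l
  have \<eta>: "\<eta> l \<in> ell2 (carrier G)" and \<eta>_norm: "ell2_norm (carrier G) (\<eta> l) = ell2_norm (carrier G) (\<xi> l)"
    if "l < n" for l
    using s \<xi> that by (simp_all add: \<eta>_def left_regular_in_ell2 ell2_norm_left_regular)
  have "ell2_norm (carrier G) (\<lambda>y. \<Sum>l<n. B k l * left_regular G (s k \<otimes> inv (s l)) (\<xi> l) y)
      = ell2_norm (carrier G) (\<lambda>y. \<Sum>l<n. B k l * \<eta> l y)" if k: "k < n" for k
  proof -
    have sum: "(\<lambda>y. \<Sum>l<n. B k l * \<eta> l y) \<in> ell2 (carrier G)" by (intro ell2_sum ell2_cmult \<eta>) simp
    have "(\<Sum>l<n. B k l * left_regular G (s k \<otimes> inv (s l)) (\<xi> l) y)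
        = left_regular G (s k) (\<lambda>y. \<Sum>l<n. B k l * \<eta> l y) y" for y
    proof (cases "y \<in> carrier G")
      case True
      have "left_regular G (s k) (\<lambda>y. \<Sum>l<n. B k l * \<eta> l y) y = (\<Sum>l<n. B k l * \<eta> l (inv (s k) \<otimes> y))"
        using sum True by (simp add: left_regular_def)
      moreover have "\<eta> l (inv (s k) \<otimes> y) = left_regular G (s k \<otimes> inv (s l)) (\<xi> l) y" if "l < n" for l
        using s[OF k] s[OF that] \<xi>[OF that] True by (simp add: \<eta>_def left_regular_def inv_mult_group m_assoc)
      then have "(\<Sum>l<n. B k l * \<eta> l (inv (s k) \<otimes> y)) = (\<Sum>l<n. B k l * left_regular G (s k \<otimes> inv (s l)) (\<xi> l) y)"
        by (intro sum.cong refl) simp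
      ultimately show ?thesis by simp
    qed (simp add: left_regular_def)
    then show ?thesis using ell2_norm_left_regular[OF s[OF k] sum] by simp
  qed
  then have "L2_set (\<lambda>k. ell2_norm (carrier G) (\<lambda>y. \<Sum>l<n. B k l * left_regular G (s k \<otimes> inv (s l)) (\<xi> l) y)) {..<n}
      = L2_set (\<lambda>k. ell2_norm (carrier G) (\<lambda>y. \<Sum>l<n. B k l * \<eta> l y)) {..<n}"
    by (intro L2_set_cong refl) simp
  also have "\<dots> \<le> c * L2_set (\<lambda>l. ell2_norm (carrier G) (\<eta> l)) {..<n}"
    by (rule ell2_matrix_bound[OF B c \<eta>])
  also have "L2_set (\<lambda>l. ell2_norm (carrier G) (\<eta> l)) {..<n} = L2_set (\<lambda>l. ell2_norm (carrier G) (\<xi> l)) {..<n}"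
    by (intro L2_set_cong refl) (simp add: \<eta>_norm)
  finally show "L2_set (\<lambda>k. ell2_norm (carrier G) (\<lambda>y. \<Sum>l<n. B k l * left_regular G (s k \<otimes> inv (s l)) (\<xi> l) y)) {..<n}
      \<le> c * L2_set (\<lambda>l. ell2_norm (carrier G) (\<xi> l)) {..<n}" .
qed

text \<open>This is the compression of the operator matrix to the span of the vectors
  \<open>delta y\<close> with y in \<open>F\<close>; by \<open>VN_delta\<close> its entries depend
  only on x y^-1.\<close>

lemma matrix_bound_section:
  assumes T: "\<And>k l. k < m \<Longrightarrow> l < m \<Longrightarrow> T k l \<in> VN G" and F: "finite F" "F \<subseteq> carrier G"
  shows "matrix_bound ({..<m} \<times> F) (\<lambda>(k, x) (l, y). T k l (delta \<one>) (x \<otimes> inv y))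
    (operator_matrix_norm (carrier G) m T)"
  unfolding matrix_bound_def
proof
  fix z :: "nat \<times> 'a \<Rightarrow> complex"
  let ?N = "operator_matrix_norm (carrier G) m T"
  have TB: "T k l \<in> bounded_operators (carrier G)" if "k < m" "l < m" for k l
    using T that by (blast intro: VN_bounded)
  define \<xi> where "\<xi> l = (\<lambda>x. \<Sum>y\<in>F. z (l, y) * delta y x)" for l
  have \<xi>_val: "\<xi> l x = (if x \<in> F then z (l, x) else 0)" for l x
  proof -
    have "\<xi> l x = (\<Sum>y\<in>F. if y = x then z (l, y) else 0)"
      unfolding \<xi>_def by (intro sum.cong) auto
    then show ?thesis using F(1) by simp
  qed
  have \<xi>: "\<xi> l \<in> ell2 (carrier G)" and \<xi>_norm: "(ell2_norm (carrier G) (\<xi> l))\<^sup>2 = (\<Sum>x\<in>F. (cmod (z (l, x)))\<^sup>2)" for l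
    using finite_support_ell2[OF F, of "\<xi> l"] by (simp_all add: \<xi>_val)
  have entry: "(\<Sum>l<m. T k l (\<xi> l) x) = (\<Sum>(l, y)\<in>{..<m} \<times> F. T k l (delta \<one>) (x \<otimes> inv y) * z (l, y))"
    if k: "k < m" and x: "x \<in> F" for k x
  proof -
    have "T k l (\<xi> l) x = (\<Sum>y\<in>F. T k l (delta \<one>) (x \<otimes> inv y) * z (l, y))" if l: "l < m" for l
    proof -
      have "T k l (\<xi> l) = (\<lambda>x. \<Sum>y\<in>F. T k l (\<lambda>x. z (l, y) * delta y x) x)"
        unfolding \<xi>_def using F by (intro bounded_operator_sum[OF TB[OF k l]] ell2_cmult delta_ell2) auto
      moreover have "T k l (\<lambda>x. z (l, y) * delta y x) x = T k l (delta \<one>) (x \<otimes> inv y) * z (l, y)" if "y \<in> F" for y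
      proof -
        have y: "y \<in> carrier G" and x': "x \<in> carrier G" using that x F by auto
        show ?thesis
          using bounded_operator_cmult[OF TB[OF k l], of "delta y" "z (l, y)"] VN_delta[OF T[OF k l] x' y] y by simp
      qed
      ultimately show ?thesis by (simp cong: sum.cong)
    qed
    then have "(\<Sum>l<m. T k l (\<xi> l) x) = (\<Sum>l<m. \<Sum>y\<in>F. T k l (delta \<one>) (x \<otimes> inv y) * z (l, y))"
      by (intro sum.cong refl) simp
    then show ?thesis by (simp add: sum.cartesian_product)
  qed
  have "(\<Sum>(k, x)\<in>{..<m} \<times> F. (cmod (\<Sum>(l, y)\<in>{..<m} \<times> F. T k l (delta \<one>) (x \<otimes> inv y) * z (l, y)))\<^sup>2)
      = (\<Sum>k<m. \<Sum>x\<in>F. (cmod (\<Sum>l<m. T k l (\<xi> l) x))\<^sup>2)"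
    unfolding sum.cartesian_product by (intro sum.cong refl) (auto simp: entry)
  also have "\<dots> \<le> (\<Sum>k<m. (ell2_norm (carrier G) (\<lambda>x. \<Sum>l<m. T k l (\<xi> l) x))\<^sup>2)"
  proof (rule sum_mono)
    fix k assume "k \<in> {..<m}"
    then have "(\<lambda>x. \<Sum>l<m. T k l (\<xi> l) x) \<in> ell2 (carrier G)"
      using bounded_operator_ell2[OF TB \<xi>] by (intro ell2_sum) auto
    from sum_le_ell2_norm[OF this F(1)]
    show "(\<Sum>x\<in>F. (cmod (\<Sum>l<m. T k l (\<xi> l) x))\<^sup>2) \<le> (ell2_norm (carrier G) (\<lambda>x. \<Sum>l<m. T k l (\<xi> l) x))\<^sup>2" .
  qed
  also have "\<dots> \<le> ?N\<^sup>2 * (\<Sum>l<m. (ell2_norm (carrier G) (\<xi> l))\<^sup>2)"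
    by (rule L2_set_le_cmultD[OF operator_matrix_norm_apply[OF TB \<xi>]])
  also have "(\<Sum>l<m. (ell2_norm (carrier G) (\<xi> l))\<^sup>2) = (\<Sum>(l, x)\<in>{..<m} \<times> F. (cmod (z (l, x)))\<^sup>2)"
    by (simp add: \<xi>_norm sum.cartesian_product)
  finally have "(\<Sum>(k, x)\<in>{..<m} \<times> F. (cmod (\<Sum>(l, y)\<in>{..<m} \<times> F. T k l (delta \<one>) (x \<otimes> inv y) * z (l, y)))\<^sup>2)
      \<le> ?N\<^sup>2 * (\<Sum>(l, x)\<in>{..<m} \<times> F. (cmod (z (l, x)))\<^sup>2)" .
  then show "L2_set (\<lambda>i. cmod (\<Sum>j\<in>{..<m} \<times> F. (case i of (k, x) \<Rightarrow> \<lambda>(l, y). T k l (delta \<one>) (x \<otimes> inv y)) j * z j)) ({..<m} \<times> F)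
      \<le> ?N * L2_set (\<lambda>j. cmod (z j)) ({..<m} \<times> F)"
    by (intro L2_set_le_cmultI operator_matrix_norm_nonneg TB) (simp_all add: case_prod_beta)
qed

text \<open>Converse to \<open>matrix_bound_section\<close>, by two limits: the columns
  \<open>H\<close> exhaust the group for fixed rows \<open>F\<close>, where \<open>VN_apply\<close>
  gives convergence, and then the rows do.\<close>

lemma operator_matrix_norm_le_sections:
  assumes T: "\<And>k l. k < m \<Longrightarrow> l < m \<Longrightarrow> T k l \<in> VN G" and c: "0 \<le> c"
    and sections: "\<And>F. finite F \<Longrightarrow> F \<subseteq> carrier G \<Longrightarrow>
      matrix_bound ({..<m} \<times> F) (\<lambda>(k, x) (l, y). T k l (delta \<one>) (x \<otimes> inv y)) c"
  shows "operator_matrix_norm (carrier G) m T \<le> c"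
proof (rule operator_matrix_norm_le[OF _ c], rule L2_set_le_cmultI[OF _ c])
  fix \<xi> :: "nat \<Rightarrow> 'a \<Rightarrow> complex" assume \<xi>: "\<And>j. j < m \<Longrightarrow> \<xi> j \<in> ell2 (carrier G)"
  let ?R = "c\<^sup>2 * (\<Sum>l<m. (ell2_norm (carrier G) (\<xi> l))\<^sup>2)"
  define h where "h k = (\<lambda>x. \<Sum>l<m. T k l (\<xi> l) x)" for k
  have h: "h k \<in> ell2 (carrier G)" if "k < m" for k
    unfolding h_def using bounded_operator_ell2[OF VN_bounded[OF T] \<xi>] that by (intro ell2_sum) auto
  have fin: "(\<Sum>k<m. \<Sum>x\<in>F. (cmod (h k x))\<^sup>2) \<le> ?R" if F: "finite F" "F \<subseteq> carrier G" for F
  proof (rule tendsto_upperbound)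
    let ?p = "\<lambda>H k x. \<Sum>l<m. \<Sum>y\<in>H. T k l (delta \<one>) (x \<otimes> inv y) * \<xi> l y"
    show "((\<lambda>H. \<Sum>k<m. \<Sum>x\<in>F. (cmod (?p H k x))\<^sup>2) \<longlongrightarrow> (\<Sum>k<m. \<Sum>x\<in>F. (cmod (h k x))\<^sup>2))
        (finite_subsets_at_top (carrier G))"
      unfolding h_def
      by (intro tendsto_sum tendsto_power tendsto_norm VN_apply[unfolded has_sum_def] T \<xi>) (use F in auto)
    show "eventually (\<lambda>H. (\<Sum>k<m. \<Sum>x\<in>F. (cmod (?p H k x))\<^sup>2) \<le> ?R) (finite_subsets_at_top (carrier G))"
      unfolding eventually_finite_subsets_at_top
    \<comment> \<open>Only \<open>H\<close> containing \<open>F\<close> are considered, so that the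
      rows in \<open>F\<close> occur in the section for \<open>H\<close>.\<close>
    proof (intro exI[of _ F] conjI F allI impI)
      fix H assume H: "finite H \<and> F \<subseteq> H \<and> H \<subseteq> carrier G"
      let ?z = "\<lambda>(l, y). \<xi> l y"
      have "(\<Sum>i\<in>{..<m} \<times> H. (cmod (\<Sum>j\<in>{..<m} \<times> H. (case i of (k, x) \<Rightarrow> \<lambda>(l, y). T k l (delta \<one>) (x \<otimes> inv y)) j * ?z j))\<^sup>2)
          \<le> c\<^sup>2 * (\<Sum>j\<in>{..<m} \<times> H. (cmod (?z j))\<^sup>2)"
        using sections[of H] H unfolding matrix_bound_def by (intro L2_set_le_cmultD) blast
      then have *: "(\<Sum>k<m. \<Sum>x\<in>H. (cmod (?p H k x))\<^sup>2) \<le> c\<^sup>2 * (\<Sum>l<m. \<Sum>y\<in>H. (cmod (\<xi> l y))\<^sup>2)"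
        by (simp add: sum.cartesian_product case_prod_beta)
      have "(\<Sum>k<m. \<Sum>x\<in>F. (cmod (?p H k x))\<^sup>2) \<le> (\<Sum>k<m. \<Sum>x\<in>H. (cmod (?p H k x))\<^sup>2)"
        using H by (intro sum_mono sum_mono2) auto
      also note *
      also have "c\<^sup>2 * (\<Sum>l<m. \<Sum>y\<in>H. (cmod (\<xi> l y))\<^sup>2) \<le> ?R"
        using H by (intro mult_left_mono sum_mono sum_le_ell2_norm \<xi>) auto
      finally show "(\<Sum>k<m. \<Sum>x\<in>F. (cmod (?p H k x))\<^sup>2) \<le> ?R" .
    qed
  qed simp
  have "((\<lambda>F. \<Sum>k<m. \<Sum>x\<in>F. (cmod (h k x))\<^sup>2) \<longlongrightarrow> (\<Sum>k<m. (ell2_norm (carrier G) (h k))\<^sup>2)) (finite_subsets_at_top (carrier G))"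
    unfolding ell2_norm_power2
    by (intro tendsto_sum infsum_tendsto) (use h in \<open>simp add: ell2_def\<close>)
  then have "(\<Sum>k<m. (ell2_norm (carrier G) (h k))\<^sup>2) \<le> ?R"
    by (rule tendsto_upperbound) (auto intro: eventually_finite_subsets_at_top_weakI fin)
  then show "(\<Sum>k<m. (ell2_norm (carrier G) (\<lambda>x. \<Sum>l<m. T k l (\<xi> l) x))\<^sup>2) \<le> ?R"
    by (simp add: h_def)
qed

end

section \<open>Transference to Schur multipliers\<close>

context group
begin

section \<open>Matrix norms over A(G)\<close>

text \<open>For one entry, a coefficient of f and g, the matrix of pairings with the
  \<open>T k l\<close> is a compression of \<open>T\<close> by f and g, with norm at most the
  product of their norms. The sum over the n^2 blocks is a bound independent of
  \<open>m\<close>.\<close>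

lemma fourier_matrix_norm_bdd:
  fixes n :: nat
  assumes u: "\<And>i j. i < n \<Longrightarrow> j < n \<Longrightarrow> u i j \<in> fourier_algebra G"
  obtains R where "0 \<le> R" and "\<And>m T. (\<And>k l. k < m \<Longrightarrow> l < m \<Longrightarrow> T k l \<in> VN G) \<Longrightarrow>
    operator_matrix_norm (carrier G) m T \<le> 1 \<Longrightarrow>
    matrix_bound ({..<n} \<times> {..<m}) (\<lambda>(i, k) (j, l). pairing G (u i j) (T k l)) R"
proof -
  have "\<exists>f g. f \<in> ell2 (carrier G) \<and> g \<in> ell2 (carrier G) \<and> u i j = coefficient G f g" if "i < n" "j < n" for i j
    using u[OF that] by (auto simp: fourier_algebra_def)
  then obtain f g where fg: "\<And>i j. i < n \<Longrightarrow> j < n \<Longrightarrow>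
      f i j \<in> ell2 (carrier G) \<and> g i j \<in> ell2 (carrier G) \<and> u i j = coefficient G (f i j) (g i j)"
    by metis
  define r where "r i j = ell2_norm (carrier G) (f i j) * ell2_norm (carrier G) (g i j)" for i j
  have r0: "0 \<le> r i j" for i j by (simp add: r_def)
  show thesis
  proof (rule that[of "\<Sum>i<n. \<Sum>j<n. r i j"])
    show "0 \<le> (\<Sum>i<n. \<Sum>j<n. r i j)" by (intro sum_nonneg r0)
    fix m :: nat and T
    assume T: "\<And>k l. k < m \<Longrightarrow> l < m \<Longrightarrow> T k l \<in> VN G" and T1: "operator_matrix_norm (carrier G) m T \<le> 1"
    have TB: "T k l \<in> bounded_operators (carrier G)" if "k < m" "l < m" for k l
      using T that by (blast intro: VN_bounded)
    have block: "L2_set (\<lambda>k. cmod (\<Sum>l<m. pairing G (u i j) (T k l) * z l)) {..<m} \<le> r i j * L2_set (\<lambda>l. cmod (z l)) {..<m}"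
      if ij: "i < n" "j < n" for i j and z :: "nat \<Rightarrow> complex"
    proof -
      define p where "p l = (\<lambda>x. z l * f i j x)" for l
      have p: "p l \<in> ell2 (carrier G)" for l using fg[OF ij] by (simp add: p_def)
      have "cmod (\<Sum>l<m. pairing G (u i j) (T k l) * z l)
          \<le> ell2_norm (carrier G) (g i j) * ell2_norm (carrier G) (\<lambda>x. \<Sum>l<m. T k l (p l) x)" if k: "k < m" for k
      proof -
        have Tp: "T k l (p l) \<in> ell2 (carrier G)" if "l < m" for l
          by (rule bounded_operator_ell2[OF TB[OF k that] p])
        have "pairing G (u i j) (T k l) * z l = ell2_inner (carrier G) (T k l (p l)) (g i j)" if l: "l < m" for l
          using fg[OF ij] T[OF k l] bounded_operator_cmult[OF TB[OF k l], of "f i j" "z l"]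
          by (simp add: pairing_coefficient p_def ell2_inner_cmult_left mult.commute)
        then have "(\<Sum>l<m. pairing G (u i j) (T k l) * z l) = (\<Sum>l<m. ell2_inner (carrier G) (T k l (p l)) (g i j))"
          by (intro sum.cong refl) simp
        also have "\<dots> = ell2_inner (carrier G) (\<lambda>x. \<Sum>l<m. T k l (p l) x) (g i j)"
          using fg[OF ij] Tp by (intro ell2_inner_sum_left[symmetric]) auto
        also have "cmod \<dots> \<le> ell2_norm (carrier G) (\<lambda>x. \<Sum>l<m. T k l (p l) x) * ell2_norm (carrier G) (g i j)"
          using fg[OF ij] Tp by (intro ell2_cauchy_schwarz ell2_sum) auto
        finally show ?thesis by (simp add: mult.commute)
      qed
      then have "L2_set (\<lambda>k. cmod (\<Sum>l<m. pairing G (u i j) (T k l) * z l)) {..<m}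
          \<le> L2_set (\<lambda>k. ell2_norm (carrier G) (g i j) * ell2_norm (carrier G) (\<lambda>x. \<Sum>l<m. T k l (p l) x)) {..<m}"
        by (intro L2_set_mono) auto
      also have "\<dots> = ell2_norm (carrier G) (g i j) * L2_set (\<lambda>k. ell2_norm (carrier G) (\<lambda>x. \<Sum>l<m. T k l (p l) x)) {..<m}"
        unfolding L2_set_cmult by simp
      also have "\<dots> \<le> ell2_norm (carrier G) (g i j) * (1 * L2_set (\<lambda>l. ell2_norm (carrier G) (p l)) {..<m})"
      proof (intro mult_left_mono)
        have "L2_set (\<lambda>k. ell2_norm (carrier G) (\<lambda>x. \<Sum>l<m. T k l (p l) x)) {..<m}
            \<le> operator_matrix_norm (carrier G) m T * L2_set (\<lambda>l. ell2_norm (carrier G) (p l)) {..<m}"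
          by (rule operator_matrix_norm_apply[OF TB p])
        also have "\<dots> \<le> 1 * L2_set (\<lambda>l. ell2_norm (carrier G) (p l)) {..<m}"
          by (rule mult_right_mono[OF T1 L2_set_nonneg])
        finally show "L2_set (\<lambda>k. ell2_norm (carrier G) (\<lambda>x. \<Sum>l<m. T k l (p l) x)) {..<m}
            \<le> 1 * L2_set (\<lambda>l. ell2_norm (carrier G) (p l)) {..<m}" .
      qed simp
      also have "L2_set (\<lambda>l. ell2_norm (carrier G) (p l)) {..<m} = ell2_norm (carrier G) (f i j) * L2_set (\<lambda>l. cmod (z l)) {..<m}"
      proof -
        have "L2_set (\<lambda>l. ell2_norm (carrier G) (p l)) {..<m} = L2_set (\<lambda>l. ell2_norm (carrier G) (f i j) * cmod (z l)) {..<m}"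
          by (intro L2_set_cong refl) (simp add: p_def ell2_norm_cmult)
        then show ?thesis unfolding L2_set_cmult by simp
      qed
      finally show ?thesis by (simp add: r_def mult_ac)
    qed
    show "matrix_bound ({..<n} \<times> {..<m}) (\<lambda>(i, k) (j, l). pairing G (u i j) (T k l)) (\<Sum>i<n. \<Sum>j<n. r i j)"
      unfolding matrix_bound_def
    proof
      fix z :: "nat \<times> nat \<Rightarrow> complex"
      let ?Z = "L2_set (\<lambda>j. cmod (z j)) ({..<n} \<times> {..<m})"
      let ?e = "\<lambda>i j k. \<Sum>l<m. pairing G (u i j) (T k l) * z (j, l)"
      have row: "L2_set (\<lambda>l. cmod (z (j, l))) {..<m} \<le> ?Z" if "j < n" for j
        using member_le_L2_set[of "{..<n}" j "\<lambda>j. L2_set (\<lambda>l. cmod (z (j, l))) {..<m}"] that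
        by (simp add: L2_set_Times[of "\<lambda>j. cmod (z j)"])
      have "L2_set (\<lambda>i. cmod (\<Sum>j\<in>{..<n} \<times> {..<m}. (case i of (i, k) \<Rightarrow> \<lambda>(j, l). pairing G (u i j) (T k l)) j * z j)) ({..<n} \<times> {..<m})
          = L2_set (\<lambda>i. L2_set (\<lambda>k. cmod (\<Sum>j<n. ?e i j k)) {..<m}) {..<n}"
        unfolding L2_set_Times[symmetric] by (simp add: sum.cartesian_product case_prod_beta)
      also have "\<dots> \<le> (\<Sum>i<n. L2_set (\<lambda>k. cmod (\<Sum>j<n. ?e i j k)) {..<m})"
        by (rule L2_set_le_sum) (simp add: L2_set_nonneg)
      also have "\<dots> \<le> (\<Sum>i<n. \<Sum>j<n. r i j * ?Z)"
      proof (rule sum_mono)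
        fix i assume i: "i \<in> {..<n}"
        have "L2_set (\<lambda>k. cmod (\<Sum>j<n. ?e i j k)) {..<m} \<le> L2_set (\<lambda>k. \<Sum>j<n. cmod (?e i j k)) {..<m}"
          by (intro L2_set_mono norm_sum) simp
        also have "\<dots> \<le> (\<Sum>j<n. L2_set (\<lambda>k. cmod (?e i j k)) {..<m})"
          by (rule L2_set_sum_triangle)
        also have "\<dots> \<le> (\<Sum>j<n. r i j * ?Z)"
          using i by (intro sum_mono order_trans[OF block mult_left_mono[OF row r0]]) auto
        finally show "L2_set (\<lambda>k. cmod (\<Sum>j<n. ?e i j k)) {..<m} \<le> (\<Sum>j<n. r i j * ?Z)" .
      qed
      also have "\<dots> = (\<Sum>i<n. \<Sum>j<n. r i j) * ?Z" by (simp add: sum_distrib_right)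
      finally show "L2_set (\<lambda>i. cmod (\<Sum>j\<in>{..<n} \<times> {..<m}. (case i of (i, k) \<Rightarrow> \<lambda>(j, l). pairing G (u i j) (T k l)) j * z j)) ({..<n} \<times> {..<m})
          \<le> (\<Sum>i<n. \<Sum>j<n. r i j) * ?Z" .
    qed
  qed
qed

lemma fourier_matrix_norm_le:
  fixes n :: nat
  assumes "0 \<le> c" and "\<And>m T. (\<And>k l. k < m \<Longrightarrow> l < m \<Longrightarrow> T k l \<in> VN G) \<Longrightarrow>
    operator_matrix_norm (carrier G) m T \<le> 1 \<Longrightarrow>
    matrix_bound ({..<n} \<times> {..<m}) (\<lambda>(i, k) (j, l). pairing G (u i j) (T k l)) c"
  shows "fourier_matrix_norm G n u \<le> c"
  unfolding fourier_matrix_norm_def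
proof (rule cSup_least)
  show "{scalar_matrix_norm ({..<n} \<times> {..<m}) (\<lambda>(i, k) (j, l). pairing G (u i j) (T k l)) | m T.
      (\<forall>k<m. \<forall>l<m. T k l \<in> VN G) \<and> operator_matrix_norm (carrier G) m T \<le> 1} \<noteq> {}"
    \<comment> \<open>The empty matrix, m = 0, shows that the supremum is over a nonempty
      set.\<close>
    using operator_matrix_norm_le[of 0 "carrier G" "\<lambda>k l f y. 0" 1]
    by (auto intro!: exI[of _ "0::nat"] exI[of _ "\<lambda>k l f y. 0"] simp: L2_set_def)
  fix r assume "r \<in> {scalar_matrix_norm ({..<n} \<times> {..<m}) (\<lambda>(i, k) (j, l). pairing G (u i j) (T k l)) | m T.
      (\<forall>k<m. \<forall>l<m. T k l \<in> VN G) \<and> operator_matrix_norm (carrier G) m T \<le> 1}"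
  then obtain m T where "\<forall>k<m. \<forall>l<m. T k l \<in> VN G" "operator_matrix_norm (carrier G) m T \<le> 1"
      and r: "r = scalar_matrix_norm ({..<n} \<times> {..<m}) (\<lambda>(i, k) (j, l). pairing G (u i j) (T k l))"
    by blast
  then show "r \<le> c" unfolding r by (intro scalar_matrix_norm_le assms) auto
qed

lemma scalar_matrix_norm_le_fourier_matrix_norm:
  fixes n m :: nat
  assumes u: "\<And>i j. i < n \<Longrightarrow> j < n \<Longrightarrow> u i j \<in> fourier_algebra G"
    and T: "\<And>k l. k < m \<Longrightarrow> l < m \<Longrightarrow> T k l \<in> VN G" and T1: "operator_matrix_norm (carrier G) m T \<le> 1"
  shows "scalar_matrix_norm ({..<n} \<times> {..<m}) (\<lambda>(i, k) (j, l). pairing G (u i j) (T k l)) \<le> fourier_matrix_norm G n u"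
proof -
  obtain R where R: "0 \<le> R" "\<And>m T. (\<And>k l. k < m \<Longrightarrow> l < m \<Longrightarrow> T k l \<in> VN G) \<Longrightarrow>
      operator_matrix_norm (carrier G) m T \<le> 1 \<Longrightarrow>
      matrix_bound ({..<n} \<times> {..<m}) (\<lambda>(i, k) (j, l). pairing G (u i j) (T k l)) R"
    using fourier_matrix_norm_bdd[where u = u and n = n, OF u] by metis
  show ?thesis
    unfolding fourier_matrix_norm_def
  proof (rule cSup_upper)
    show "scalar_matrix_norm ({..<n} \<times> {..<m}) (\<lambda>(i, k) (j, l). pairing G (u i j) (T k l))
      \<in> {scalar_matrix_norm ({..<n} \<times> {..<m}) (\<lambda>(i, k) (j, l). pairing G (u i j) (T k l)) | m T.
      (\<forall>k<m. \<forall>l<m. T k l \<in> VN G) \<and> operator_matrix_norm (carrier G) m T \<le> 1}"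
      using T T1 by (intro CollectI exI[of _ m] exI[of _ T] conjI allI impI refl)
    show "bdd_above {scalar_matrix_norm ({..<n} \<times> {..<m}) (\<lambda>(i, k) (j, l). pairing G (u i j) (T k l)) | m T.
      (\<forall>k<m. \<forall>l<m. T k l \<in> VN G) \<and> operator_matrix_norm (carrier G) m T \<le> 1}"
    proof (rule bdd_aboveI)
      fix r assume "r \<in> {scalar_matrix_norm ({..<n} \<times> {..<m}) (\<lambda>(i, k) (j, l). pairing G (u i j) (T k l)) | m T.
        (\<forall>k<m. \<forall>l<m. T k l \<in> VN G) \<and> operator_matrix_norm (carrier G) m T \<le> 1}"
      then obtain m T where "\<forall>k<m. \<forall>l<m. T k l \<in> VN G" "operator_matrix_norm (carrier G) m T \<le> 1"
          and r: "r = scalar_matrix_norm ({..<n} \<times> {..<m}) (\<lambda>(i, k) (j, l). pairing G (u i j) (T k l))"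
        by blast
      then show "r \<le> R" unfolding r by (intro scalar_matrix_norm_le R) auto
    qed
  qed
qed

lemma fourier_matrix_norm_nonneg:
  fixes n :: nat
  assumes u: "\<And>i j. i < n \<Longrightarrow> j < n \<Longrightarrow> u i j \<in> fourier_algebra G"
  shows "0 \<le> fourier_matrix_norm G n u"
proof -
  have "operator_matrix_norm (carrier G) 0 (\<lambda>k l f y. 0) \<le> 1"
    by (rule operator_matrix_norm_le) (simp_all add: L2_set_def)
  then have "scalar_matrix_norm ({..<n} \<times> {..<0}) (\<lambda>(i, k::nat) (j, l::nat). pairing G (u i j) (\<lambda>f y. 0))
      \<le> fourier_matrix_norm G n u"
    by (intro scalar_matrix_norm_le_fourier_matrix_norm[where T = "\<lambda>k l f y. 0"] u) auto
  from order_trans[OF scalar_matrix_norm_nonneg this] show ?thesis by simp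
qed

lemma fourier_matrix_norm_bound_1:
  fixes n m :: nat
  assumes u: "\<And>i j. i < n \<Longrightarrow> j < n \<Longrightarrow> u i j \<in> fourier_algebra G"
    and T: "\<And>k l. k < m \<Longrightarrow> l < m \<Longrightarrow> T k l \<in> VN G" and T1: "operator_matrix_norm (carrier G) m T \<le> 1"
  shows "matrix_bound ({..<n} \<times> {..<m}) (\<lambda>(i, k) (j, l). pairing G (u i j) (T k l)) (fourier_matrix_norm G n u)"
  by (rule matrix_bound_mono[OF matrix_bound_scalar_matrix_norm scalar_matrix_norm_le_fourier_matrix_norm[OF u T T1]])
    simp

lemma fourier_matrix_norm_bound:
  fixes n m :: nat
  assumes u: "\<And>i j. i < n \<Longrightarrow> j < n \<Longrightarrow> u i j \<in> fourier_algebra G"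
    and T: "\<And>k l. k < m \<Longrightarrow> l < m \<Longrightarrow> T k l \<in> VN G" and c: "operator_matrix_norm (carrier G) m T \<le> c" "0 < c"
  shows "matrix_bound ({..<n} \<times> {..<m}) (\<lambda>(i, k) (j, l). pairing G (u i j) (T k l)) (c * fourier_matrix_norm G n u)"
proof -
  define d where "d = complex_of_real (1 / c)"
  have d: "cmod d = 1 / c" using c by (simp add: d_def norm_divide)
  have TB: "T k l \<in> bounded_operators (carrier G)" if "k < m" "l < m" for k l
    using T that by (blast intro: VN_bounded)
  let ?S = "\<lambda>k l f y. d * T k l f y"
  have "operator_matrix_norm (carrier G) m ?S \<le> 1"
  proof (rule operator_matrix_norm_le)
    fix \<xi> :: "nat \<Rightarrow> 'a \<Rightarrow> complex" assume \<xi>: "\<And>j. j < m \<Longrightarrow> \<xi> j \<in> ell2 (carrier G)"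
    have "L2_set (\<lambda>i. ell2_norm (carrier G) (\<lambda>x. \<Sum>j<m. d * T i j (\<xi> j) x)) {..<m}
        = (1 / c) * L2_set (\<lambda>i. ell2_norm (carrier G) (\<lambda>x. \<Sum>j<m. T i j (\<xi> j) x)) {..<m}"
      unfolding sum_distrib_left[symmetric] ell2_norm_cmult d L2_set_cmult using c by simp
    also have "\<dots> \<le> (1 / c) * (c * L2_set (\<lambda>j. ell2_norm (carrier G) (\<xi> j)) {..<m})"
    proof (rule mult_left_mono)
      have "L2_set (\<lambda>i. ell2_norm (carrier G) (\<lambda>x. \<Sum>j<m. T i j (\<xi> j) x)) {..<m}
          \<le> operator_matrix_norm (carrier G) m T * L2_set (\<lambda>j. ell2_norm (carrier G) (\<xi> j)) {..<m}"
        by (rule operator_matrix_norm_apply[OF TB \<xi>])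
      also have "\<dots> \<le> c * L2_set (\<lambda>j. ell2_norm (carrier G) (\<xi> j)) {..<m}"
        by (rule mult_right_mono[OF c(1) L2_set_nonneg])
      finally show "L2_set (\<lambda>i. ell2_norm (carrier G) (\<lambda>x. \<Sum>j<m. T i j (\<xi> j) x)) {..<m}
          \<le> c * L2_set (\<lambda>j. ell2_norm (carrier G) (\<xi> j)) {..<m}" .
    qed (use c in simp)
    finally show "L2_set (\<lambda>i. ell2_norm (carrier G) (\<lambda>x. \<Sum>j<m. d * T i j (\<xi> j) x)) {..<m}
        \<le> 1 * L2_set (\<lambda>j. ell2_norm (carrier G) (\<xi> j)) {..<m}" using c by simp
  qed simp
  then have *: "matrix_bound ({..<n} \<times> {..<m}) (\<lambda>(i, k) (j, l). pairing G (u i j) (?S k l)) (fourier_matrix_norm G n u)"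
    by (intro fourier_matrix_norm_bound_1 u VN_scale T)
  have scale: "pairing G (u i j) (?S k l) = d * pairing G (u i j) (T k l)" if "i < n" "j < n" "k < m" "l < m" for i j k l
    by (rule pairing_scale[OF T u]) (use that in auto)
  show ?thesis unfolding matrix_bound_def
  proof
    fix z :: "nat \<times> nat \<Rightarrow> complex"
    let ?I = "{..<n} \<times> {..<m}"
    have "L2_set (\<lambda>p. (1 / c) * cmod (\<Sum>q\<in>?I. (case p of (i, k) \<Rightarrow> \<lambda>(j, l). pairing G (u i j) (T k l)) q * z q)) ?I
        = L2_set (\<lambda>p. cmod (\<Sum>q\<in>?I. (case p of (i, k) \<Rightarrow> \<lambda>(j, l). pairing G (u i j) (?S k l)) q * z q)) ?I"
    proof (intro L2_set_cong refl)
      fix p assume p: "p \<in> ?I"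
      have "(\<Sum>q\<in>?I. (case p of (i, k) \<Rightarrow> \<lambda>(j, l). pairing G (u i j) (?S k l)) q * z q)
          = (\<Sum>q\<in>?I. d * ((case p of (i, k) \<Rightarrow> \<lambda>(j, l). pairing G (u i j) (T k l)) q * z q))"
        using p by (intro sum.cong refl) (auto simp: scale)
      then show "(1 / c) * cmod (\<Sum>q\<in>?I. (case p of (i, k) \<Rightarrow> \<lambda>(j, l). pairing G (u i j) (T k l)) q * z q)
          = cmod (\<Sum>q\<in>?I. (case p of (i, k) \<Rightarrow> \<lambda>(j, l). pairing G (u i j) (?S k l)) q * z q)"
        by (simp only: sum_distrib_left[symmetric] norm_mult d)
    qed
    also have "\<dots> \<le> fourier_matrix_norm G n u * L2_set (\<lambda>q. cmod (z q)) ?I"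
      by (rule *[unfolded matrix_bound_def, rule_format])
    finally have "(1 / c) * L2_set (\<lambda>p. cmod (\<Sum>q\<in>?I. (case p of (i, k) \<Rightarrow> \<lambda>(j, l). pairing G (u i j) (T k l)) q * z q)) ?I
        \<le> fourier_matrix_norm G n u * L2_set (\<lambda>q. cmod (z q)) ?I"
      unfolding L2_set_cmult using c by simp
    then show "L2_set (\<lambda>p. cmod (\<Sum>q\<in>?I. (case p of (i, k) \<Rightarrow> \<lambda>(j, l). pairing G (u i j) (T k l)) q * z q)) ?I
        \<le> c * fourier_matrix_norm G n u * L2_set (\<lambda>q. cmod (z q)) ?I"
      using c by (simp add: field_simps)
  qed
qed

section \<open>Schur bounds from completely bounded maps\<close>

lemma schur_bound_VN:
  assumes P: "completely_bounded_map (VN_space G) P"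
  shows "\<exists>K. schur_bound G (\<lambda>x. P (left_regular G x) (delta \<one>) x) K"
proof -
  obtain C where PC: "\<And>n a. (\<forall>i<n. \<forall>j<n. a i j \<in> VN G) \<Longrightarrow>
      operator_matrix_norm (carrier G) n (\<lambda>i j. P (a i j)) \<le> C * operator_matrix_norm (carrier G) n a"
    using P by (auto simp: completely_bounded_map_def VN_space_def)
  have P_VN: "P T \<in> VN G" if "T \<in> VN G" for T
    using P that by (auto simp: completely_bounded_map_def linear_map_def VN_space_def)
  have P_scale: "P (\<lambda>f x. c * T f x) = (\<lambda>f x. c * P T f x)" if "T \<in> VN G" for T c
    using P that by (auto simp: completely_bounded_map_def linear_map_def VN_space_def)
  \<comment> \<open>\<open>C\<close> may be negative in the definition of complete
    boundedness.\<close>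
  define K where "K = max C 0"
  have "schur_bound G (\<lambda>x. P (left_regular G x) (delta \<one>) x) K"
  proof (rule schur_boundI)
    show "0 \<le> K" by (simp add: K_def)
    fix n :: nat and s B c
    assume s: "\<And>k. k < n \<Longrightarrow> s k \<in> carrier G" and c: "0 < c" and B: "matrix_bound {..<n} B c"
    define a where "a k l = (\<lambda>f y. B k l * left_regular G (s k \<otimes> inv (s l)) f y)" for k l
    have x: "s k \<otimes> inv (s l) \<in> carrier G" if "k < n" "l < n" for k l using s that by simp
    have lam: "left_regular G (s k \<otimes> inv (s l)) \<in> VN G" if "k < n" "l < n" for k l
      using scaled_left_regular_VN[OF x[OF that], of 1] by simp
    have a: "a k l \<in> VN G" if "k < n" "l < n" for k l
      unfolding a_def by (rule scaled_left_regular_VN[OF x[OF that]])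
    have Pa: "P (a k l) = (\<lambda>f y. B k l * P (left_regular G (s k \<otimes> inv (s l))) f y)" if "k < n" "l < n" for k l
      unfolding a_def by (rule P_scale[OF lam[OF that]])
    have PaB: "P (a k l) \<in> bounded_operators (carrier G)" if "k < n" "l < n" for k l
      by (rule VN_bounded[OF P_VN[OF a[OF that]]])
    have na: "operator_matrix_norm (carrier G) n a \<le> c"
      unfolding a_def by (rule translated_matrix_norm[OF s _ B]) (use c in auto)
    have "0 \<le> operator_matrix_norm (carrier G) n a"
      by (rule operator_matrix_norm_nonneg[OF VN_bounded[OF a]])
    then have "C * operator_matrix_norm (carrier G) n a \<le> K * c"
      by (intro mult_mono na) (auto simp: K_def)
    with PC[of n a] a have nPa: "operator_matrix_norm (carrier G) n (\<lambda>k l. P (a k l)) \<le> K * c" by force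
    show "matrix_bound {..<n} (\<lambda>k l. B k l * P (left_regular G (s k \<otimes> inv (s l))) (delta \<one>) (s k \<otimes> inv (s l))) (K * c)"
      unfolding matrix_bound_def
    proof
      fix z :: "nat \<Rightarrow> complex"
      define \<xi> where "\<xi> l = (\<lambda>x. z l * delta (s l) x)" for l
      have \<xi>: "\<xi> l \<in> ell2 (carrier G)" and \<xi>_norm: "ell2_norm (carrier G) (\<xi> l) = cmod (z l)" if "l < n" for l
        using s[OF that] by (simp_all add: \<xi>_def ell2_norm_cmult)
      have "L2_set (\<lambda>k. cmod (\<Sum>l<n. B k l * P (left_regular G (s k \<otimes> inv (s l))) (delta \<one>) (s k \<otimes> inv (s l)) * z l)) {..<n}
          \<le> L2_set (\<lambda>k. ell2_norm (carrier G) (\<lambda>x. \<Sum>l<n. P (a k l) (\<xi> l) x)) {..<n}"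
      proof (rule L2_set_mono)
        fix k assume "k \<in> {..<n}"
        then have k: "k < n" by simp
        \<comment> \<open>The entry of an operator in VN(G) at (s_k, s_l) is its coefficient at s_k
          s_l^-1, here exactly the group element of \<lambda> in \<open>a k l\<close>. Other
          coefficients of the image are not seen.\<close>
        have "P (a k l) (\<xi> l) (s k) = B k l * P (left_regular G (s k \<otimes> inv (s l))) (delta \<one>) (s k \<otimes> inv (s l)) * z l"
          if l: "l < n" for l
          using bounded_operator_cmult[OF PaB[OF k l], of "delta (s l)" "z l"]
            VN_delta[OF P_VN[OF lam[OF k l]] s[OF k] s[OF l]] s[OF l]
          by (simp add: \<xi>_def Pa[OF k l] mult_ac)
        then have "(\<Sum>l<n. B k l * P (left_regular G (s k \<otimes> inv (s l))) (delta \<one>) (s k \<otimes> inv (s l)) * z l)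
            = (\<Sum>l<n. P (a k l) (\<xi> l) (s k))"
          by (intro sum.cong refl) simp
        moreover have "(\<lambda>x. \<Sum>l<n. P (a k l) (\<xi> l) x) \<in> ell2 (carrier G)"
          by (intro ell2_sum bounded_operator_ell2[OF PaB[OF k] \<xi>]) auto
        ultimately show "cmod (\<Sum>l<n. B k l * P (left_regular G (s k \<otimes> inv (s l))) (delta \<one>) (s k \<otimes> inv (s l)) * z l)
            \<le> ell2_norm (carrier G) (\<lambda>x. \<Sum>l<n. P (a k l) (\<xi> l) x)"
          using cmod_le_ell2_norm[of "\<lambda>x. \<Sum>l<n. P (a k l) (\<xi> l) x" "carrier G" "s k"] by simp
      qed simp
      also have "\<dots> \<le> operator_matrix_norm (carrier G) n (\<lambda>k l. P (a k l)) * L2_set (\<lambda>l. ell2_norm (carrier G) (\<xi> l)) {..<n}"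
        by (rule operator_matrix_norm_apply[OF PaB \<xi>])
      also have "\<dots> \<le> K * c * L2_set (\<lambda>l. ell2_norm (carrier G) (\<xi> l)) {..<n}"
        by (rule mult_right_mono[OF nPa L2_set_nonneg])
      also have "L2_set (\<lambda>l. ell2_norm (carrier G) (\<xi> l)) {..<n} = L2_set (\<lambda>l. cmod (z l)) {..<n}"
        by (intro L2_set_cong refl) (simp add: \<xi>_norm)
      finally show "L2_set (\<lambda>k. cmod (\<Sum>l<n. B k l * P (left_regular G (s k \<otimes> inv (s l))) (delta \<one>) (s k \<otimes> inv (s l)) * z l)) {..<n}
          \<le> K * c * L2_set (\<lambda>l. cmod (z l)) {..<n}" .
    qed
  qed
  then show ?thesis ..
qed

lemma delta_fourier: "x \<in> carrier G \<Longrightarrow> delta x \<in> fourier_algebra G"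
  by (intro ell2_subset_fourier delta_ell2)

text \<open>
  The matrix \<open>u\<^sub>a\<^sub>b = \<delta>(r\<^sub>a r\<^sub>b\<^sup>-\<^sup>1)\<close> over \<open>A(G)\<close> has norm at most one, because \<open>T \<mapsto> [\<langle>u\<^sub>a\<^sub>b, T\<rangle>]\<close> is the
  compression to the vectors \<open>\<delta>(r\<^sub>a)\<close>.
\<close>

lemma schur_bound_fourier:
  assumes P: "completely_bounded_map (fourier_space G) P"
  shows "\<exists>K. schur_bound G (\<lambda>x. P (delta x) x) K"
proof -
  obtain C where PC: "\<And>n a. (\<forall>i<n. \<forall>j<n. a i j \<in> fourier_algebra G) \<Longrightarrow>
      fourier_matrix_norm G n (\<lambda>i j. P (a i j)) \<le> C * fourier_matrix_norm G n a"
    using P by (auto simp: completely_bounded_map_def fourier_space_def)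
  have P_A: "P u \<in> fourier_algebra G" if "u \<in> fourier_algebra G" for u
    using P that by (auto simp: completely_bounded_map_def linear_map_def fourier_space_def)
  define K where "K = max C 0"
  have "schur_bound G (\<lambda>x. P (delta x) x) K"
  proof (rule schur_boundI)
    show "0 \<le> K" by (simp add: K_def)
    fix n :: nat and s B c
    assume s: "\<And>k. k < n \<Longrightarrow> s k \<in> carrier G" and c: "0 < c" and B: "matrix_bound {..<n} B c"
    \<comment> \<open>The matrix over A(G) is indexed by the distinct values of \<open>s\<close>,
      because a compression to point masses needs distinct points; \<phi> sends k to the index of
      \<open>s k\<close>.\<close>
    define R where "R = s ` {..<n}"
    define p where "p = card R"
    have R: "finite R" "R \<subseteq> carrier G" using s by (auto simp: R_def)
    obtain r where "bij_betw r {0..<card R} R" using ex_bij_betw_nat_finite[OF R(1)] by blast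
    then have r: "bij_betw r {..<p} R" by (simp add: lessThan_atLeast0 p_def)
    have rG: "r a \<in> carrier G" if "a < p" for a using r R that by (auto dest: bij_betwE)
    define \<phi> where "\<phi> k = inv_into {..<p} r (s k)" for k
    have \<phi>: "\<phi> k < p" "r (\<phi> k) = s k" if "k < n" for k
    proof -
      have "s k \<in> R" using that by (simp add: R_def)
      then show "\<phi> k < p" "r (\<phi> k) = s k"
        using bij_betw_inv_into_right[OF r] bij_betw_apply[OF bij_betw_inv_into[OF r]] by (auto simp: \<phi>_def)
    qed
    define u where "u a b = delta (r a \<otimes> inv (r b))" for a b
    have u: "u a b \<in> fourier_algebra G" if "a < p" "b < p" for a b
      using rG that by (simp add: u_def delta_fourier)
    have "fourier_matrix_norm G p u \<le> 1"
    proof (rule fourier_matrix_norm_le)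
      fix m :: nat and T
      assume T: "\<And>k l. k < m \<Longrightarrow> l < m \<Longrightarrow> T k l \<in> VN G" and T1: "operator_matrix_norm (carrier G) m T \<le> 1"
      define h where "h = (\<lambda>(a, k::nat). (k, r a))"
      have "bij_betw h ({..<p} \<times> {..<m}) ({..<m} \<times> R)"
        using r unfolding h_def bij_betw_def inj_on_def by (auto simp: image_iff)
      then have "matrix_bound ({..<p} \<times> {..<m}) (\<lambda>i j. (\<lambda>(k, x) (l, y). T k l (delta \<one>) (x \<otimes> inv y)) (h i) (h j)) 1"
        using matrix_bound_mono[OF matrix_bound_section[OF T R] T1] by (rule matrix_bound_reindex)
      then show "matrix_bound ({..<p} \<times> {..<m}) (\<lambda>(i, k) (j, l). pairing G (u i j) (T k l)) 1"
        by (rule matrix_bound_cong[THEN iffD1, rotated])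
          (use T rG in \<open>auto simp: h_def u_def pairing_delta\<close>)
    qed simp
    then have "C * fourier_matrix_norm G p u \<le> K * 1"
      by (intro mult_mono fourier_matrix_norm_nonneg u) (auto simp: K_def)
    then have nPu: "fourier_matrix_norm G p (\<lambda>a b. P (u a b)) \<le> K"
      using PC[of p u] u by force
    define S where "S k l = (\<lambda>f y. B k l * left_regular G (s k \<otimes> inv (s l)) f y)" for k l
    have x: "s k \<otimes> inv (s l) \<in> carrier G" if "k < n" "l < n" for k l using s that by simp
    have S: "S k l \<in> VN G" if "k < n" "l < n" for k l
      unfolding S_def by (rule scaled_left_regular_VN[OF x[OF that]])
    have nS: "operator_matrix_norm (carrier G) n S \<le> c"
      unfolding S_def by (rule translated_matrix_norm[OF s _ B]) (use c in auto)
    let ?I = "{..<p} \<times> {..<n}"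
    let ?M = "\<lambda>(a, k) (b, l). pairing G (P (u a b)) (S k l)"
    have "matrix_bound ?I ?M (c * fourier_matrix_norm G p (\<lambda>a b. P (u a b)))"
      by (rule fourier_matrix_norm_bound[OF P_A[OF u] S nS c])
    then have M: "matrix_bound ?I ?M (K * c)"
      by (rule matrix_bound_mono) (use nPu c in \<open>simp add: mult.commute\<close>)
    show "matrix_bound {..<n} (\<lambda>k l. B k l * P (delta (s k \<otimes> inv (s l))) (s k \<otimes> inv (s l))) (K * c)"
      unfolding matrix_bound_def
    proof
      fix z :: "nat \<Rightarrow> complex"
      \<comment> \<open>Of the rows (a, k) of the matrix of pairings only those with a = \<phi> k
        are wanted. On them \<open>P (u (\<phi> k) (\<phi> l))\<close> meets a multiple of
        \<lambda>(s_k s_l^-1), which evaluates it at s_k s_l^-1.\<close>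
      define D where "D = (\<lambda>k. (\<phi> k, k)) ` {..<n}"
      have D: "D \<subseteq> ?I" using \<phi> by (auto simp: D_def)
      have inj: "inj_on (\<lambda>k. (\<phi> k, k)) {..<n}" by (auto simp: inj_on_def)
      define w where "w q = (if q \<in> D then z (snd q) else 0)" for q
      have w: "w (\<phi> k, k) = z k" if "k < n" for k using that by (auto simp: w_def D_def)
      have w_norm: "(\<Sum>q\<in>?I. (cmod (w q))\<^sup>2) = (\<Sum>k<n. (cmod (z k))\<^sup>2)"
      proof -
        have "(\<Sum>q\<in>?I. (cmod (w q))\<^sup>2) = (\<Sum>q\<in>D. (cmod (w q))\<^sup>2)"
          using D by (intro sum.mono_neutral_right) (auto simp: w_def)
        also have "\<dots> = (\<Sum>k<n. (cmod (w (\<phi> k, k)))\<^sup>2)"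
          unfolding D_def by (simp add: sum.reindex[OF inj])
        finally show ?thesis by (simp add: w)
      qed
      have entry: "(\<Sum>q\<in>?I. ?M (\<phi> k, k) q * w q) = (\<Sum>l<n. B k l * P (delta (s k \<otimes> inv (s l))) (s k \<otimes> inv (s l)) * z l)"
        if k: "k < n" for k
      proof -
        have "(\<Sum>q\<in>?I. ?M (\<phi> k, k) q * w q) = (\<Sum>q\<in>D. ?M (\<phi> k, k) q * w q)"
          using D by (intro sum.mono_neutral_right) (auto simp: w_def)
        also have "\<dots> = (\<Sum>l<n. ?M (\<phi> k, k) (\<phi> l, l) * w (\<phi> l, l))"
          unfolding D_def by (simp add: sum.reindex[OF inj])
        also have "\<dots> = (\<Sum>l<n. B k l * P (delta (s k \<otimes> inv (s l))) (s k \<otimes> inv (s l)) * z l)"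
        proof (intro sum.cong refl)
          fix l assume "l \<in> {..<n}"
          then have l: "l < n" by simp
          have "pairing G (P (u (\<phi> k) (\<phi> l))) (S k l) = B k l * P (u (\<phi> k) (\<phi> l)) (s k \<otimes> inv (s l))"
            unfolding S_def using \<phi> k l by (intro pairing_scaled_left_regular P_A u x) auto
          then show "?M (\<phi> k, k) (\<phi> l, l) * w (\<phi> l, l) = B k l * P (delta (s k \<otimes> inv (s l))) (s k \<otimes> inv (s l)) * z l"
            using \<phi> k l by (simp add: w u_def)
        qed
        finally show ?thesis .
      qed
      have "(\<Sum>k<n. (cmod (\<Sum>l<n. B k l * P (delta (s k \<otimes> inv (s l))) (s k \<otimes> inv (s l)) * z l))\<^sup>2)
          = (\<Sum>q\<in>D. (cmod (\<Sum>q'\<in>?I. ?M q q' * w q'))\<^sup>2)"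
        unfolding D_def by (subst sum.reindex[OF inj]) (simp add: entry[simplified])
      also have "\<dots> \<le> (\<Sum>q\<in>?I. (cmod (\<Sum>q'\<in>?I. ?M q q' * w q'))\<^sup>2)"
        using D by (intro sum_mono2) auto
      also have "\<dots> \<le> (K * c)\<^sup>2 * (\<Sum>q\<in>?I. (cmod (w q))\<^sup>2)"
        by (rule L2_set_le_cmultD, rule M[unfolded matrix_bound_def, rule_format])
      finally show "L2_set (\<lambda>k. cmod (\<Sum>l<n. B k l * P (delta (s k \<otimes> inv (s l))) (s k \<otimes> inv (s l)) * z l)) {..<n}
          \<le> K * c * L2_set (\<lambda>l. cmod (z l)) {..<n}"
        unfolding w_norm using c by (intro L2_set_le_cmultI) (simp_all add: K_def)
    qed
  qed
  then show ?thesis ..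
qed

end

section \<open>Complemented ideals and annihilators\<close>

context group
begin

text \<open>For x in \<open>E\<close> the range of P forces the value 0 at x. For other x the point
  mass lies in the ideal and is fixed by P.\<close>

lemma schur_bound_fourier_complemented:
  assumes "completely_complemented (fourier_space G) (ideal_of G E)"
  shows "\<exists>K. schur_bound G (\<lambda>x. if x \<in> E then 0 else 1) K"
proof -
  obtain P where P: "completely_bounded_map (fourier_space G) P"
      and "projection_onto (fourier_space G) (ideal_of G E) P"
    using assms by (auto simp: completely_complemented_def)
  then have onto: "P ` fourier_algebra G = ideal_of G E" and idem: "\<And>u. u \<in> fourier_algebra G \<Longrightarrow> P (P u) = P u"
    by (simp_all add: projection_onto_def fourier_space_def)
  have diag: "P (delta x) x = (if x \<in> E then 0 else 1)" if x: "x \<in> carrier G" for x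
  proof (cases "x \<in> E")
    case True
    have "P (delta x) \<in> ideal_of G E" using onto delta_fourier[OF x] by blast
    then show ?thesis using True by (simp add: ideal_of_def)
  next
    case False
    then have "delta x \<in> ideal_of G E"
      using delta_fourier[OF x] by (auto simp: ideal_of_def delta_def)
    then obtain u where "u \<in> fourier_algebra G" "delta x = P u" unfolding onto[symmetric] by blast
    then have "P (delta x) = delta x" using idem by simp
    then show ?thesis using False by simp
  qed
  obtain K where "schur_bound G (\<lambda>x. P (delta x) x) K" using schur_bound_fourier[OF P] ..
  from schur_bound_cong[OF diag this] show ?thesis ..
qed

lemma left_regular_VN: "x \<in> carrier G \<Longrightarrow> left_regular G x \<in> VN G"
  using scaled_left_regular_VN[of x 1] by simp

text \<open>For x in \<open>E\<close> the operator \<lambda>(x) annihilates the ideal and is fixed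
  by P. For other x the point mass at x is in the ideal, and pairing with it shows that the
  coefficient at x of P(\<lambda>(x)) is 0.\<close>

lemma schur_bound_VN_complemented:
  assumes "completely_complemented (VN_space G) (annihilator G (ideal_of G E))"
  shows "\<exists>K. schur_bound G (\<lambda>x. if x \<in> E then 1 else 0) K"
proof -
  obtain P where P: "completely_bounded_map (VN_space G) P"
      and "projection_onto (VN_space G) (annihilator G (ideal_of G E)) P"
    using assms by (auto simp: completely_complemented_def)
  then have onto: "P ` VN G = annihilator G (ideal_of G E)" and idem: "\<And>T. T \<in> VN G \<Longrightarrow> P (P T) = P T"
    by (simp_all add: projection_onto_def VN_space_def)
  have diag: "P (left_regular G x) (delta \<one>) x = (if x \<in> E then 1 else 0)" if x: "x \<in> carrier G" for x
  proof (cases "x \<in> E")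
    case True
    have "pairing G u (left_regular G x) = 0" if "u \<in> ideal_of G E" for u
      using that True pairing_scaled_left_regular[of u x 1] x by (simp add: ideal_of_def)
    then have "left_regular G x \<in> annihilator G (ideal_of G E)"
      using left_regular_VN[OF x] by (simp add: annihilator_def)
    then obtain T where "T \<in> VN G" "left_regular G x = P T" unfolding onto[symmetric] by blast
    then have "P (left_regular G x) = left_regular G x" using idem by simp
    then show ?thesis using True x by (simp add: left_regular_delta)
  next
    case False
    have PA: "P (left_regular G x) \<in> annihilator G (ideal_of G E)" using onto left_regular_VN[OF x] by blast
    moreover have "delta x \<in> ideal_of G E"
      using False delta_fourier[OF x] by (auto simp: ideal_of_def delta_def)
    ultimately have "pairing G (delta x) (P (left_regular G x)) = 0" by (simp add: annihilator_def)
    moreover have "P (left_regular G x) \<in> VN G" using PA by (simp add: annihilator_def)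
    ultimately show ?thesis using False pairing_delta x by simp
  qed
  obtain K where "schur_bound G (\<lambda>x. P (left_regular G x) (delta \<one>) x) K" using schur_bound_VN[OF P] ..
  from schur_bound_cong[OF diag this] show ?thesis ..
qed

end

context ell2_restricted
begin

section \<open>The four bounded projections\<close>

lemma restrict_fourier: "u \<in> fourier_algebra G \<Longrightarrow> restrict_to E u \<in> fourier_algebra G"
  by (rule ell2_subset_fourier[OF ell2_E_carrier[OF restrict_fourier_ell2(1)]])

lemma restrict_fourier_norm:
  assumes "u \<in> fourier_algebra G"
  shows "fourier_norm G (restrict_to E u) \<le> C * fourier_norm G u"
proof -
  note r = restrict_fourier_ell2[OF assms]
  have "fourier_norm G (restrict_to E u) \<le> ell2_norm (carrier G) (restrict_to E u)"
    by (rule fourier_norm_ell2[OF ell2_E_carrier[OF r(1)]])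
  also have "\<dots> = ell2_norm E (restrict_to E u)"
    using ell2_norm_UNIV[OF r(1)] ell2_norm_UNIV[OF ell2_E_carrier[OF r(1)]] by simp
  finally show ?thesis using r(2) by simp
qed

text \<open>The restriction to \<open>E\<close> is square-summable, so
  \<open>fourier_add_ell2\<close> applies to its negative.\<close>

lemma fourier_complement:
  assumes u: "u \<in> fourier_algebra G"
  shows "(\<lambda>x. u x - restrict_to E u x) \<in> fourier_algebra G"
    and "fourier_norm G (\<lambda>x. u x - restrict_to E u x) \<le> (1 + C) * fourier_norm G u"
proof -
  let ?h = "\<lambda>x. - restrict_to E u x"
  note r = restrict_fourier_ell2[OF u]
  have h: "?h \<in> ell2 (carrier G)" using ell2_E_carrier[OF r(1)] by simp
  have A: "(\<lambda>x. u x + ?h x) \<in> fourier_algebra G" by (rule fourier_add_ell2[OF u h])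
  then show "(\<lambda>x. u x - restrict_to E u x) \<in> fourier_algebra G" by simp
  have "fourier_norm G ?h \<le> ell2_norm (carrier G) ?h" by (rule fourier_norm_ell2[OF h])
  also have "\<dots> = ell2_norm E (restrict_to E u)"
    using ell2_norm_UNIV[OF r(1)] ell2_norm_UNIV[OF ell2_E_carrier[OF r(1)]] by (simp add: ell2_norm_def)
  also have "\<dots> \<le> C * fourier_norm G u" by (rule r(2))
  finally have "fourier_norm G ?h \<le> C * fourier_norm G u" .
  then show "fourier_norm G (\<lambda>x. u x - restrict_to E u x) \<le> (1 + C) * fourier_norm G u"
    using fourier_norm_triangle[OF u ell2_subset_fourier[OF h] A] by (simp add: distrib_right)
qed

lemma complemented_ideal_complement: "complemented (fourier_space G) (ideal_of G (carrier G - E))"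
proof -
  have fixed: "restrict_to E u = u" if "u \<in> ideal_of G (carrier G - E)" for u
    using that by (auto simp: ideal_of_def fourier_algebra_def restrict_to_def coefficient_def fun_eq_iff)
  have in_ideal: "restrict_to E u \<in> ideal_of G (carrier G - E)" if "u \<in> fourier_algebra G" for u
    using restrict_fourier[OF that] by (simp add: ideal_of_def restrict_to_def)
  have "restrict_to E ` fourier_algebra G = ideal_of G (carrier G - E)"
  proof
    show "ideal_of G (carrier G - E) \<subseteq> restrict_to E ` fourier_algebra G"
      using fixed by (force simp: ideal_of_def)
  qed (use in_ideal in blast)
  moreover have "restrict_to E (restrict_to E u) = restrict_to E u" for u by (auto simp: restrict_to_def)
  ultimately have "projection_onto (fourier_space G) (ideal_of G (carrier G - E)) (restrict_to E)"
    by (simp add: projection_onto_def fourier_space_def)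
  moreover have "bounded_map (fourier_space G) (restrict_to E)"
    unfolding bounded_map_def linear_map_def fourier_space_def
    using restrict_fourier restrict_fourier_norm by (auto simp: restrict_to_def fun_eq_iff intro!: exI[of _ C])
  ultimately show ?thesis by (auto simp: complemented_def)
qed

lemma complemented_ideal: "complemented (fourier_space G) (ideal_of G E)"
proof -
  let ?P = "\<lambda>u x. u x - restrict_to E u x"
  have fixed: "?P u = u" if "u \<in> ideal_of G E" for u
    using that by (auto simp: ideal_of_def restrict_to_def fun_eq_iff)
  have in_ideal: "?P u \<in> ideal_of G E" if "u \<in> fourier_algebra G" for u
    using fourier_complement[OF that] by (simp add: ideal_of_def restrict_to_def)
  have "?P ` fourier_algebra G = ideal_of G E"
  proof
    show "ideal_of G E \<subseteq> ?P ` fourier_algebra G"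
    proof
      fix u assume u: "u \<in> ideal_of G E"
      then have "u \<in> fourier_algebra G" by (simp add: ideal_of_def)
      then show "u \<in> ?P ` fourier_algebra G" by (rule image_eqI[where f = ?P, OF fixed[OF u, symmetric]])
    qed
  qed (use in_ideal in blast)
  moreover have "?P (?P u) = ?P u" for u by (auto simp: restrict_to_def fun_eq_iff)
  ultimately have "projection_onto (fourier_space G) (ideal_of G E) ?P"
    unfolding projection_onto_def fourier_space_def by simp
  moreover have "bounded_map (fourier_space G) ?P"
    unfolding bounded_map_def linear_map_def fourier_space_def operator_space.simps
  proof (intro conjI exI ballI allI)
    show "?P ` fourier_algebra G \<subseteq> fourier_algebra G" using fourier_complement by blast
    show "fourier_norm G (?P u) \<le> (1 + C) * fourier_norm G u" if "u \<in> fourier_algebra G" for u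
      by (rule fourier_complement(2)[OF that])
  qed (auto simp: restrict_to_def fun_eq_iff algebra_simps)
  ultimately show ?thesis unfolding complemented_def by blast
qed

text \<open>Point masses off \<open>E\<close> lie in the ideal and detect the coefficients there.
  Conversely, an operator with coefficients only on \<open>E\<close> is fixed by
  \<open>VN_restrict\<close>, whose adjoint kills functions vanishing on \<open>E\<close>.\<close>

lemma annihilator_ideal:
  "annihilator G (ideal_of G E) = {T \<in> VN G. \<forall>x\<in>carrier G - E. T (delta \<one>) x = 0}"
proof (intro equalityI subsetI)
  fix T assume T: "T \<in> annihilator G (ideal_of G E)"
  then have TV: "T \<in> VN G" by (simp add: annihilator_def)
  have "T (delta \<one>) x = 0" if x: "x \<in> carrier G - E" for x
  proof -
    have "delta x \<in> ideal_of G E" using x delta_fourier by (auto simp: ideal_of_def delta_def)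
    then show ?thesis using T x pairing_delta[OF TV, of x] by (simp add: annihilator_def)
  qed
  with TV show "T \<in> {T \<in> VN G. \<forall>x\<in>carrier G - E. T (delta \<one>) x = 0}" by simp
next
  fix T assume "T \<in> {T \<in> VN G. \<forall>x\<in>carrier G - E. T (delta \<one>) x = 0}"
  then have T: "T \<in> VN G" and 0: "\<And>x. x \<in> carrier G - E \<Longrightarrow> T (delta \<one>) x = 0" by auto
  have fixed: "VN_restrict T = T"
    by (rule VN_eqI[OF VN_restrict_VN[OF T] T]) (use 0 in \<open>simp add: VN_restrict_delta_one[OF T]\<close>)
  have "pairing G u T = 0" if u: "u \<in> ideal_of G E" for u
  proof -
    have uA: "u \<in> fourier_algebra G" and "restrict_to E u = (\<lambda>_. 0)"
      using u by (auto simp: ideal_of_def restrict_to_def)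
    then have "pairing G u T = pairing G (\<lambda>_. 0) T"
      using pairing_VN_restrict[OF T uA] fixed by simp
    also have "\<dots> = 0" using has_sum_unique[OF pairing_ell2[OF T ell2_zero]] by simp
    finally show ?thesis .
  qed
  with T show "T \<in> annihilator G (ideal_of G E)" by (simp add: annihilator_def)
qed

text \<open>A function in this ideal equals its restriction to \<open>E\<close>, so its pairing with
  \<open>T\<close> involves only the coefficients of \<open>T\<close> on \<open>E\<close>.\<close>

lemma annihilator_ideal_complement:
  "annihilator G (ideal_of G (carrier G - E)) = {T \<in> VN G. \<forall>x\<in>E. T (delta \<one>) x = 0}"
proof (intro equalityI subsetI)
  fix T assume T: "T \<in> annihilator G (ideal_of G (carrier G - E))"
  then have TV: "T \<in> VN G" by (simp add: annihilator_def)
  have "T (delta \<one>) x = 0" if x: "x \<in> E" for x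
  proof -
    have "delta x \<in> ideal_of G (carrier G - E)" using x delta_fourier by (auto simp: ideal_of_def delta_def)
    then show ?thesis using T x pairing_delta[OF TV, of x] by (simp add: annihilator_def)
  qed
  with TV show "T \<in> {T \<in> VN G. \<forall>x\<in>E. T (delta \<one>) x = 0}" by simp
next
  fix T assume "T \<in> {T \<in> VN G. \<forall>x\<in>E. T (delta \<one>) x = 0}"
  then have T: "T \<in> VN G" and 0: "\<And>x. x \<in> E \<Longrightarrow> T (delta \<one>) x = 0" by auto
  have "pairing G u T = 0" if u: "u \<in> ideal_of G (carrier G - E)" for u
  proof -
    have uA: "u \<in> fourier_algebra G" and "restrict_to E u = u"
      using u by (auto simp: ideal_of_def restrict_to_def fourier_algebra_def coefficient_def fun_eq_iff)
    then have "pairing G u T = pairing G u (VN_restrict T)"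
      using pairing_VN_restrict[OF T uA] by simp
    moreover have "((\<lambda>x. restrict_to E (T (delta \<one>)) x * u x) has_sum pairing G u (VN_restrict T)) E"
      unfolding VN_restrict_def by (rule pairing_convolution[OF restrict_VN_ell2(1)[OF T] uA])
    moreover have "restrict_to E (T (delta \<one>)) = (\<lambda>_. 0)" using 0 by (auto simp: restrict_to_def)
    ultimately have "((\<lambda>x. 0) has_sum pairing G u T) E" by simp
    then show ?thesis by (rule has_sum_unique) (rule has_sum_0_simp)
  qed
  with T show "T \<in> annihilator G (ideal_of G (carrier G - E))" by (simp add: annihilator_def)
qed

lemma VN_restrict_add:
  assumes "S \<in> VN G" "T \<in> VN G"
  shows "VN_restrict (\<lambda>f x. S f x + T f x) = (\<lambda>f x. VN_restrict S f x + VN_restrict T f x)"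
proof (rule VN_eqI)
  show "VN_restrict (\<lambda>f x. S f x + T f x) \<in> VN G" by (rule VN_restrict_VN[OF VN_add[OF assms]])
  show "(\<lambda>f x. VN_restrict S f x + VN_restrict T f x) \<in> VN G"
    by (rule VN_add[OF VN_restrict_VN[OF assms(1)] VN_restrict_VN[OF assms(2)]])
  show "VN_restrict (\<lambda>f x. S f x + T f x) (delta \<one>) x = VN_restrict S (delta \<one>) x + VN_restrict T (delta \<one>) x"
    if "x \<in> carrier G" for x
    using that by (simp add: VN_restrict_delta_one[OF VN_add[OF assms]] VN_restrict_delta_one[OF assms(1)]
        VN_restrict_delta_one[OF assms(2)])
qed

lemma VN_restrict_scale:
  assumes "T \<in> VN G"
  shows "VN_restrict (\<lambda>f x. c * T f x) = (\<lambda>f x. c * VN_restrict T f x)"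
proof (rule VN_eqI)
  show "VN_restrict (\<lambda>f x. c * T f x) \<in> VN G" by (rule VN_restrict_VN[OF VN_scale[OF assms]])
  show "(\<lambda>f x. c * VN_restrict T f x) \<in> VN G" by (rule VN_scale[OF VN_restrict_VN[OF assms]])
  show "VN_restrict (\<lambda>f x. c * T f x) (delta \<one>) x = c * VN_restrict T (delta \<one>) x" if "x \<in> carrier G" for x
    using that by (simp add: VN_restrict_delta_one[OF VN_scale[OF assms]] VN_restrict_delta_one[OF assms])
qed

lemma complemented_annihilator: "complemented (VN_space G) (annihilator G (ideal_of G E))"
proof -
  have fixed: "VN_restrict T = T" if "T \<in> annihilator G (ideal_of G E)" for T
    using that unfolding annihilator_ideal
    by (intro VN_eqI VN_restrict_VN) (auto simp: VN_restrict_delta_one)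
  have in_ann: "VN_restrict T \<in> annihilator G (ideal_of G E)" if "T \<in> VN G" for T
    using that by (simp add: annihilator_ideal VN_restrict_VN VN_restrict_delta_one)
  have "VN_restrict ` VN G = annihilator G (ideal_of G E)"
  proof
    show "annihilator G (ideal_of G E) \<subseteq> VN_restrict ` VN G"
      using fixed by (force simp: annihilator_def)
  qed (use in_ann in blast)
  then have "projection_onto (VN_space G) (annihilator G (ideal_of G E)) VN_restrict"
    using fixed[OF in_ann] by (simp add: projection_onto_def VN_space_def)
  moreover have "bounded_map (VN_space G) VN_restrict"
    unfolding bounded_map_def linear_map_def VN_space_def
    by (auto simp: VN_restrict_VN VN_restrict_add VN_restrict_scale intro!: exI[of _ C] VN_restrict_norm)
  ultimately show ?thesis by (auto simp: complemented_def)
qed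

lemma operator_norm_diff:
  assumes S: "S \<in> VN G" and T: "T \<in> VN G"
  shows "operator_norm (carrier G) (\<lambda>f x. S f x - T f x) \<le> operator_norm (carrier G) S + operator_norm (carrier G) T"
proof (rule operator_norm_le)
  fix f assume f: "f \<in> ell2 (carrier G)"
  note S' = bounded_operator_ell2[OF VN_bounded[OF S] f] and T' = bounded_operator_ell2[OF VN_bounded[OF T] f]
  have "ell2_norm (carrier G) (\<lambda>x. S f x + (-1) * T f x) \<le> ell2_norm (carrier G) (S f) + ell2_norm (carrier G) (\<lambda>x. (-1) * T f x)"
    by (intro ell2_norm_triangle S' ell2_cmult T')
  also have "\<dots> = ell2_norm (carrier G) (S f) + ell2_norm (carrier G) (T f)"
    unfolding ell2_norm_cmult by simp
  also have "\<dots> \<le> operator_norm (carrier G) S * ell2_norm (carrier G) f + operator_norm (carrier G) T * ell2_norm (carrier G) f"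
    by (intro add_mono operator_norm_apply VN_bounded S T f)
  finally show "ell2_norm (carrier G) (\<lambda>x. S f x - T f x)
      \<le> (operator_norm (carrier G) S + operator_norm (carrier G) T) * ell2_norm (carrier G) f"
    by (simp add: distrib_right)
qed (intro add_nonneg_nonneg operator_norm_nonneg VN_bounded S T)

lemma complemented_annihilator_complement:
  "complemented (VN_space G) (annihilator G (ideal_of G (carrier G - E)))"
proof -
  let ?P = "\<lambda>T f x. T f x - VN_restrict T f x"
  have P_VN: "?P T \<in> VN G" if "T \<in> VN G" for T
    by (intro VN_diff VN_restrict_VN that)
  have fixed: "?P T = T" if "T \<in> annihilator G (ideal_of G (carrier G - E))" for T
    using that unfolding annihilator_ideal_complement
    by (intro VN_eqI P_VN) (auto simp: VN_restrict_delta_one)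
  have in_ann: "?P T \<in> annihilator G (ideal_of G (carrier G - E))" if "T \<in> VN G" for T
    unfolding annihilator_ideal_complement using P_VN[OF that] by (simp add: VN_restrict_delta_one[OF that])
  have "?P ` VN G = annihilator G (ideal_of G (carrier G - E))"
  proof
    show "annihilator G (ideal_of G (carrier G - E)) \<subseteq> ?P ` VN G"
    proof
      fix T assume T: "T \<in> annihilator G (ideal_of G (carrier G - E))"
      then have "T \<in> VN G" by (simp add: annihilator_def)
      then show "T \<in> ?P ` VN G" by (rule image_eqI[where f = ?P, OF fixed[OF T, symmetric]])
    qed
  qed (use in_ann in blast)
  then have "projection_onto (VN_space G) (annihilator G (ideal_of G (carrier G - E))) ?P"
    unfolding projection_onto_def VN_space_def operator_space.simps
    using fixed[OF in_ann] by blast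
  moreover have "bounded_map (VN_space G) ?P"
    unfolding bounded_map_def linear_map_def VN_space_def operator_space.simps
  proof (intro conjI exI ballI allI)
    show "?P ` VN G \<subseteq> VN G" using P_VN by blast
    show "operator_norm (carrier G) (?P T) \<le> (1 + C) * operator_norm (carrier G) T" if "T \<in> VN G" for T
      using operator_norm_diff[OF that VN_restrict_VN[OF that]] VN_restrict_norm[OF that]
      by (simp add: distrib_right)
  qed (auto simp: VN_restrict_add VN_restrict_scale algebra_simps)
  ultimately show ?thesis unfolding complemented_def by blast
qed

section \<open>Complete boundedness from a Schur bound\<close>

text \<open>A finite section of the restricted matrix is the Schur product of the section of
  \<open>T\<close> with 1_E(x y^-1). The index (k, x) carries x, so each group element is repeated m
  times.\<close>

lemma VN_restrict_matrix_norm: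
  fixes m :: nat
  assumes K: "schur_bound G (\<lambda>x. if x \<in> E then 1 else 0) K"
    and T: "\<And>k l. k < m \<Longrightarrow> l < m \<Longrightarrow> T k l \<in> VN G" and c: "operator_matrix_norm (carrier G) m T \<le> c" "0 < c"
  shows "operator_matrix_norm (carrier G) m (\<lambda>k l. VN_restrict (T k l)) \<le> K * c"
proof (rule operator_matrix_norm_le_sections)
  show "0 \<le> K * c" using K c by (simp add: schur_bound_def)
  fix F assume F: "finite F" "F \<subseteq> carrier G"
  have "matrix_bound ({..<m} \<times> F) (\<lambda>(k, x) (l, y). T k l (delta \<one>) (x \<otimes> inv y)) c"
    by (rule matrix_bound_mono[OF matrix_bound_section[OF T F] c(1)])
  then have "matrix_bound ({..<m} \<times> F) (\<lambda>i j. (\<lambda>(k, x) (l, y). T k l (delta \<one>) (x \<otimes> inv y)) i j *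
      (if snd i \<otimes> inv (snd j) \<in> E then 1 else 0)) (K * c)"
    using F c by (intro schur_bound_finite[OF K]) auto
  then show "matrix_bound ({..<m} \<times> F) (\<lambda>(k, x) (l, y). VN_restrict (T k l) (delta \<one>) (x \<otimes> inv y)) (K * c)"
    by (rule matrix_bound_cong[THEN iffD1, rotated]) (use F T in \<open>auto simp: VN_restrict_delta_one subset_iff\<close>)
qed (intro VN_restrict_VN T)

text \<open>The norm over A(G) is tested on matrices over VN(G), where restriction can be moved to
  the other side of the pairing.\<close>

lemma indicator_McbA:
  assumes K: "schur_bound G (\<lambda>x. if x \<in> E then 1 else 0) K"
  shows "indicator E \<in> McbA G"
proof -
  have ind: "(\<lambda>u x. indicator E x * u x) = (restrict_to E :: ('a \<Rightarrow> complex) \<Rightarrow> _)"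
    by (auto simp: restrict_to_def fun_eq_iff indicator_def)
  have MA: "indicator E \<in> MA G"
    using restrict_fourier fun_cong[OF ind] by (auto simp: MA_def indicator_def)
  have K0: "0 \<le> K" using K by (simp add: schur_bound_def)
  \<comment> \<open>\<open>K + 1\<close> rather than \<open>K\<close>, as
    \<open>fourier_matrix_norm_bound\<close> takes a positive constant.\<close>
  have bound: "fourier_matrix_norm G n (\<lambda>i j. restrict_to E (u i j)) \<le> (K + 1) * fourier_matrix_norm G n u"
    if u: "\<And>i j. i < n \<Longrightarrow> j < n \<Longrightarrow> u i j \<in> fourier_algebra G" for n :: nat and u
  proof (rule fourier_matrix_norm_le)
    show "0 \<le> (K + 1) * fourier_matrix_norm G n u"
      using K0 by (intro mult_nonneg_nonneg fourier_matrix_norm_nonneg u) auto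
    fix m :: nat and T
    assume T: "\<And>k l. k < m \<Longrightarrow> l < m \<Longrightarrow> T k l \<in> VN G" and T1: "operator_matrix_norm (carrier G) m T \<le> 1"
    have "operator_matrix_norm (carrier G) m (\<lambda>k l. VN_restrict (T k l)) \<le> K + 1"
      using VN_restrict_matrix_norm[OF K T T1] by simp
    then have "matrix_bound ({..<n} \<times> {..<m}) (\<lambda>(i, k) (j, l). pairing G (u i j) (VN_restrict (T k l)))
        ((K + 1) * fourier_matrix_norm G n u)"
      using K0 by (intro fourier_matrix_norm_bound u VN_restrict_VN T) auto
    then show "matrix_bound ({..<n} \<times> {..<m}) (\<lambda>(i, k) (j, l). pairing G (restrict_to E (u i j)) (T k l))
        ((K + 1) * fourier_matrix_norm G n u)"
      by (rule matrix_bound_cong[THEN iffD1, rotated]) (use u T in \<open>auto simp: pairing_VN_restrict\<close>)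
  qed
  have "completely_bounded_map (fourier_space G) (restrict_to E)"
    unfolding completely_bounded_map_def linear_map_def fourier_space_def operator_space.simps
  proof (intro conjI exI ballI allI impI)
    show "restrict_to E ` fourier_algebra G \<subseteq> fourier_algebra G" using restrict_fourier by blast
    show "fourier_matrix_norm G n (\<lambda>i j. restrict_to E (a i j)) \<le> (K + 1) * fourier_matrix_norm G n a"
      if "\<forall>i<n. \<forall>j<n. a i j \<in> fourier_algebra G" for n a
      using that by (intro bound) auto
  qed (auto simp: restrict_to_def)
  with MA show ?thesis by (simp add: McbA_def ind)
qed

end

text \<open>
  An isomorphism \<open>\<Phi>\<close> of \<open>A\<^sub>G(E)\<close> onto \<open>\<ell>\<^sup>2(E)\<close> sends the idempotents \<open>\<delta>\<^sub>x\<close> to indicators of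
  nonempty disjoint sets, on which \<open>\<Phi> u\<close> takes the value \<open>u(x)\<close>.
\<close>

lemma (in group) Leinert_restricts_to_ell2:
  assumes "Leinert_set G E"
  shows "\<exists>C. restricts_to_ell2 G E C"
proof -
  let ?A = "restriction_algebra G E"
  obtain \<Phi> C where E: "E \<subseteq> carrier G" and bij: "bij_betw \<Phi> ?A (ell2 E)"
      and mult: "\<And>u v. u \<in> ?A \<Longrightarrow> v \<in> ?A \<Longrightarrow> \<Phi> (\<lambda>x. u x * v x) = (\<lambda>x. \<Phi> u x * \<Phi> v x)"
      and scale: "\<And>c u. u \<in> ?A \<Longrightarrow> \<Phi> (\<lambda>x. c * u x) = (\<lambda>x. c * \<Phi> u x)"
      and C: "\<And>u. u \<in> ?A \<Longrightarrow> ell2_norm E (\<Phi> u) \<le> C * restriction_norm G E u"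
    using assms unfolding Leinert_set_def by blast
  have delta_A: "delta x \<in> ?A" if "x \<in> E" for x
  proof -
    have "delta x = restrict_to E (delta x)" using that by (auto simp: restrict_to_def delta_def)
    then show ?thesis unfolding restriction_algebra_def using that E delta_fourier[of x] by blast
  qed
  have zero_A: "(\<lambda>_. 0) \<in> ?A"
  proof -
    have "(\<lambda>_. 0) = restrict_to E (\<lambda>_. 0)" by (auto simp: restrict_to_def)
    then show ?thesis unfolding restriction_algebra_def using ell2_subset_fourier[OF ell2_zero] by blast
  qed
  have \<Phi>0: "\<Phi> (\<lambda>_. 0) = (\<lambda>_. 0)" using scale[OF zero_A, of 0] by simp
  have "\<exists>y. \<Phi> (delta x) y \<noteq> 0" if x: "x \<in> E" for x
  proof (rule ccontr)
    assume "\<not> ?thesis"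
    then have "\<Phi> (delta x) = \<Phi> (\<lambda>_. 0)" using \<Phi>0 by auto
    then have "delta x = (\<lambda>_. 0)"
      using bij delta_A[OF x] zero_A by (auto simp: bij_betw_def inj_on_def)
    then have "delta x x = 0" by (rule fun_cong)
    then show False by simp
  qed
  then obtain \<sigma> where \<sigma>: "\<And>x. x \<in> E \<Longrightarrow> \<Phi> (delta x) (\<sigma> x) \<noteq> 0" by metis
  have inj: "inj_on \<sigma> E"
  proof (rule inj_onI, rule ccontr)
    fix x y assume x: "x \<in> E" and y: "y \<in> E" and eq: "\<sigma> x = \<sigma> y" and ne: "x \<noteq> y"
    have "(\<lambda>z. delta x z * delta y z) = (\<lambda>_. 0)" using ne by (auto simp: delta_def)
    then have "(\<lambda>z. \<Phi> (delta x) z * \<Phi> (delta y) z) = (\<lambda>_. 0)"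
      using mult[OF delta_A[OF x] delta_A[OF y]] \<Phi>0 by simp
    from fun_cong[OF this, of "\<sigma> x"] show False using \<sigma>[OF x] \<sigma>[OF y] eq by simp
  qed
  have val: "\<Phi> u (\<sigma> x) = u x" if u: "u \<in> ?A" and x: "x \<in> E" for u x
  proof -
    have "(\<lambda>z. u z * delta x z) = (\<lambda>z. u x * delta x z)" by (auto simp: delta_def)
    then have "(\<lambda>z. \<Phi> u z * \<Phi> (delta x) z) = (\<lambda>z. u x * \<Phi> (delta x) z)"
      using mult[OF u delta_A[OF x]] scale[OF delta_A[OF x], of "u x"] by simp
    from fun_cong[OF this, of "\<sigma> x"] show ?thesis using \<sigma>[OF x] by simp
  qed
  have "restricts_to_ell2 G E (max C 0)"
    unfolding restricts_to_ell2_def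
  proof (intro conjI ballI allI impI E)
    fix f g F assume f: "f \<in> ell2 (carrier G)" and g: "g \<in> ell2 (carrier G)" and F: "finite F \<and> F \<subseteq> E"
    define u where "u = restrict_to E (coefficient G f g)"
    let ?n = "ell2_norm (carrier G) f * ell2_norm (carrier G) g"
    have u: "u \<in> ?A" using f g by (simp add: u_def restriction_algebra_def)
    have "(\<Sum>x\<in>F. (cmod (coefficient G f g x))\<^sup>2) = (\<Sum>x\<in>F. (cmod (\<Phi> u (\<sigma> x)))\<^sup>2)"
      using F val[OF u] by (intro sum.cong) (auto simp: u_def restrict_to_def)
    also have "\<dots> = (\<Sum>y\<in>\<sigma> ` F. (cmod (\<Phi> u y))\<^sup>2)"
      using F inj by (intro sum.reindex_cong[of \<sigma>, symmetric]) (auto intro: inj_on_subset)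
    also have "\<dots> \<le> (ell2_norm E (\<Phi> u))\<^sup>2"
      using F bij u by (intro sum_le_ell2_norm) (auto dest: bij_betwE)
    also have "\<dots> \<le> (max C 0 * ?n)\<^sup>2"
    proof (rule power_mono)
      have rn: "0 \<le> restriction_norm G E u" "restriction_norm G E u \<le> fourier_norm G (coefficient G f g)"
      proof -
        have in_set: "fourier_norm G (coefficient G f g) \<in> {fourier_norm G w |w. w \<in> fourier_algebra G \<and> restrict_to E w = u}"
          using f g by (auto simp: u_def)
        show "0 \<le> restriction_norm G E u"
          unfolding restriction_norm_def using in_set by (intro cInf_greatest) (auto intro: fourier_norm_nonneg)
        show "restriction_norm G E u \<le> fourier_norm G (coefficient G f g)"
          unfolding restriction_norm_def
          by (rule cInf_lower[OF in_set]) (auto intro!: bdd_belowI[of _ 0] fourier_norm_nonneg)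
      qed
      have "ell2_norm E (\<Phi> u) \<le> C * restriction_norm G E u" by (rule C[OF u])
      also have "\<dots> \<le> max C 0 * ?n"
        using rn fourier_norm_coefficient[OF f g] by (intro mult_mono) auto
      finally show "ell2_norm E (\<Phi> u) \<le> max C 0 * ?n" .
    qed simp
    finally show "(\<Sum>x\<in>F. (cmod (coefficient G f g x))\<^sup>2) \<le> (max C 0 * ?n)\<^sup>2" .
  qed simp
  then show ?thesis ..
qed

section \<open>The free group\<close>

lemma prefix_ell2:
  assumes h: "h \<in> ell2 S"
  shows "(\<lambda>w. h (p @ w)) \<in> ell2 UNIV"
proof (rule ell2I)
  fix F :: "'a list set" assume F: "finite F"
  have "(\<Sum>w\<in>F. (cmod (h (p @ w)))\<^sup>2) = (\<Sum>v\<in>(@) p ` F. (cmod (h v))\<^sup>2)"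
    by (simp add: sum.reindex inj_on_def)
  also have "\<dots> \<le> (ell2_norm S h)\<^sup>2" using F by (intro sum_le_ell2_norm h) simp
  finally show "(\<Sum>w\<in>F. (cmod (h (p @ w)))\<^sup>2) \<le> (ell2_norm S h)\<^sup>2" .
qed simp

text \<open>For prefixes of one length, \<open>p @ w\<close> determines both \<open>p\<close> and
  \<open>w\<close>, so the pieces of \<open>h\<close> have disjoint supports.\<close>

lemma prefix_norm_sum:
  assumes h: "h \<in> ell2 S" and P: "finite P" and len: "\<And>p. p \<in> P \<Longrightarrow> length p = n"
  shows "(\<Sum>p\<in>P. (ell2_norm UNIV (\<lambda>w. h (p @ w)))\<^sup>2) \<le> (ell2_norm S h)\<^sup>2"
proof (rule tendsto_upperbound)
  show "((\<lambda>F. \<Sum>p\<in>P. \<Sum>w\<in>F. (cmod (h (p @ w)))\<^sup>2) \<longlongrightarrow> (\<Sum>p\<in>P. (ell2_norm UNIV (\<lambda>w. h (p @ w)))\<^sup>2))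
      (finite_subsets_at_top UNIV)"
    unfolding ell2_norm_power2
    by (intro tendsto_sum infsum_tendsto) (use prefix_ell2[OF h] in \<open>simp add: ell2_def\<close>)
  show "eventually (\<lambda>F. (\<Sum>p\<in>P. \<Sum>w\<in>F. (cmod (h (p @ w)))\<^sup>2) \<le> (ell2_norm S h)\<^sup>2) (finite_subsets_at_top UNIV)"
  proof (rule eventually_finite_subsets_at_top_weakI)
    fix F :: "'a list set" assume F: "finite F"
    have inj: "inj_on (\<lambda>(p, w). p @ w) (P \<times> F)" using len by (auto simp: inj_on_def)
    have "(\<Sum>p\<in>P. \<Sum>w\<in>F. (cmod (h (p @ w)))\<^sup>2) = (\<Sum>v\<in>(\<lambda>(p, w). p @ w) ` (P \<times> F). (cmod (h v))\<^sup>2)"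
      unfolding sum.reindex[OF inj] by (simp add: sum.cartesian_product case_prod_beta)
    also have "\<dots> \<le> (ell2_norm S h)\<^sup>2" using P F by (intro sum_le_ell2_norm h) simp
    finally show "(\<Sum>p\<in>P. \<Sum>w\<in>F. (cmod (h (p @ w)))\<^sup>2) \<le> (ell2_norm S h)\<^sup>2" .
  qed
qed simp

interpretation free: group "free_group :: ('i \<times> bool) list monoid"
  by (rule group_free_group)

lemma carrier_free_group: "w \<in> carrier free_group \<longleftrightarrow> reduced_word w"
  by (simp add: free_group_def)

lemma not_reduced_zero: "f \<in> ell2 (carrier free_group) \<Longrightarrow> \<not> reduced_word w \<Longrightarrow> f w = 0"
  by (simp add: ell2_def carrier_free_group)

lemma inv_free_gen: "inv\<^bsub>free_group\<^esub> (free_gen j) = [(j, False)]"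
  by (rule free.inv_equality) (simp_all add: free_group_def free_gen_def opposite_def reduced_word_def)

lemma free_gen_mult_inv:
  "free_gen i \<otimes>\<^bsub>free_group\<^esub> inv\<^bsub>free_group\<^esub> (free_gen j) = (if i = j then [] else [(i, True), (j, False)])"
  unfolding inv_free_gen by (simp add: free_group_def free_gen_def opposite_def)

text \<open>Summing over w = x^-1 y puts the product x w into \<open>g\<close>, where the
  cancellation can be read off from the first letters of w.\<close>

lemma coefficient_reindex:
  fixes G (structure)
  assumes "group G" and x: "x \<in> carrier G" and f: "f \<in> ell2 (carrier G)" and g: "g \<in> ell2 (carrier G)"
  shows "((\<lambda>w. f w * cnj (g (x \<otimes> w))) has_sum coefficient G f g x) (carrier G)"
proof -
  interpret group G by fact
  have "((\<lambda>y. f (inv x \<otimes> y) * cnj (g (x \<otimes> (inv x \<otimes> y)))) has_sum coefficient G f g x) (carrier G)"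
  proof -
    have "(\<lambda>y. left_regular G x f y * cnj (g y)) summable_on carrier G"
      by (rule ell2_inner_summable[OF left_regular_in_ell2[OF x f] g])
    then have "((\<lambda>y. left_regular G x f y * cnj (g y)) has_sum coefficient G f g x) (carrier G)"
      using x by (simp add: coefficient_def ell2_inner_def)
    then show ?thesis
      by (rule has_sum_cong[THEN iffD1, rotated]) (use x f in \<open>simp add: left_regular_def\<close>)
  qed
  then show ?thesis
    using has_sum_reindex_bij_betw[OF bij_left_translation[OF x], of "\<lambda>w. f w * cnj (g (x \<otimes> w))"] by simp
qed

text \<open>
  Left multiplication of \<open>w\<close> by \<open>x\<^sub>i x\<^sub>j\<^sup>-\<^sup>1\<close> cancels no letter, one letter or two letters. Terms where the
  wrong number of cancellations is assumed vanish because \<open>f\<close> and \<open>g\<close> are zero on unreduced words.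
\<close>

lemma coefficient_length_two:
  assumes f: "f \<in> ell2 (carrier free_group)" and g: "g \<in> ell2 (carrier free_group)" and ij: "i \<noteq> j"
  shows "coefficient free_group f g [(i, True), (j, False)] =
    ell2_inner UNIV f (\<lambda>w. g ([(i, True), (j, False)] @ w))
    + ell2_inner UNIV (\<lambda>w. f ([(j, True)] @ w)) (\<lambda>w. g ([(i, True)] @ w))
    + ell2_inner UNIV (\<lambda>w. f ([(j, True), (i, False)] @ w)) g"
proof -
  define x where "x = [(i, True), (j, False)]"
  define t where "t w = f w * cnj (g (push (i, True) (push (j, False) w)))" for w
  have fU: "f \<in> ell2 UNIV" and gU: "g \<in> ell2 UNIV" using f g ell2_mono by blast+
  have x: "x \<in> carrier free_group" using ij by (simp add: x_def carrier_free_group reduced_word_def opposite_def)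
  have "((\<lambda>w. f w * cnj (g (x \<otimes>\<^bsub>free_group\<^esub> w))) has_sum coefficient free_group f g x) (carrier free_group)"
    by (rule coefficient_reindex[OF group_free_group x f g])
  \<comment> \<open>Unreduced words contribute 0, so the sum may run over all lists.\<close>
  then have "(t has_sum coefficient free_group f g x) UNIV"
    by (rule has_sum_cong_neutral[THEN iffD1, rotated -1])
      (auto simp: t_def x_def free_group_def not_reduced_zero[OF f, unfolded free_group_def])
  \<comment> \<open>In \<open>B\<close> only the letter x_j cancels, in \<open>C\<close> both x_j
    and x_i^-1, in \<open>A\<close> nothing.\<close>
  define B where "B = Cons (j, True) ` {w. \<forall>v. w \<noteq> (i, False) # v}"
  define C where "C = (\<lambda>w. (j, True) # (i, False) # w) ` UNIV"
  define A where "A = {w. \<forall>v. w \<noteq> (j, True) # v}"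
  have UNIV_eq: "UNIV = A \<union> (B \<union> C)" by (auto simp: A_def B_def C_def)
  have disj: "A \<inter> (B \<union> C) = {}" "B \<inter> C = {}" by (auto simp: A_def B_def C_def)
  have inner: "((\<lambda>w. p w * cnj (q w)) has_sum ell2_inner UNIV p q) UNIV" if "p \<in> ell2 UNIV" "q \<in> ell2 UNIV" for p q
    unfolding ell2_inner_def by (rule has_sum_infsum[OF ell2_inner_summable[OF that]])
  have "(t has_sum ell2_inner UNIV f (\<lambda>w. g (x @ w))) A"
  proof (rule has_sum_cong_neutral[THEN iffD1, rotated -1, OF inner[OF fU prefix_ell2[OF g]]])
    show "f w * cnj (g (x @ w)) = 0" if "w \<in> UNIV - A" for w
    proof -
      from that obtain v where "w = (j, True) # v" by (auto simp: A_def)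
      then have "\<not> reduced_word (x @ w)" by (simp add: x_def reduced_word_def opposite_def)
      then show ?thesis by (simp add: not_reduced_zero[OF g])
    qed
    show "f w * cnj (g (x @ w)) = t w" if "w \<in> UNIV \<inter> A" for w
    proof -
      have "push (j, False) w = (j, False) # w"
        using that by (cases w) (auto simp: A_def opposite_def)
      then show ?thesis using ij by (simp add: t_def x_def opposite_def)
    qed
  qed simp
  moreover have "(t has_sum ell2_inner UNIV (\<lambda>w. f ([(j, True)] @ w)) (\<lambda>w. g ([(i, True)] @ w))) B"
  proof -
    have "((\<lambda>w. t ((j, True) # w)) has_sum ell2_inner UNIV (\<lambda>w. f ([(j, True)] @ w)) (\<lambda>w. g ([(i, True)] @ w)))
        {w. \<forall>v. w \<noteq> (i, False) # v}"
    proof (rule has_sum_cong_neutral[THEN iffD1, rotated -1, OF inner[OF prefix_ell2[OF f] prefix_ell2[OF g]]])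
      show "f ([(j, True)] @ w) * cnj (g ([(i, True)] @ w)) = 0" if "w \<in> UNIV - {w. \<forall>v. w \<noteq> (i, False) # v}" for w
      proof -
        from that obtain v where "w = (i, False) # v" by auto
        then have "\<not> reduced_word ([(i, True)] @ w)" by (simp add: reduced_word_def opposite_def)
        from not_reduced_zero[OF g this] show ?thesis by simp
      qed
      show "f ([(j, True)] @ w) * cnj (g ([(i, True)] @ w)) = t ((j, True) # w)"
        if "w \<in> UNIV \<inter> {w. \<forall>v. w \<noteq> (i, False) # v}" for w
      proof -
        have "push (i, True) w = (i, True) # w"
          using that by (cases w) (auto simp: opposite_def)
        then show ?thesis by (simp add: t_def opposite_def)
      qed
    qed simp
    then show ?thesis unfolding B_def
      by (subst has_sum_reindex) (simp_all add: o_def)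
  qed
  moreover have "(t has_sum ell2_inner UNIV (\<lambda>w. f ([(j, True), (i, False)] @ w)) g) C"
  proof -
    have "((\<lambda>w. t ((j, True) # (i, False) # w)) has_sum ell2_inner UNIV (\<lambda>w. f ([(j, True), (i, False)] @ w)) g) UNIV"
      by (rule has_sum_cong[THEN iffD1, rotated, OF inner[OF prefix_ell2[OF f] gU]]) (simp add: t_def opposite_def)
    then show ?thesis unfolding C_def
      by (subst has_sum_reindex) (simp_all add: o_def inj_on_def)
  qed
  ultimately have "(t has_sum (ell2_inner UNIV f (\<lambda>w. g (x @ w))
      + (ell2_inner UNIV (\<lambda>w. f ([(j, True)] @ w)) (\<lambda>w. g ([(i, True)] @ w))
      + ell2_inner UNIV (\<lambda>w. f ([(j, True), (i, False)] @ w)) g))) UNIV"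
    unfolding UNIV_eq by (intro has_sum_Un_disjoint disj)
  with \<open>(t has_sum coefficient free_group f g x) UNIV\<close> show ?thesis
    using has_sum_unique by (fastforce simp: x_def add.assoc)
qed

text \<open>Apply Cauchy-Schwarz to each of the three terms. The outer ones sum over prefixes of
  length two of one function; the middle one is a product of prefixes of length one and factors
  after enlarging \<open>D\<close> to the product of its projections. The constant is 3 from (a + b
  + c)^2 \<le> 3 (a^2 + b^2 + c^2) times three terms.\<close>

lemma sum_coefficient_length_two:
  assumes f: "f \<in> ell2 (carrier free_group)" and g: "g \<in> ell2 (carrier free_group)"
    and D: "finite D" "\<And>i j. (i, j) \<in> D \<Longrightarrow> i \<noteq> j"
  shows "(\<Sum>(i, j)\<in>D. (cmod (coefficient free_group f g [(i, True), (j, False)]))\<^sup>2)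
    \<le> 9 * (ell2_norm (carrier free_group) f * ell2_norm (carrier free_group) g)\<^sup>2"
proof -
  let ?f = "ell2_norm (carrier free_group) f" and ?g = "ell2_norm (carrier free_group) g"
  let ?N = "ell2_norm UNIV"
  define g2 where "g2 i j = (?N (\<lambda>w. g ([(i, True), (j, False)] @ w)))\<^sup>2" for i j
  define f2 where "f2 i j = (?N (\<lambda>w. f ([(j, True), (i, False)] @ w)))\<^sup>2" for i j
  define g1 where "g1 i = (?N (\<lambda>w. g ([(i, True)] @ w)))\<^sup>2" for i
  define f1 where "f1 j = (?N (\<lambda>w. f ([(j, True)] @ w)))\<^sup>2" for j
  have fU: "f \<in> ell2 UNIV" and gU: "g \<in> ell2 UNIV" using f g ell2_mono by blast+
  have square3: "(a + b + c)\<^sup>2 \<le> 3 * (a\<^sup>2 + b\<^sup>2 + c\<^sup>2)" for a b c :: real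
    using sum_squares_bound[of a b] sum_squares_bound[of a c] sum_squares_bound[of b c]
    by (simp add: power2_eq_square algebra_simps)
  have CS: "(cmod (ell2_inner UNIV p q))\<^sup>2 \<le> (?N p)\<^sup>2 * (?N q)\<^sup>2" if "p \<in> ell2 UNIV" "q \<in> ell2 UNIV" for p q
    using power_mono[OF ell2_cauchy_schwarz[OF that], of 2] by (simp add: power_mult_distrib)
  have summand: "(cmod (coefficient free_group f g [(i, True), (j, False)]))\<^sup>2
      \<le> 3 * (?f\<^sup>2 * g2 i j + f1 j * g1 i + f2 i j * ?g\<^sup>2)" if "(i, j) \<in> D" for i j
  proof -
    let ?a = "ell2_inner UNIV f (\<lambda>w. g ([(i, True), (j, False)] @ w))"
    let ?b = "ell2_inner UNIV (\<lambda>w. f ([(j, True)] @ w)) (\<lambda>w. g ([(i, True)] @ w))"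
    let ?c = "ell2_inner UNIV (\<lambda>w. f ([(j, True), (i, False)] @ w)) g"
    have "cmod (coefficient free_group f g [(i, True), (j, False)]) \<le> cmod ?a + cmod ?b + cmod ?c"
      unfolding coefficient_length_two[OF f g D(2)[OF that]]
      by (meson norm_triangle_ineq order_trans add_right_mono)
    then have "(cmod (coefficient free_group f g [(i, True), (j, False)]))\<^sup>2 \<le> (cmod ?a + cmod ?b + cmod ?c)\<^sup>2"
      by (rule power_mono) simp
    also have "\<dots> \<le> 3 * ((cmod ?a)\<^sup>2 + (cmod ?b)\<^sup>2 + (cmod ?c)\<^sup>2)" by (rule square3)
    also have "\<dots> \<le> 3 * (?f\<^sup>2 * g2 i j + f1 j * g1 i + f2 i j * ?g\<^sup>2)"
      unfolding g2_def f1_def g1_def f2_def ell2_norm_UNIV[OF f, symmetric] ell2_norm_UNIV[OF g, symmetric]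
      by (intro mult_left_mono add_mono CS prefix_ell2[OF f] prefix_ell2[OF g] fU gU) simp
    finally show ?thesis .
  qed
  have sum_g2: "(\<Sum>(i, j)\<in>D. g2 i j) \<le> ?g\<^sup>2"
  proof -
    have inj: "inj_on (\<lambda>(i, j). [(i, True), (j, False)]) D" by (auto simp: inj_on_def)
    have "(\<Sum>(i, j)\<in>D. g2 i j) = (\<Sum>p\<in>(\<lambda>(i, j). [(i, True), (j, False)]) ` D. (?N (\<lambda>w. g (p @ w)))\<^sup>2)"
      unfolding sum.reindex[OF inj] by (simp add: g2_def case_prod_beta)
    also have "\<dots> \<le> ?g\<^sup>2" using D by (intro prefix_norm_sum[where n = 2] g) auto
    finally show ?thesis .
  qed
  have sum_f2: "(\<Sum>(i, j)\<in>D. f2 i j) \<le> ?f\<^sup>2"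
  proof -
    have inj: "inj_on (\<lambda>(i, j). [(j, True), (i, False)]) D" by (auto simp: inj_on_def)
    have "(\<Sum>(i, j)\<in>D. f2 i j) = (\<Sum>p\<in>(\<lambda>(i, j). [(j, True), (i, False)]) ` D. (?N (\<lambda>w. f (p @ w)))\<^sup>2)"
      unfolding sum.reindex[OF inj] by (simp add: f2_def case_prod_beta)
    also have "\<dots> \<le> ?f\<^sup>2" using D by (intro prefix_norm_sum[where n = 2] f) auto
    finally show ?thesis .
  qed
  have single: "(\<Sum>i\<in>I. (?N (\<lambda>w. h ([(i, True)] @ w)))\<^sup>2) \<le> (ell2_norm (carrier free_group) h)\<^sup>2"
    if "finite I" "h \<in> ell2 (carrier free_group)" for I :: "'a set" and h
  proof -
    have "(\<Sum>i\<in>I. (?N (\<lambda>w. h ([(i, True)] @ w)))\<^sup>2) = (\<Sum>p\<in>(\<lambda>i. [(i, True)]) ` I. (?N (\<lambda>w. h (p @ w)))\<^sup>2)"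
      by (simp add: sum.reindex inj_on_def)
    also have "\<dots> \<le> (ell2_norm (carrier free_group) h)\<^sup>2"
      using that by (intro prefix_norm_sum[where n = 1]) auto
    finally show ?thesis .
  qed
  have sum_fg: "(\<Sum>(i, j)\<in>D. f1 j * g1 i) \<le> ?f\<^sup>2 * ?g\<^sup>2"
  proof -
    have "(\<Sum>(i, j)\<in>D. f1 j * g1 i) \<le> (\<Sum>(i, j)\<in>fst ` D \<times> snd ` D. f1 j * g1 i)"
      using D(1) by (intro sum_mono2) (force simp: f1_def g1_def)+
    also have "\<dots> = (\<Sum>j\<in>snd ` D. f1 j) * (\<Sum>i\<in>fst ` D. g1 i)"
      by (subst sum.cartesian_product[symmetric], subst sum.swap) (simp add: sum_product)
    also have "\<dots> \<le> ?f\<^sup>2 * ?g\<^sup>2"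
      unfolding f1_def g1_def using D(1) f g by (intro mult_mono single sum_nonneg) auto
    finally show ?thesis .
  qed
  have "(\<Sum>(i, j)\<in>D. (cmod (coefficient free_group f g [(i, True), (j, False)]))\<^sup>2)
      \<le> (\<Sum>(i, j)\<in>D. 3 * (?f\<^sup>2 * g2 i j + f1 j * g1 i + f2 i j * ?g\<^sup>2))"
    using summand by (intro sum_mono) auto
  also have "\<dots> = 3 * (?f\<^sup>2 * (\<Sum>(i, j)\<in>D. g2 i j) + (\<Sum>(i, j)\<in>D. f1 j * g1 i) + (\<Sum>(i, j)\<in>D. f2 i j) * ?g\<^sup>2)"
    by (simp add: case_prod_beta sum_distrib_left sum_distrib_right sum.distrib)
  also have "\<dots> \<le> 3 * (?f\<^sup>2 * ?g\<^sup>2 + ?f\<^sup>2 * ?g\<^sup>2 + ?f\<^sup>2 * ?g\<^sup>2)"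
    by (intro mult_left_mono mult_right_mono add_mono sum_g2 sum_f2 sum_fg) simp_all
  also have "\<dots> = 9 * (?f * ?g)\<^sup>2" by (simp add: power_mult_distrib)
  finally show ?thesis .
qed

text \<open>The empty word, arising from i = j, adds at most 1 to the constant 9, and 10 \<le>
  4^2.\<close>

lemma free_group_restricts_to_ell2:
  fixes E :: "('i \<times> bool) list set"
  assumes E: "E \<subseteq> insert [] {[(i, True), (j, False)] | i j. i \<noteq> j}"
  shows "restricts_to_ell2 free_group E 4"
  unfolding restricts_to_ell2_def
proof (intro conjI ballI allI impI)
  show "E \<subseteq> carrier free_group"
    using E by (auto simp: carrier_free_group reduced_word_def opposite_def)
  fix f g :: "('i \<times> bool) list \<Rightarrow> complex" and F
  assume f: "f \<in> ell2 (carrier free_group)" and g: "g \<in> ell2 (carrier free_group)"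
    and F: "finite F \<and> F \<subseteq> E"
  let ?u = "\<lambda>x. (cmod (coefficient free_group f g x))\<^sup>2"
  let ?n = "ell2_norm (carrier free_group) f * ell2_norm (carrier free_group) g"
  define D where "D = (\<lambda>x. (fst (x ! 0), fst (x ! 1))) ` (F - {[]})"
  have word: "x = [(fst (x ! 0), True), (fst (x ! 1), False)] \<and> fst (x ! 0) \<noteq> fst (x ! 1)" if "x \<in> F - {[]}" for x
    using that F E by auto
  have F_eq: "F - {[]} = (\<lambda>(i, j). [(i, True), (j, False)]) ` D"
    unfolding D_def image_image case_prod_conv using word by force
  have "(\<Sum>x\<in>F - {[]}. ?u x) = (\<Sum>(i, j)\<in>D. ?u [(i, True), (j, False)])"
    unfolding F_eq by (subst sum.reindex) (auto simp: inj_on_def case_prod_beta intro!: sum.cong)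
  also have "\<dots> \<le> 9 * ?n\<^sup>2"
    using F word by (intro sum_coefficient_length_two f g) (auto simp: D_def)
  finally have *: "(\<Sum>x\<in>F - {[]}. ?u x) \<le> 9 * ?n\<^sup>2" .
  have one: "[] \<in> carrier free_group" by (simp add: carrier_free_group reduced_word_def)
  have "cmod (coefficient free_group f g []) \<le> ?n"
    using ell2_cauchy_schwarz[OF free.left_regular_in_ell2[OF one f] g] one
    by (simp add: coefficient_def free.ell2_norm_left_regular[OF one f])
  then have "?u [] \<le> ?n\<^sup>2" by (rule power_mono) simp
  moreover have "(\<Sum>x\<in>F. ?u x) \<le> ?u [] + (\<Sum>x\<in>F - {[]}. ?u x)"
    using F by (cases "[] \<in> F") (simp_all add: sum.remove)
  ultimately have "(\<Sum>x\<in>F. ?u x) \<le> 16 * ?n\<^sup>2" using * zero_le_power2[of ?n] by linarith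
  then show "(\<Sum>x\<in>F. ?u x) \<le> (4 * ?n)\<^sup>2" by (simp add: power_mult_distrib)
qed simp

section \<open>Unboundedness of triangular truncation\<close>

text \<open>
  The matrix of the operator \<open>\<Sum>\<^sub>k \<epsilon>\<^sub>k E\<^sub>k\<close> on functions on \<open>{0,1}\<^sup>n\<close>, where \<open>E\<^sub>k\<close> averages over the lowest
  \<open>k\<close> bits and \<open>\<epsilon>\<^sub>k\<close> multiplies by the sign \<open>\<plusminus>1\<close> of the highest of these bits. The summands have
  orthogonal ranges, so the norm is at most \<open>\<surd>n\<close>, but the upper triangular part has
  entry sum \<open>2\<^sup>n n / 4\<close>.
\<close>

fun dyadic_matrix :: "nat \<Rightarrow> nat \<Rightarrow> nat \<Rightarrow> complex" where
  "dyadic_matrix 0 i j = 0"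
| "dyadic_matrix (Suc n) i j =
    (if i < 2 ^ n then (if j < 2 ^ n then dyadic_matrix n i j else 0) + 1 / 2 ^ Suc n
     else (if j < 2 ^ n then 0 else dyadic_matrix n (i - 2 ^ n) (j - 2 ^ n)) - 1 / 2 ^ Suc n)"

lemma sum_lessThan_double: "sum h {..<2 * N} = sum h {..<N} + (\<Sum>i<N. h (N + i))" for h :: "nat \<Rightarrow> 'a::comm_monoid_add"
proof -
  have "sum h {..<N + N} = sum h {..<N} + sum h {N..<N + N}"
    by (simp add: lessThan_atLeast0 sum.atLeastLessThan_concat)
  also have "sum h {N..<N + N} = (\<Sum>i<N. h (N + i))"
    using sum.shift_bounds_nat_ivl[of h 0 N N] by (simp add: lessThan_atLeast0 add.commute)
  finally show ?thesis by (simp add: mult_2)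
qed

text \<open>The range consists of vectors with entry sum 0, hence is orthogonal to the constants
  added at the next level.\<close>

lemma dyadic_column_sum: "j < 2 ^ n \<Longrightarrow> (\<Sum>i<2 ^ n. dyadic_matrix n i j) = 0"
proof (induction n arbitrary: j)
  case (Suc n)
  show ?case
  proof (cases "j < 2 ^ n")
    case True
    then show ?thesis using Suc.IH[OF True]
      by (simp add: sum_lessThan_double sum.distrib sum_negf)
  next
    case False
    then have "j - 2 ^ n < 2 ^ n" using Suc.prems by simp
    then show ?thesis using False Suc.IH[of "j - 2 ^ n"]
      by (simp add: sum_lessThan_double sum.distrib sum_subtractf)
  qed
qed simp

text \<open>Pythagoras: constant vectors are orthogonal to vectors with entry sum 0.\<close>

lemma sum_cmod_shift:
  fixes w :: "nat \<Rightarrow> complex"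
  assumes "(\<Sum>i<N. w i) = 0"
  shows "(\<Sum>i<N. (cmod (w i + s))\<^sup>2) = (\<Sum>i<N. (cmod (w i))\<^sup>2) + real N * (cmod s)\<^sup>2"
proof -
  have "(cmod (w i + s))\<^sup>2 = (cmod (w i))\<^sup>2 + 2 * Re (w i * cnj s) + (cmod s)\<^sup>2" for i
    unfolding cmod_power2 by (simp add: power2_eq_square algebra_simps)
  then have "(\<Sum>i<N. (cmod (w i + s))\<^sup>2) = (\<Sum>i<N. (cmod (w i))\<^sup>2) + 2 * (\<Sum>i<N. Re (w i * cnj s)) + real N * (cmod s)\<^sup>2"
    by (simp add: sum.distrib sum_distrib_left)
  also have "(\<Sum>i<N. Re (w i * cnj s)) = Re ((\<Sum>i<N. w i) * cnj s)"
    by (simp only: sum_distrib_right Re_sum)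
  finally show ?thesis using assms by simp
qed

text \<open>The new level adds +s to the upper half and -s to the lower half, where s is the mean of
  z. By orthogonality this contributes 2 N |s|^2, at most the squared norm of z, so each level
  raises the bound by one.\<close>

lemma dyadic_norm:
  "(\<Sum>i<2 ^ n. (cmod (\<Sum>j<2 ^ n. dyadic_matrix n i j * z j))\<^sup>2) \<le> real n * (\<Sum>j<2 ^ n. (cmod (z j))\<^sup>2)"
proof (induction n arbitrary: z)
  case (Suc n)
  define N :: nat where "N = 2 ^ n"
  have N: "N > 0" "2 ^ Suc n = 2 * N" by (simp_all add: N_def)
  define s where "s = (\<Sum>j<2 * N. z j) / of_nat (2 * N)"
  define p where "p i = (\<Sum>j<N. dyadic_matrix n i j * z j)" for i
  define q where "q i = (\<Sum>j<N. dyadic_matrix n i j * z (N + j))" for i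
  have col: "(\<Sum>i<N. \<Sum>j<N. dyadic_matrix n i j * w j) = 0" for w
    using dyadic_column_sum[of _ n] by (subst sum.swap) (simp add: N_def flip: sum_distrib_right)
  have upper: "(\<Sum>j<2 * N. dyadic_matrix (Suc n) i j * z j) = p i + s" if "i < N" for i
    using that unfolding s_def p_def
    by (simp add: sum_lessThan_double N_def[symmetric] distrib_right sum.distrib add_divide_distrib flip: sum_divide_distrib)
      (simp add: N_def)
  have lower: "(\<Sum>j<2 * N. dyadic_matrix (Suc n) (N + i) j * z j) = q i + (- s)" for i
    unfolding s_def q_def
    by (simp add: sum_lessThan_double N_def[symmetric] left_diff_distrib sum_subtractf add_divide_distrib sum_negf flip: sum_divide_distrib)
      (simp add: N_def)
  have "(\<Sum>i<2 * N. (cmod (\<Sum>j<2 * N. dyadic_matrix (Suc n) i j * z j))\<^sup>2)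
      = (\<Sum>i<N. (cmod (p i + s))\<^sup>2) + (\<Sum>i<N. (cmod (q i + (- s)))\<^sup>2)"
    by (subst sum_lessThan_double) (simp only: lower, simp add: upper del: dyadic_matrix.simps)
  also have "\<dots> = (\<Sum>i<N. (cmod (p i))\<^sup>2) + (\<Sum>i<N. (cmod (q i))\<^sup>2) + 2 * real N * (cmod s)\<^sup>2"
    using col by (subst sum_cmod_shift, simp add: p_def, subst sum_cmod_shift) (simp_all add: q_def)
  also have "\<dots> \<le> real n * (\<Sum>j<N. (cmod (z j))\<^sup>2) + real n * (\<Sum>j<N. (cmod (z (N + j)))\<^sup>2) + (\<Sum>j<2 * N. (cmod (z j))\<^sup>2)"
  proof (intro add_mono)
    show "(\<Sum>i<N. (cmod (p i))\<^sup>2) \<le> real n * (\<Sum>j<N. (cmod (z j))\<^sup>2)"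
      unfolding p_def N_def by (rule Suc.IH)
    show "(\<Sum>i<N. (cmod (q i))\<^sup>2) \<le> real n * (\<Sum>j<N. (cmod (z (N + j)))\<^sup>2)"
      unfolding q_def N_def by (rule Suc.IH)
    have "(cmod (\<Sum>j<2 * N. z j))\<^sup>2 \<le> (\<Sum>j<2 * N. cmod (z j))\<^sup>2"
      by (intro power_mono norm_sum) simp
    also have "\<dots> \<le> real (2 * N) * (\<Sum>j<2 * N. (cmod (z j))\<^sup>2)"
      using Cauchy_Schwarz_ineq_sum[of "\<lambda>_. 1" "\<lambda>j. cmod (z j)" "{..<2 * N}"] by simp
    finally have "(cmod (\<Sum>j<2 * N. z j))\<^sup>2 / real (2 * N) \<le> (\<Sum>j<2 * N. (cmod (z j))\<^sup>2)"
      using N by (simp add: field_simps)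
    moreover have "2 * real N * (cmod s)\<^sup>2 = (cmod (\<Sum>j<2 * N. z j))\<^sup>2 / real (2 * N)"
      using N unfolding s_def norm_divide power_divide by (simp add: power2_eq_square norm_mult)
    ultimately show "2 * real N * (cmod s)\<^sup>2 \<le> (\<Sum>j<2 * N. (cmod (z j))\<^sup>2)" by simp
  qed
  also have "\<dots> = real (Suc n) * (\<Sum>j<2 * N. (cmod (z j))\<^sup>2)"
    unfolding sum_lessThan_double by (simp add: algebra_simps)
  finally show ?case unfolding N(2) .
qed simp

text \<open>With N = 2^n, the constants +a and -a cancel in the triangular parts of the two diagonal
  blocks. The upper right block lies wholly above the diagonal and adds N^2 a = N / 2, so the sum
  doubles and grows by N / 2.\<close>

lemma dyadic_triangular_sum:
  "(\<Sum>i<2 ^ n. \<Sum>j<2 ^ n. if i \<le> j then dyadic_matrix n i j else 0) = of_real (2 ^ n * real n / 4)"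
proof (induction n)
  case (Suc n)
  define N :: nat where "N = 2 ^ n"
  define a :: complex where "a = 1 / 2 ^ Suc n"
  have N: "2 ^ Suc n = 2 * N" by (simp add: N_def)
  define M where "M i j = (if i \<le> j then dyadic_matrix (Suc n) i j else 0)" for i j
  define L where "L i j = (if i \<le> j then dyadic_matrix n i j else 0)" for i j
  have M: "M i j = L i j + (if i \<le> j then a else 0)" "M i (N + j) = a" "M (N + i) j = 0"
      "M (N + i) (N + j) = L i j - (if i \<le> j then a else 0)" if "i < N" "j < N" for i j
    using that by (auto simp: M_def L_def N_def a_def)
  have "(\<Sum>i<2 * N. \<Sum>j<2 * N. M i j) =
      (\<Sum>i<N. (\<Sum>j<N. M i j) + (\<Sum>j<N. M i (N + j))) + (\<Sum>i<N. (\<Sum>j<N. M (N + i) j) + (\<Sum>j<N. M (N + i) (N + j)))"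
    by (simp add: sum_lessThan_double)
  also have "\<dots> = (\<Sum>i<N. (\<Sum>j<N. L i j + (if i \<le> j then a else 0)) + (\<Sum>j<N. a))
      + (\<Sum>i<N. (\<Sum>j<N. 0) + (\<Sum>j<N. L i j - (if i \<le> j then a else 0)))"
    by (intro arg_cong2[where f = plus] sum.cong refl) (simp_all add: M)
  also have "\<dots> = 2 * (\<Sum>i<N. \<Sum>j<N. L i j) + of_nat N * of_nat N * a"
    by (simp add: sum.distrib sum_subtractf)
  also have "(\<Sum>i<N. \<Sum>j<N. L i j) = of_real (2 ^ n * real n / 4)"
    using Suc by (simp add: L_def N_def)
  also have "2 * complex_of_real (2 ^ n * real n / 4) + of_nat N * of_nat N * a = of_real (2 ^ Suc n * real (Suc n) / 4)"
    by (simp add: a_def N_def field_simps)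
  finally show ?case unfolding N M_def .
qed simp

text \<open>The truncated matrix has norm at most K \<surd>n, but its entry sum 2^n n / 4 is at most
  2^n times its norm. Hence \<surd>n \<le> 4 K for every n.\<close>

lemma triangular_truncation_unbounded:
  assumes "group G" and s: "\<And>k::nat. s k \<in> carrier G"
    and v: "\<And>k l. v (s k \<otimes>\<^bsub>G\<^esub> inv\<^bsub>G\<^esub> (s l)) = (if k \<le> l then 1 else 0)"
  shows "\<not> schur_bound G v K"
proof
  assume K: "schur_bound G v K"
  then have K0: "0 \<le> K" by (simp add: schur_bound_def)
  obtain n :: nat where n: "(4 * K)\<^sup>2 < real n" using reals_Archimedean2 by blast
  have n0: "0 < real n" using n zero_le_power2[of "4 * K"] by linarith
  let ?I = "{..<2 ^ n :: nat}"
  have "matrix_bound ?I (dyadic_matrix n) (sqrt (real n))"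
    unfolding matrix_bound_def
    by (intro allI L2_set_le_cmultI) (simp_all add: dyadic_norm)
  then have "matrix_bound ?I (\<lambda>k l. dyadic_matrix n k l * v (s k \<otimes>\<^bsub>G\<^esub> inv\<^bsub>G\<^esub> (s l))) (K * sqrt (real n))"
    using K s n0 unfolding schur_bound_def by auto
  \<comment> \<open>Test vector: constant 1, of norm \<open>sqrt (2 ^ n)\<close>.\<close>
  then have "L2_set (\<lambda>k. cmod (\<Sum>l\<in>?I. dyadic_matrix n k l * v (s k \<otimes>\<^bsub>G\<^esub> inv\<^bsub>G\<^esub> (s l)) * 1)) ?I
      \<le> K * sqrt (real n) * L2_set (\<lambda>l. cmod 1) ?I"
    unfolding matrix_bound_def by (rule spec)
  moreover have "(\<Sum>l\<in>?I. dyadic_matrix n k l * v (s k \<otimes>\<^bsub>G\<^esub> inv\<^bsub>G\<^esub> (s l)) * 1) =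
      (\<Sum>l\<in>?I. if k \<le> l then dyadic_matrix n k l else 0)" for k
    by (intro sum.cong) (auto simp: v)
  ultimately have L2: "L2_set (\<lambda>k. cmod (\<Sum>l\<in>?I. if k \<le> l then dyadic_matrix n k l else 0)) ?I
      \<le> K * sqrt (real n) * sqrt (2 ^ n)"
    by (simp add: L2_set_def)
  have "2 ^ n * real n / 4 = cmod (\<Sum>k\<in>?I. \<Sum>l\<in>?I. if k \<le> l then dyadic_matrix n k l else 0)"
    unfolding dyadic_triangular_sum norm_of_real by simp
  also have "\<dots> \<le> (\<Sum>k\<in>?I. \<bar>cmod (\<Sum>l\<in>?I. if k \<le> l then dyadic_matrix n k l else 0)\<bar> * \<bar>1\<bar>)"
    by (simp add: norm_sum)
  also have "\<dots> \<le> L2_set (\<lambda>k. cmod (\<Sum>l\<in>?I. if k \<le> l then dyadic_matrix n k l else 0)) ?I * L2_set (\<lambda>_. 1) ?I"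
    by (rule L2_set_mult_ineq)
  also have "\<dots> \<le> K * sqrt (real n) * sqrt (2 ^ n) * sqrt (2 ^ n)"
    using mult_right_mono[OF L2, of "sqrt (2 ^ n)"] by (simp add: L2_set_def)
  finally have "2 ^ n * (real n / 4) \<le> 2 ^ n * (K * sqrt (real n))" by (simp add: mult_ac)
  then have "sqrt (real n) * sqrt (real n) \<le> (4 * K) * sqrt (real n)" by simp
  then have "sqrt (real n) \<le> 4 * K" using n0 by (simp only: mult_le_cancel_right) auto
  then have "(sqrt (real n))\<^sup>2 \<le> (4 * K)\<^sup>2" by (rule power_mono) simp
  then show False using n by simp
qed

theorem corollary3p14:
  shows
    "(\<forall>E. Leinert_set F_infinity E \<longrightarrow>
        indicator E \<in> MA F_infinity - McbA F_infinity \<longrightarrow>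
        complemented (fourier_space F_infinity) (ideal_of F_infinity (carrier F_infinity - E)) \<and>
        complemented (fourier_space F_infinity) (ideal_of F_infinity E) \<and>
        \<not> completely_complemented (fourier_space F_infinity)
             (ideal_of F_infinity (carrier F_infinity - E)) \<and>
        \<not> completely_complemented (fourier_space F_infinity) (ideal_of F_infinity E) \<and>
        complemented (VN_space F_infinity)
          (annihilator F_infinity (ideal_of F_infinity (carrier F_infinity - E))) \<and>
        complemented (VN_space F_infinity) (annihilator F_infinity (ideal_of F_infinity E)) \<and>
        \<not> completely_complemented (VN_space F_infinity)
             (annihilator F_infinity (ideal_of F_infinity (carrier F_infinity - E))) \<and>
        \<not> completely_complemented (VN_space F_infinity)
             (annihilator F_infinity (ideal_of F_infinity E))) \<and>
     (let E = {free_gen i \<otimes>\<^bsub>F_infinity\<^esub> inv\<^bsub>F_infinity\<^esub> (free_gen j) | i j. i \<le> j} in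
        complemented (fourier_space F_infinity) (ideal_of F_infinity E) \<and>
        \<not> completely_weakly_complemented F_infinity (ideal_of F_infinity E))"
proof (intro conjI allI impI)
  fix E :: "(nat \<times> bool) list set"
  assume "Leinert_set F_infinity E" and McbA: "indicator E \<in> MA F_infinity - McbA F_infinity"
  then obtain C where "restricts_to_ell2 F_infinity E C"
    using free.Leinert_restricts_to_ell2 by blast
  then interpret ell2_restricted F_infinity E C by unfold_locales
  show "complemented (fourier_space F_infinity) (ideal_of F_infinity (carrier F_infinity - E))"
    by (rule complemented_ideal_complement)
  show "complemented (fourier_space F_infinity) (ideal_of F_infinity E)"
    by (rule complemented_ideal)
  show "complemented (VN_space F_infinity) (annihilator F_infinity (ideal_of F_infinity (carrier F_infinity - E)))"
    by (rule complemented_annihilator_complement)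
  show "complemented (VN_space F_infinity) (annihilator F_infinity (ideal_of F_infinity E))"
    by (rule complemented_annihilator)
  \<comment> \<open>Contrapositive of \<open>indicator_McbA\<close>. The two variants below treat
    functions known to equal 1_E or 1 - 1_E only on the carrier.\<close>
  have no_schur: "\<not> schur_bound F_infinity (\<lambda>x. if x \<in> E then 1 else 0) K" for K
    using indicator_McbA McbA by blast
  have no_schur': "\<not> schur_bound F_infinity v K"
    if v: "\<And>x. x \<in> carrier F_infinity \<Longrightarrow> v x = (if x \<in> E then 1 else 0)" for v K
  proof
    assume "schur_bound F_infinity v K"
    from free.schur_bound_cong[OF v this] show False by (rule notE[OF no_schur])
  qed
  have no_schur_complement: "\<not> schur_bound F_infinity v K"
    if v: "\<And>x. x \<in> carrier F_infinity \<Longrightarrow> v x = (if x \<in> E then 0 else 1)" for v K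
  proof
    assume "schur_bound F_infinity v K"
    then have "schur_bound F_infinity (\<lambda>x. 1 - v x) (1 + K)" by (rule free.schur_bound_complement)
    then show False using no_schur'[of "\<lambda>x. 1 - v x"] v by simp
  qed
  show "\<not> completely_complemented (fourier_space F_infinity) (ideal_of F_infinity (carrier F_infinity - E))"
  proof
    assume "completely_complemented (fourier_space F_infinity) (ideal_of F_infinity (carrier F_infinity - E))"
    then obtain K where "schur_bound F_infinity (\<lambda>x. if x \<in> carrier F_infinity - E then 0 else 1) K"
      using free.schur_bound_fourier_complemented by blast
    moreover have "\<not> schur_bound F_infinity (\<lambda>x. if x \<in> carrier F_infinity - E then 0 else 1) K"
      by (rule no_schur') simp
    ultimately show False by contradiction
  qed
  show "\<not> completely_complemented (fourier_space F_infinity) (ideal_of F_infinity E)"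
  proof
    assume "completely_complemented (fourier_space F_infinity) (ideal_of F_infinity E)"
    then obtain K where "schur_bound F_infinity (\<lambda>x. if x \<in> E then 0 else 1) K"
      using free.schur_bound_fourier_complemented by blast
    moreover have "\<not> schur_bound F_infinity (\<lambda>x. if x \<in> E then 0 else 1) K"
      by (rule no_schur_complement) simp
    ultimately show False by contradiction
  qed
  show "\<not> completely_complemented (VN_space F_infinity)
      (annihilator F_infinity (ideal_of F_infinity (carrier F_infinity - E)))"
  proof
    assume "completely_complemented (VN_space F_infinity)
      (annihilator F_infinity (ideal_of F_infinity (carrier F_infinity - E)))"
    then obtain K where "schur_bound F_infinity (\<lambda>x. if x \<in> carrier F_infinity - E then 1 else 0) K"
      using free.schur_bound_VN_complemented by blast
    moreover have "\<not> schur_bound F_infinity (\<lambda>x. if x \<in> carrier F_infinity - E then 1 else 0) K"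
      by (rule no_schur_complement) simp
    ultimately show False by contradiction
  qed
  show "\<not> completely_complemented (VN_space F_infinity) (annihilator F_infinity (ideal_of F_infinity E))"
  proof
    assume "completely_complemented (VN_space F_infinity) (annihilator F_infinity (ideal_of F_infinity E))"
    from free.schur_bound_VN_complemented[OF this] obtain K
      where "schur_bound F_infinity (\<lambda>x. if x \<in> E then 1 else 0) K" by (elim exE)
    then show False by (rule notE[OF no_schur])
  qed
next
  let ?E = "{free_gen i \<otimes>\<^bsub>F_infinity\<^esub> inv\<^bsub>F_infinity\<^esub> (free_gen j) | i j. i \<le> j}"
  have "restricts_to_ell2 F_infinity ?E 4"
    by (rule free_group_restricts_to_ell2) (auto simp: free_gen_mult_inv)
  then interpret ell2_restricted F_infinity ?E 4 by unfold_locales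
  have no_schur: "\<not> schur_bound F_infinity (\<lambda>x. if x \<in> ?E then 1 else 0) K" for K
  proof (rule triangular_truncation_unbounded[OF group_free_group, of free_gen])
    show "free_gen k \<in> carrier F_infinity" for k
      by (simp add: carrier_free_group free_gen_def reduced_word_def)
    show "(if free_gen k \<otimes>\<^bsub>F_infinity\<^esub> inv\<^bsub>F_infinity\<^esub> (free_gen l) \<in> ?E then 1 else 0) = (if k \<le> l then 1 else (0::complex))"
      for k l
      \<comment> \<open>For k \<noteq> l the reduced word determines k and l, so it lies in the set
        exactly if k \<le> l; k = l gives the empty word, which belongs to it.\<close>
      by (auto simp: free_gen_mult_inv split: if_splits)
  qed
  have "\<not> completely_weakly_complemented F_infinity (ideal_of F_infinity ?E)"
    unfolding completely_weakly_complemented_def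
  proof
    assume "completely_complemented (VN_space F_infinity) (annihilator F_infinity (ideal_of F_infinity ?E))"
    from free.schur_bound_VN_complemented[OF this] obtain K
      where "schur_bound F_infinity (\<lambda>x. if x \<in> ?E then 1 else 0) K" by (elim exE)
    then show False by (rule notE[OF no_schur])
  qed
  then show "let E = ?E in complemented (fourier_space F_infinity) (ideal_of F_infinity E) \<and>
      \<not> completely_weakly_complemented F_infinity (ideal_of F_infinity E)"
    using complemented_ideal by (simp add: Let_def)
qed

end
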